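(* Let $A=(A_{i,j})_{i,j\in\mathbb Z}$ be a complex matrix such that for every $i\in\mathbb Z$, $A_{i,j}=0$ for $j\ll0$. Let $\tilde\Gamma^+_i=\sum_{j\in\mathbb Z}A_{i,j}\Gamma^+_j$, where $\Gamma^+_j$ are the vertex operators of Hall–Littlewood polynomials. Let $\lambda\in\mathbb Z^l$ and let $$\tilde F_\lambda=\tilde\Gamma^+_{-\lambda_1}\cdots\tilde\Gamma^+_{-\lambda_l}(1).$$ (a) $\tilde F_\lambda$ is a finite element of $\Lambda[t]$ and $\tilde F_\lambda=\sum_{\alpha\in\mathbb Z^l}A_{-\lambda_1,-\alpha_1}\cdots A_{-\lambda_l,-\alpha_l}F_\alpha$. (b) The family of symmetric polynomials $\tilde F_\lambda$ ($\lambda\in\mathbb Z^l$) satisfies the stability property $\tilde F_\lambda(x_1,\dots,x_n,0;t)=\tilde F_\lambda(x_1,\dots,x_n;t)$. (c) If $A$ is invertible, then for any $\alpha\in\mathbb Z^l$ $$F_\alpha=\sum_{\lambda\in\mathbb Z^l}(A^{-1})_{-\alpha_1,-\lambda_1}\cdots(A^{-1})_{-\alpha_l,-\lambda_l}\tilde F_\lambda.$$ (d) If $A$ is invertible, then the formal distribution $\mathcal F(u_1,\dots,u_l;t)$ has a re-expansion with coefficients $\tilde F_\lambda$: $$\mathcal F(u_1,\dots,u_l;t)=\sum_{\lambda\in\mathbb Z^l}\tilde F_\lambda\,g_{\lambda_1}(u_1)\cdots g_{\lambda_l}(u_l),$$ where $g_k(u)=\sum_{s\in\mathbb Z}(A^{-1})_{-s,-k}u^s$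 are complex-valued formal distributions. (e) Assume that $A_{i,j}=0$ for all $i<0$, $j\ge0$, and that $A_{0,j}=\delta_{0,j}$. Let $\lambda\in\mathbb N^l$, let $n\ge l$, and set $\lambda_{l+1}=\dots=\lambda_n=0$. Then $\tilde F_\lambda\in\Lambda[t]$ can be identified with the symmetric polynomial in $(x_1,\dots,x_n)$ with coefficients in $\mathbb C[t]$ given by $$\tilde F_\lambda(x_1,\dots,x_n;t)=\frac{(1-t)^n}{\prod_{i=1}^{n-l}(1-t^i)}\sum_{\sigma\in S_n}\sigma\left(f_{\lambda_1}(x_1)\cdots f_{\lambda_n}(x_n)\prod_{1\le i<j\le n}\frac{x_i-tx_j}{x_i-x_j}\right),$$ where $f_k(x)=\sum_{j=1}^{-M(-k)}A_{-k,-j}x^j$ ($k\in\mathbb N$) are complex-valued polynomials with zero constant coefficient ($f_k(0)=0$), $f_0(x)=1$, and $M(i)=\max\{k\in\mathbb Z: A_{i,r}=0\text{ for all }r<k\}$ is the position of the first non-zero entry in the $i$-th row of $A$.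
   Context: $\mathbb N=\{1,2,\dots\}$. $\Lambda=\mathbb C[p_1,p_2,\dots]$ is the ring of symmetric functions in $x_1,x_2,\dots$, with complete and elementary symmetric functions $h_k,e_k$; $f^\perp$ is the adjoint of multiplication by $f$ for the scalar product in which Schur functions are orthonormal ($p_n^\perp=n\,\partial/\partial p_n$). Put $H(u)=\sum_{k\ge0}h_ku^k$, $E(u)=\sum_{k\ge0}e_ku^k$, $E^\perp(u)=\sum_{k\ge0}e_k^\perp u^{-k}$. With $t$ an indeterminate, $\Gamma^+(u)=\sum_{k\in\mathbb Z}\Gamma_k^+u^{-k}=E(-tu)H(u)E^\perp(-u)$ is a series of operators acting on $\Lambda[[t]]$; they preserve $\Lambda[t]$, and for each $f\in\Lambda[t]$, $\Gamma^+_k(f)=0$ for $k\gg0$. Let $$\mathcal F(u_1,\dots,u_l;t)=\prod_{1\le i<j\le l}\Big(1+\sum_{s\ge1}(t^s-t^{s-1})\big(\tfrac{u_j}{u_i}\big)^s\Big)\prod_{i=1}^lE(-tu_i)H(u_i)=\sum_{\lambda\in\mathbb Z^l}F_\lambda\,u_1^{\lambda_1}\cdots u_l^{\lambda_l},$$ where the first factors are the expansions of $\frac{u_i-u_j}{u_i-tu_j}$ in $|tu_j|<|u_i|$. One has $\mathcal F(u_1,\dots,u_l;t)=\Gamma^+(u_1)\cdots\Gamma^+(u_l)(1)$, i.e. $F_\lambda=\Gamma^+_{-\lambda_1}\cdots\Gamma^+_{-\lambda_l}(1)\in\Lambda[t]$. For $F\in\Lambda[t]$, $F(x_1,\dots,x_n;t)$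 denotes the symmetric polynomial obtained by setting $x_{n+1}=x_{n+2}=\dots=0$. $S_n$ acts by permuting $x_1,\dots,x_n$. $B=(B_{i,j})_{i,j\in\mathbb Z}$ is the (left) inverse of $A$, written $B=A^{-1}$, if $\sum_{k\in\mathbb Z}B_{i,k}A_{k,j}=\delta_{i,j}$; $A$ is invertible if it has such an inverse. *)

theory Defs
  imports
    "HOL-Analysis.Analysis"
    "HOL-Library.Poly_Mapping"
    "HOL-Computational_Algebra.Polynomial_FPS"
    "HOL-Computational_Algebra.Fraction_Field"
    "HOL-Combinatorics.Permutations"
begin

section \<open>Polynomials in countably many variables\<close>

type_synonym 'a mpoly = "(nat \<Rightarrow>\<^sub>0 nat) \<Rightarrow>\<^sub>0 'a"

definition Const :: "'a::zero \<Rightarrow> 'a mpoly" where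
  "Const c = Poly_Mapping.single 0 c"

definition Var :: "nat \<Rightarrow> 'a::zero_neq_one mpoly" where
  "Var i = Poly_Mapping.single (Poly_Mapping.single i 1) 1"

text \<open>The value of a polynomial when its coefficients are mapped by \<open>h\<close> and \<open>v i\<close> is
  substituted for the \<open>i\<close>-th variable.\<close>

definition eval_mpoly :: "('a::zero \<Rightarrow> 'b::comm_semiring_1) \<Rightarrow> (nat \<Rightarrow> 'b) \<Rightarrow> 'a mpoly \<Rightarrow> 'b" where
  "eval_mpoly h v f =
     (\<Sum>m\<in>Poly_Mapping.keys f.
        h (Poly_Mapping.lookup f m) * (\<Prod>i\<in>Poly_Mapping.keys m. v i ^ Poly_Mapping.lookup m i))"


section \<open>The ring of symmetric functions\<close>

text \<open>\<open>\<Lambda> = \<complex>[p\<^sub>1, p\<^sub>2, \<dots>]\<close>; the variable with index \<open>k\<close> stands for the power sum \<open>p\<^sub>k\<^sub>+\<^sub>1\<close>, so that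
  there is no superfluous variable. A monomial \<open>m\<close> is the product of the \<open>p\<^sub>k\<^sub>+\<^sub>1\<close> to the powers
  \<open>lookup m k\<close>.\<close>

type_synonym sym = "complex mpoly"

definition psym :: "nat \<Rightarrow> sym" where
  "psym n = Var (n - 1)"

text \<open>\<open>h\<^sub>k\<close> and \<open>e\<^sub>k\<close> as polynomials in the power sums, by Newton's identities
  \<open>k h\<^sub>k = \<Sum>\<^sub>i p\<^sub>i h\<^sub>k\<^sub>-\<^sub>i\<close> and \<open>k e\<^sub>k = \<Sum>\<^sub>i (-1)\<^sup>i\<^sup>-\<^sup>1 p\<^sub>i e\<^sub>k\<^sub>-\<^sub>i\<close>. That they specialise to the complete and the
  elementary symmetric polynomials in \<open>x\<^sub>1, \<dots>, x\<^sub>n\<close> is proved below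
  (\<open>sym_at_hsym\<close>, \<open>sym_at_esym\<close>).\<close>

fun hsym :: "nat \<Rightarrow> sym" where
  "hsym 0 = 1"
| "hsym (Suc k) = Const (1 / of_nat (Suc k)) * (\<Sum>i\<le>k. psym (Suc i) * hsym (k - i))"

fun esym :: "nat \<Rightarrow> sym" where
  "esym 0 = 1"
| "esym (Suc k) =
     Const (1 / of_nat (Suc k)) * (\<Sum>i\<le>k. (-1) ^ i * psym (Suc i) * esym (k - i))"

text \<open>The Hall scalar product (extended bilinearly), for which the Schur functions are orthonormal:
  the products \<open>p\<^sub>\<mu>\<close> of power sums are orthogonal and \<open>\<langle>p\<^sub>\<mu>, p\<^sub>\<mu>\<rangle> = z\<^sub>\<mu>\<close>. It is the only bilinear form
  with \<open>\<langle>1, 1\<rangle> = 1\<close> for which the adjoint of multiplication by \<open>p\<^sub>n\<close> is \<open>n \<partial>/\<partial>p\<^sub>n\<close>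
  (\<open>perp_adjoint\<close> and \<open>perp_psym\<close> below).\<close>

definition zee :: "(nat \<Rightarrow>\<^sub>0 nat) \<Rightarrow> nat" where
  "zee m =
     (\<Prod>k\<in>Poly_Mapping.keys m. Suc k ^ Poly_Mapping.lookup m k * fact (Poly_Mapping.lookup m k))"

definition hall_inner :: "sym \<Rightarrow> sym \<Rightarrow> complex" where
  "hall_inner f g =
     (\<Sum>m\<in>Poly_Mapping.keys f. of_nat (zee m) * Poly_Mapping.lookup f m * Poly_Mapping.lookup g m)"

definition perp :: "sym \<Rightarrow> sym \<Rightarrow> sym" where
  "perp f g = (THE g'. \<forall>q. hall_inner g' q = hall_inner g (f * q))"


section \<open>Vertex operators of Hall--Littlewood functions\<close>

text \<open>Elements of \<open>\<Lambda>[[t]]\<close> have type \<open>sym fps\<close>, and \<open>\<Lambda>[t]\<close> is the range of \<open>fps_of_poly\<close>.\<close>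

definition scalar :: "complex \<Rightarrow> sym fps" where
  "scalar c = fps_const (Const c)"

text \<open>The coefficient of \<open>t\<^sup>n\<close> and of the monomial \<open>m\<close> in the power sums.\<close>

definition coeff_at :: "sym fps \<Rightarrow> nat \<Rightarrow> (nat \<Rightarrow>\<^sub>0 nat) \<Rightarrow> complex" where
  "coeff_at f n m = Poly_Mapping.lookup (fps_nth f n) m"

text \<open>Sum of a family in \<open>\<Lambda>[[t]]\<close> in which every power of \<open>t\<close> occurs in finitely many members only;
  this is the case in the two definitions where it is used.\<close>

definition fps_fam_sum :: "('i \<Rightarrow> sym fps) \<Rightarrow> 'i set \<Rightarrow> sym fps" where
  "fps_fam_sum f S = Abs_fps (\<lambda>n. sum' (\<lambda>a. fps_nth (f a) n) S)"

text \<open>The coefficient of \<open>u\<^sup>k\<close> in \<open>E(-tu) H(u)\<close>.\<close>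

definition hl_q :: "int \<Rightarrow> sym fps" where
  "hl_q k = (if k < 0 then 0
             else \<Sum>i\<le>nat k. (- fps_X) ^ i * fps_const (esym i * hsym (nat k - i)))"

text \<open>\<open>\<Gamma>\<^sup>+\<^sub>k\<close> is the coefficient of \<open>u\<^sup>-\<^sup>k\<close> in \<open>E(-tu) H(u) \<Sum>\<^sub>m (-1)\<^sup>m e\<^sub>m\<^sup>\<bottom> u\<^sup>-\<^sup>m\<close>, where \<open>e\<^sub>m\<^sup>\<bottom>\<close> acts on the
  coefficients of a power series in \<open>t\<close>.\<close>

definition hl_Gamma :: "int \<Rightarrow> sym fps \<Rightarrow> sym fps" where
  "hl_Gamma k f =
     fps_fam_sum
       (\<lambda>m. (-1) ^ m * hl_q (int m - k) * Abs_fps (\<lambda>n. perp (esym m) (fps_nth f n))) UNIV"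

definition tGamma :: "(int \<Rightarrow> int \<Rightarrow> complex) \<Rightarrow> int \<Rightarrow> sym fps \<Rightarrow> sym fps" where
  "tGamma A i f = fps_fam_sum (\<lambda>j. scalar (A i j) * hl_Gamma j f) UNIV"

text \<open>\<open>\<int>\<^sup>l\<close>: the components are those with index \<open>1, \<dots>, l\<close>, continued by zero.\<close>

definition Zvec :: "nat \<Rightarrow> (nat \<Rightarrow> int) set" where
  "Zvec l = {v. \<forall>i. i \<notin> {1..l} \<longrightarrow> v i = 0}"

definition pairs :: "nat \<Rightarrow> (nat \<times> nat) set" where
  "pairs l = {(i, j). 1 \<le> i \<and> i < j \<and> j \<le> l}"

text \<open>The coefficient of \<open>x\<^sup>s\<close> in \<open>(1 - x) / (1 - t x)\<close>.\<close>

definition hl_c :: "nat \<Rightarrow> sym fps" where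
  "hl_c s = (if s = 0 then 1 else fps_X ^ s - fps_X ^ (s - 1))"

text \<open>\<open>hl_F l lam\<close> is the coefficient \<open>F\<^sub>\<lambda>\<close> of \<open>u\<^sub>1\<^bsup>\<lambda>\<^sub>1\<^esup> \<cdots> u\<^sub>l\<^bsup>\<lambda>\<^sub>l\<^esup>\<close> in the formal distribution
  \<open>\<F>(u\<^sub>1, \<dots>, u\<^sub>l; t)\<close>, which is thus \<open>hl_F l\<close>. The defining product is multiplied out: from the factor of
  a pair \<open>(i, j)\<close> one takes the term with \<open>(u\<^sub>j / u\<^sub>i)\<^sup>s\<close> for \<open>s = s (i, j)\<close>, and the factor
  \<open>E(-tu\<^sub>i) H(u\<^sub>i)\<close> has to supply the remaining power of \<open>u\<^sub>i\<close>. As \<open>hl_q\<close> vanishes at negative numbers,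
  only finitely many \<open>s\<close> contribute.\<close>

definition hl_F :: "nat \<Rightarrow> (nat \<Rightarrow> int) \<Rightarrow> sym fps" where
  "hl_F l lam =
     sum' (\<lambda>s. (\<Prod>p\<in>pairs l. hl_c (s p)) *
               (\<Prod>i=1..l. hl_q (lam i
                  + (\<Sum>j\<in>{i<..l}. int (s (i, j)))
                  - (\<Sum>j\<in>{1..<i}. int (s (j, i))))))
          (pairs l \<rightarrow>\<^sub>E UNIV)"

definition tF :: "(int \<Rightarrow> int \<Rightarrow> complex) \<Rightarrow> nat \<Rightarrow> (nat \<Rightarrow> int) \<Rightarrow> sym fps" where
  "tF A l lam = foldr (\<lambda>i. tGamma A (- lam i)) [1..<Suc l] 1"


section \<open>Infinite sums and inverse matrices\<close>

text \<open>The sums over \<open>\<int>\<close> and \<open>\<int>\<^sup>l\<close> that need not be finite are unconditionally convergent sums of complex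
  numbers (this comprises sums with finitely many non-zero terms); in \<open>\<Lambda>[[t]]\<close>, and for formal
  distributions in \<open>u\<^sub>1, \<dots>, u\<^sub>l\<close> with coefficients in \<open>\<Lambda>[[t]]\<close>, sums are taken coefficientwise.\<close>

definition left_inverse :: "(int \<Rightarrow> int \<Rightarrow> complex) \<Rightarrow> (int \<Rightarrow> int \<Rightarrow> complex) \<Rightarrow> bool" where
  "left_inverse B A \<longleftrightarrow>
     (\<forall>i j. ((\<lambda>k. B i k * A k j) has_sum (if i = j then 1 else 0)) UNIV)"

definition has_coeff_sum :: "('i \<Rightarrow> sym fps) \<Rightarrow> sym fps \<Rightarrow> 'i set \<Rightarrow> bool" where
  "has_coeff_sum f s S \<longleftrightarrow>
     (\<forall>n m. ((\<lambda>a. coeff_at (f a) n m) has_sum coeff_at s n m) S)"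

definition has_dist_sum ::
    "nat \<Rightarrow> ('i \<Rightarrow> (nat \<Rightarrow> int) \<Rightarrow> sym fps) \<Rightarrow> ((nat \<Rightarrow> int) \<Rightarrow> sym fps) \<Rightarrow> 'i set \<Rightarrow> bool" where
  "has_dist_sum l \<Phi> D S \<longleftrightarrow> (\<forall>\<alpha>\<in>Zvec l. has_coeff_sum (\<lambda>a. \<Phi> a \<alpha>) (D \<alpha>) S)"

text \<open>The formal distribution \<open>g\<^sub>k(u)\<close>, with \<open>B = A\<^sup>-\<^sup>1\<close>, as the function mapping \<open>s\<close> to the coefficient of
  \<open>u\<^sup>s\<close>, and the product \<open>g\<^sub>1(u\<^sub>1) \<cdots> g\<^sub>l(u\<^sub>l)\<close> of distributions in different variables.\<close>

definition g_dist :: "(int \<Rightarrow> int \<Rightarrow> complex) \<Rightarrow> int \<Rightarrow> int \<Rightarrow> complex" where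
  "g_dist B k s = B (- s) (- k)"

definition dist_prod :: "nat \<Rightarrow> (nat \<Rightarrow> int \<Rightarrow> complex) \<Rightarrow> (nat \<Rightarrow> int) \<Rightarrow> complex" where
  "dist_prod l g \<alpha> = (\<Prod>i=1..l. g i (\<alpha> i))"


section \<open>Symmetric polynomials\<close>

text \<open>\<open>\<complex>[t][x\<^sub>1, x\<^sub>2, \<dots>]\<close> and its field of fractions.\<close>

type_synonym xpoly = "complex poly mpoly"

text \<open>\<open>f(x\<^sub>1, \<dots>, x\<^sub>n)\<close> for \<open>f \<in> \<Lambda>\<close>: the substitution of \<open>x\<^sub>1\<^sup>k\<^sup>+\<^sup>1 + \<dots> + x\<^sub>n\<^sup>k\<^sup>+\<^sup>1\<close> for \<open>p\<^sub>k\<^sub>+\<^sub>1\<close>.\<close>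

definition sym_at :: "nat \<Rightarrow> sym \<Rightarrow> xpoly" where
  "sym_at n f = eval_mpoly (\<lambda>c. Const [:c:]) (\<lambda>k. \<Sum>j=1..n. Var j ^ Suc k) f"

text \<open>\<open>F(x\<^sub>1, \<dots>, x\<^sub>n; t)\<close> for \<open>F \<in> \<Lambda>[t]\<close>; irrelevant for other \<open>F \<in> \<Lambda>[[t]]\<close>.\<close>

definition at_vars :: "nat \<Rightarrow> sym fps \<Rightarrow> xpoly" where
  "at_vars n F =
     (let p = (THE p. fps_of_poly p = F)
      in \<Sum>k\<le>degree p. Const ([:0, 1:] ^ k) * sym_at n (coeff p k))"

definition subst_vars :: "(nat \<Rightarrow> xpoly) \<Rightarrow> xpoly \<Rightarrow> xpoly" where
  "subst_vars v f = eval_mpoly Const v f"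

definition symmetric_poly :: "nat \<Rightarrow> xpoly \<Rightarrow> bool" where
  "symmetric_poly n f \<longleftrightarrow> (\<forall>\<sigma>. \<sigma> permutes {1..n} \<longrightarrow> subst_vars (\<lambda>i. Var (\<sigma> i)) f = f)"

definition to_rat :: "xpoly \<Rightarrow> xpoly fract" where
  "to_rat f = Fraction_Field.Fract f 1"

definition X :: "nat \<Rightarrow> xpoly fract" where
  "X i = to_rat (Var i)"

definition T :: "xpoly fract" where
  "T = to_rat (Const [:0, 1:])"

text \<open>\<open>M(i)\<close>; the matrices in question have \<open>A i j = 0\<close> for \<open>j \<lless> 0\<close>. In a zero row, where \<open>M(i)\<close> does not
  exist, \<open>f_poly\<close> is zero for any value of \<open>M(i)\<close>.\<close>

definition first_nonzero :: "(int \<Rightarrow> int \<Rightarrow> complex) \<Rightarrow> int \<Rightarrow> int" where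
  "first_nonzero A i = (GREATEST k. \<forall>r<k. A i r = 0)"

definition f_poly :: "(int \<Rightarrow> int \<Rightarrow> complex) \<Rightarrow> int \<Rightarrow> complex poly" where
  "f_poly A k =
     (if k = 0 then 1 else \<Sum>j\<in>{1..- first_nonzero A (- k)}. monom (A (- k) (- j)) (nat j))"

text \<open>The expression under the sum over \<open>S\<^sub>n\<close> with \<open>y\<^sub>1, \<dots>, y\<^sub>n\<close> in place of \<open>x\<^sub>1, \<dots>, x\<^sub>n\<close>, so that
  \<open>\<sigma>\<close> transforms \<open>hl_term A n lam X\<close> into \<open>hl_term A n lam (X \<circ> \<sigma>)\<close>.\<close>

definition hl_term ::
    "(int \<Rightarrow> int \<Rightarrow> complex) \<Rightarrow> nat \<Rightarrow> (nat \<Rightarrow> int) \<Rightarrow> (nat \<Rightarrow> xpoly fract) \<Rightarrow> xpoly fract" where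
  "hl_term A n lam y =
     (\<Prod>i=1..n. poly (map_poly (\<lambda>c. to_rat (Const [:c:])) (f_poly A (lam i))) (y i)) *
     (\<Prod>(i, j)\<in>pairs n. (y i - T * y j) / (y i - y j))"


section \<open>Complete and elementary symmetric functions, the Hall scalar product\<close>

lemma pm_sum_singles:
  fixes f :: "'a \<Rightarrow>\<^sub>0 'b::comm_monoid_add"
  shows "f = (\<Sum>m\<in>Poly_Mapping.keys f. Poly_Mapping.single m (Poly_Mapping.lookup f m))"
proof (rule poly_mapping_eqI)
  fix k
  show "Poly_Mapping.lookup f k =
    Poly_Mapping.lookup (\<Sum>m\<in>Poly_Mapping.keys f. Poly_Mapping.single m (Poly_Mapping.lookup f m)) k"
    by (simp add: lookup_sum lookup_single when_def in_keys_iff)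
qed

lemma eval_mpoly_superset:
  assumes "finite S" "Poly_Mapping.keys f \<subseteq> S" "h 0 = 0"
  shows "eval_mpoly h v f =
    (\<Sum>m\<in>S. h (Poly_Mapping.lookup f m) * (\<Prod>i\<in>Poly_Mapping.keys m. v i ^ Poly_Mapping.lookup m i))"
  unfolding eval_mpoly_def
  by (rule sum.mono_neutral_left) (use assms in \<open>auto simp: in_keys_iff\<close>)

lemma eval_mpoly_add:
  assumes "h 0 = 0" "\<And>a b. h (a + b) = h a + h b"
  shows "eval_mpoly h v (f + g) = eval_mpoly h v f + eval_mpoly h v g"
proof -
  let ?S = "Poly_Mapping.keys f \<union> Poly_Mapping.keys g"
  have k: "Poly_Mapping.keys (f + g) \<subseteq> ?S" by (rule keys_add)
  show ?thesis
    by (simp add: eval_mpoly_superset[of ?S] k assms lookup_add ring_distribs sum.distrib)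
qed

lemma eval_mpoly_0: "eval_mpoly h v 0 = 0"
  by (simp add: eval_mpoly_def)

lemma eval_mpoly_sum:
  assumes "h 0 = 0" "\<And>a b. h (a + b) = h a + h b"
  shows "eval_mpoly h v (sum F S) = (\<Sum>a\<in>S. eval_mpoly h v (F a))"
  by (induction S rule: infinite_finite_induct) (simp_all add: eval_mpoly_0 eval_mpoly_add assms)

lemma eval_mpoly_single:
  assumes "h 0 = 0"
  shows "eval_mpoly h v (Poly_Mapping.single m c) =
    h c * (\<Prod>i\<in>Poly_Mapping.keys m. v i ^ Poly_Mapping.lookup m i)"
  by (subst eval_mpoly_superset[of "{m}"]) (use assms in auto)

lemma monomial_value_add:
  fixes v :: "nat \<Rightarrow> 'b::comm_semiring_1"
  shows "(\<Prod>i\<in>Poly_Mapping.keys (m + m'). v i ^ Poly_Mapping.lookup (m + m') i) =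
    (\<Prod>i\<in>Poly_Mapping.keys m. v i ^ Poly_Mapping.lookup m i) *
    (\<Prod>i\<in>Poly_Mapping.keys m'. v i ^ Poly_Mapping.lookup m' i)"
proof -
  let ?S = "Poly_Mapping.keys m \<union> Poly_Mapping.keys m'"
  have *: "(\<Prod>i\<in>Poly_Mapping.keys k. v i ^ Poly_Mapping.lookup k i) =
      (\<Prod>i\<in>?S. v i ^ Poly_Mapping.lookup k i)" if "Poly_Mapping.keys k \<subseteq> ?S" for k
    by (rule prod.mono_neutral_left) (use that in \<open>auto simp: in_keys_iff\<close>)
  have k: "Poly_Mapping.keys (m + m') \<subseteq> ?S" by (rule keys_add)
  show ?thesis
    unfolding *[OF k] *[OF Un_upper1] *[OF Un_upper2]
    by (simp add: lookup_add power_add prod.distrib)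
qed

lemma eval_mpoly_mult:
  assumes "h 0 = 0" "\<And>a b. h (a + b) = h a + h b" "\<And>a b. h (a * b) = h a * h b"
  shows "eval_mpoly h v (f * g) = eval_mpoly h v f * eval_mpoly h v g"
proof -
  let ?s = "\<lambda>f m. Poly_Mapping.single m (Poly_Mapping.lookup f m)"
  let ?mv = "\<lambda>m. \<Prod>i\<in>Poly_Mapping.keys m. v i ^ Poly_Mapping.lookup m i"
  have "f * g = (\<Sum>m\<in>Poly_Mapping.keys f. ?s f m) * (\<Sum>m\<in>Poly_Mapping.keys g. ?s g m)"
    using pm_sum_singles[of f] pm_sum_singles[of g] by simp
  also have "\<dots> = (\<Sum>m\<in>Poly_Mapping.keys f. \<Sum>m'\<in>Poly_Mapping.keys g.
      Poly_Mapping.single (m + m') (Poly_Mapping.lookup f m * Poly_Mapping.lookup g m'))"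
    by (simp add: sum_product mult_single)
  finally have "eval_mpoly h v (f * g) = (\<Sum>m\<in>Poly_Mapping.keys f. \<Sum>m'\<in>Poly_Mapping.keys g.
      (h (Poly_Mapping.lookup f m) * ?mv m) * (h (Poly_Mapping.lookup g m') * ?mv m'))"
    by (simp add: eval_mpoly_sum eval_mpoly_single assms monomial_value_add mult_ac)
  also have "\<dots> = eval_mpoly h v f * eval_mpoly h v g"
    by (simp add: eval_mpoly_def sum_product)
  finally show ?thesis .
qed

lemma eval_mpoly_Const: "h 0 = 0 \<Longrightarrow> eval_mpoly h v (Const c) = h c"
  by (simp add: Const_def eval_mpoly_single)

lemma eval_mpoly_Var: "h 0 = 0 \<Longrightarrow> h 1 = 1 \<Longrightarrow> eval_mpoly h v (Var i) = v i"
  by (simp add: Var_def eval_mpoly_single)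

lemma Const_hom: "Const 0 = 0" "Const 1 = 1"
  "Const (a + b) = Const a + Const (b :: 'a::comm_ring_1)" "Const (a * b) = Const a * Const (b :: 'a::comm_ring_1)"
  by (simp_all add: Const_def single_add mult_single)

abbreviation (input) cc :: "complex \<Rightarrow> xpoly" where "cc c \<equiv> Const [:c:]"

lemma cc_hom: "cc 0 = 0" "cc 1 = 1" "cc (a + b) = cc a + cc b" "cc (a * b) = cc a * cc b"
proof -
  have "[:a + b:] = [:a:] + [:b:]" "[:a * b:] = [:a:] * [:b:]" by simp_all
  then show "cc (a + b) = cc a + cc b" "cc (a * b) = cc a * cc b" by (metis Const_hom)+
  show "cc 0 = 0" "cc 1 = 1" by (simp_all add: Const_hom flip: one_pCons)
qed

lemma sym_at_hom:
  "sym_at n 1 = 1" "sym_at n (f * g) = sym_at n f * sym_at n g" "sym_at n (Const c) = cc c"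
  "sym_at n (f + g) = sym_at n f + sym_at n g" "sym_at n 0 = 0"
  "sym_at n (sum F S) = (\<Sum>a\<in>S. sym_at n (F a))"
  "sym_at n (psym (Suc k)) = (\<Sum>j=1..n. Var j ^ Suc k)"
proof -
  show c: "sym_at n (Const c) = cc c" for c
    unfolding sym_at_def by (rule eval_mpoly_Const) (rule cc_hom)
  show "sym_at n 1 = 1" using c[of 1] unfolding Const_hom(2) cc_hom(2) .
  show "sym_at n 0 = 0" by (simp only: sym_at_def eval_mpoly_0)
  show "sym_at n (f * g) = sym_at n f * sym_at n g"
    unfolding sym_at_def by (rule eval_mpoly_mult) (rule cc_hom)+
  show "sym_at n (f + g) = sym_at n f + sym_at n g"
    unfolding sym_at_def by (rule eval_mpoly_add) (rule cc_hom)+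
  show "sym_at n (sum F S) = (\<Sum>a\<in>S. sym_at n (F a))"
    unfolding sym_at_def by (rule eval_mpoly_sum) (rule cc_hom)+
  show "sym_at n (psym (Suc k)) = (\<Sum>j=1..n. Var j ^ Suc k)"
    unfolding sym_at_def psym_def by (subst eval_mpoly_Var) (simp_all only: cc_hom diff_Suc_1)
qed

lemma sym_at_neg1: "sym_at n ((-1) ^ i) = (-1) ^ i"
proof (induction i)
  case (Suc i)
  have "sym_at n (-1) + sym_at n 1 = sym_at n (-1 + 1)" by (rule sym_at_hom(4)[symmetric])
  then have "sym_at n (-1) + 1 = 0" by (simp only: sym_at_hom(1,5) add.left_inverse)
  then have "sym_at n (-1) = -1" by (rule eq_neg_iff_add_eq_0[THEN iffD2])
  then show ?case by (simp only: power_Suc sym_at_hom(2) Suc)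
qed (simp only: power_0 sym_at_hom)

lemma of_nat_cc: "cc (1 / of_nat (Suc k)) * of_nat (Suc k) = 1"
proof -
  have "cc (of_nat m) = of_nat m" for m
    by (induction m) (simp_all add: cc_hom(1,2) Const_hom(1) cc_hom(3)[of 1])
  then have "cc (1 / of_nat (Suc k)) * of_nat (Suc k) = cc (1 / of_nat (Suc k)) * cc (of_nat (Suc k))"
    by metis
  also have "\<dots> = cc (1 / of_nat (Suc k) * of_nat (Suc k))" by (rule cc_hom(4)[symmetric])
  also have "\<dots> = 1" by (simp add: cc_hom(2) del: of_nat_Suc)
  finally show ?thesis .
qed

lemma newton_prod:
  fixes F P :: "nat \<Rightarrow> 'a::comm_ring_1 fps"
  assumes "\<And>j. fps_X * fps_deriv (F j) = F j * P j"
  shows "fps_X * fps_deriv (\<Prod>j\<in>S. F j) = (\<Prod>j\<in>S. F j) * (\<Sum>j\<in>S. P j)"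
proof (induction S rule: infinite_finite_induct)
  case (insert x S)
  have "fps_X * fps_deriv (F x * (\<Prod>j\<in>S. F j)) =
      (fps_X * fps_deriv (F x)) * (\<Prod>j\<in>S. F j) + F x * (fps_X * fps_deriv (\<Prod>j\<in>S. F j))"
    by (simp add: algebra_simps)
  then show ?case unfolding assms insert.IH using insert.hyps by (simp add: algebra_simps)
qed auto

lemma newton_unique:
  fixes F P :: "xpoly fps"
  assumes F: "fps_X * fps_deriv F = F * P" and P0: "fps_nth P 0 = 0" and F0: "fps_nth F 0 = 1"
    and a0: "a 0 = 1"
    and a: "\<And>k. a (Suc k) = cc (1 / of_nat (Suc k)) * (\<Sum>i\<le>k. fps_nth P (Suc i) * a (k - i))"
  shows "a k = fps_nth F k"
proof (induction k rule: less_induct)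
  case (less k)
  show ?case
  proof (cases k)
    case 0
    then show ?thesis by (simp add: a0 F0)
  next
    case [simp]: (Suc k')
    have "of_nat (Suc k') * fps_nth F (Suc k') = fps_nth (fps_X * fps_deriv F) (Suc k')"
      by simp
    also have "\<dots> = fps_nth (P * F) (Suc k')" by (simp only: F mult.commute)
    also have "\<dots> = (\<Sum>i\<le>Suc k'. fps_nth P i * fps_nth F (Suc k' - i))"
      by (simp only: fps_mult_nth atMost_atLeast0)
    also have "\<dots> = (\<Sum>i\<le>k'. fps_nth P (Suc i) * fps_nth F (k' - i))"
      by (subst sum.atMost_Suc_shift) (simp add: P0)
    also have "\<dots> = (\<Sum>i\<le>k'. fps_nth P (Suc i) * a (k' - i))"
      by (intro sum.cong) (simp_all add: less)
    finally have "a (Suc k') = (cc (1 / of_nat (Suc k')) * of_nat (Suc k')) * fps_nth F (Suc k')"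
      by (simp add: a mult.assoc del: of_nat_Suc)
    then show ?thesis unfolding of_nat_cc by simp
  qed
qed

text \<open>\<open>H(u) = \<Prod>\<^sub>j 1 / (1 - x\<^sub>j u)\<close> and \<open>E(u) = \<Prod>\<^sub>j (1 + x\<^sub>j u)\<close> in the variables \<open>x\<^sub>1, \<dots>, x\<^sub>n\<close>.\<close>

lemma sym_at_hsym:
  "sym_at n (hsym k) = fps_nth (\<Prod>j=1..n. Abs_fps (\<lambda>k. Var j ^ k)) k"
proof -
  define P :: "nat \<Rightarrow> xpoly fps" where "P j = Abs_fps (\<lambda>k. if k = 0 then 0 else Var j ^ k)" for j
  have *: "fps_X * fps_deriv (Abs_fps (\<lambda>k. Var j ^ k)) = Abs_fps (\<lambda>k. Var j ^ k) * P j" for j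
  proof (rule fps_ext)
    fix k
    have "fps_nth (Abs_fps (\<lambda>k. Var j ^ k) * P j) k =
        (\<Sum>i=0..k. if i = k then 0 else Var j ^ k)"
      unfolding fps_mult_nth P_def by (intro sum.cong) (auto simp flip: power_add)
    also have "\<dots> = (\<Sum>i\<in>{0..k} - {k}. Var j ^ k)"
      by (rule sum.mono_neutral_cong_right) auto
    finally show "fps_nth (fps_X * fps_deriv (Abs_fps (\<lambda>k. Var j ^ k))) k =
        fps_nth (Abs_fps (\<lambda>k. Var j ^ k) * P j :: xpoly fps) k"
      by (cases k) simp_all
  qed
  have F0: "fps_nth (\<Prod>j\<in>S. Abs_fps (\<lambda>k. (Var j :: xpoly) ^ k)) 0 = 1" for S
    by (induction S rule: infinite_finite_induct) simp_all
  show ?thesis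
    by (rule newton_unique[OF newton_prod[where P = P, OF *] _ F0])
       (auto simp: P_def fps_sum_nth sym_at_hom)
qed

lemma sym_at_esym:
  "sym_at n (esym k) = fps_nth (\<Prod>j=1..n. 1 + fps_const (Var j) * fps_X) k"
proof -
  define P :: "nat \<Rightarrow> xpoly fps"
    where "P j = Abs_fps (\<lambda>k. if k = 0 then 0 else (-1) ^ (k - 1) * Var j ^ k)" for j
  have *: "fps_X * fps_deriv (1 + fps_const (Var j) * fps_X) =
      (1 + fps_const (Var j) * fps_X) * P j" for j
  proof (rule fps_ext)
    fix k
    show "fps_nth (fps_X * fps_deriv (1 + fps_const (Var j) * fps_X)) k =
        fps_nth ((1 + fps_const (Var j) * fps_X) * P j) k"
      by (cases k; cases "k - 1") (simp_all add: P_def distrib_right mult.assoc)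
  qed
  have F0: "fps_nth (\<Prod>j\<in>S. 1 + fps_const (Var j :: xpoly) * fps_X) 0 = 1" for S
    by (induction S rule: infinite_finite_induct) simp_all
  show ?thesis
    by (rule newton_unique[OF newton_prod[where P = P, OF *] _ F0])
       (auto simp: P_def fps_sum_nth sym_at_hom sym_at_neg1 sum_distrib_left)
qed

lemma zee_pos: "zee m > 0"
  by (auto simp: zee_def intro!: prod_pos)

lemma hall_inner_superset:
  assumes "finite S" "Poly_Mapping.keys f \<subseteq> S \<or> Poly_Mapping.keys g \<subseteq> S"
  shows "hall_inner f g = (\<Sum>m\<in>S. of_nat (zee m) * Poly_Mapping.lookup f m * Poly_Mapping.lookup g m)"
  unfolding hall_inner_def
proof (rule sum.mono_neutral_cong)
  fix m assume "m \<in> Poly_Mapping.keys f - S"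
  with assms have "m \<notin> Poly_Mapping.keys g" by blast
  then show "of_nat (zee m) * Poly_Mapping.lookup f m * Poly_Mapping.lookup g m = 0"
    by (simp add: in_keys_iff)
qed (use assms in \<open>auto simp: in_keys_iff\<close>)

lemma hall_inner_add:
  "hall_inner (f + f') g = hall_inner f g + hall_inner f' g"
  "hall_inner f (g + g') = hall_inner f g + hall_inner f g'"
proof -
  let ?S = "Poly_Mapping.keys f \<union> Poly_Mapping.keys f'"
  have *: "hall_inner k g = (\<Sum>m\<in>?S. of_nat (zee m) * Poly_Mapping.lookup k m * Poly_Mapping.lookup g m)"
    if "Poly_Mapping.keys k \<subseteq> ?S" for k
    by (rule hall_inner_superset) (use that in auto)
  show "hall_inner (f + f') g = hall_inner f g + hall_inner f' g"
    unfolding *[OF keys_add] *[OF Un_upper1] *[OF Un_upper2]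
    by (simp add: lookup_add ring_distribs sum.distrib)
  show "hall_inner f (g + g') = hall_inner f g + hall_inner f g'"
    by (simp add: hall_inner_def lookup_add ring_distribs sum.distrib)
qed

lemma hall_inner_sum:
  "hall_inner (sum F S) g = (\<Sum>a\<in>S. hall_inner (F a) g)"
  "hall_inner f (sum G S) = (\<Sum>a\<in>S. hall_inner f (G a))"
  by (induction S rule: infinite_finite_induct) (simp_all add: hall_inner_add, simp_all add: hall_inner_def)

lemma hall_inner_single:
  "hall_inner f (Poly_Mapping.single m c) = of_nat (zee m) * Poly_Mapping.lookup f m * c"
  by (subst hall_inner_superset[of "{m}"]) auto

lemma hall_inner_nondegenerate:
  assumes "\<And>q. hall_inner f q = hall_inner f' q"
  shows "f = f'"
proof (rule poly_mapping_eqI)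
  fix m
  show "Poly_Mapping.lookup f m = Poly_Mapping.lookup f' m"
    using assms[of "Poly_Mapping.single m 1"] zee_pos[of m] by (simp add: hall_inner_single)
qed


lemma perp_ex: "\<exists>g'. \<forall>q. hall_inner g' q = hall_inner g (f * q)"
proof -
  let ?mon = "\<lambda>m. Poly_Mapping.single m 1 :: sym"
  let ?c = "\<lambda>m. hall_inner g (f * ?mon m) / of_nat (zee m)"
  have "{m. ?c m \<noteq> 0} \<subseteq> (\<lambda>(a, b). a - b) ` (Poly_Mapping.keys g \<times> Poly_Mapping.keys f)"
  proof
    fix m assume "m \<in> {m. ?c m \<noteq> 0}"
    then have "hall_inner g (f * ?mon m) \<noteq> 0" by auto
    then obtain a where a: "a \<in> Poly_Mapping.keys g" "a \<in> Poly_Mapping.keys (f * ?mon m)"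
      unfolding hall_inner_def by (auto elim!: sum.not_neutral_contains_not_neutral simp: in_keys_iff)
    with keys_mult[of f "?mon m"] obtain b where "b \<in> Poly_Mapping.keys f" "a = b + m" by auto
    then have "b \<in> Poly_Mapping.keys f" "m = a - b" by simp_all
    with a show "m \<in> (\<lambda>(a, b). a - b) ` (Poly_Mapping.keys g \<times> Poly_Mapping.keys f)" by force
  qed
  then have fin: "finite {m. ?c m \<noteq> 0}" by (rule finite_subset) simp
  define g' where "g' = Abs_poly_mapping ?c"
  have g': "Poly_Mapping.lookup g' m = ?c m" for m
    unfolding g'_def using fin by (subst lookup_Abs_poly_mapping) auto
  have *: "hall_inner g' (Poly_Mapping.single m c) = hall_inner g (f * Poly_Mapping.single m c)" for m c
  proof -
    have e1: "f * Poly_Mapping.single m c = Const c * (f * ?mon m)"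
      by (simp add: Const_def mult.left_commute mult_single)
    have e2: "hall_inner g (Const c * h) = c * hall_inner g h" for h
      by (auto simp: hall_inner_def Const_def sum_distrib_left map.rep_eq when_def
          simp flip: mult_map_scale_conv_mult intro!: sum.cong)
    show ?thesis unfolding e1 e2 using zee_pos[of m] by (simp add: hall_inner_single g')
  qed
  show ?thesis
  proof (intro exI allI)
    fix q :: sym
    have "hall_inner g' (\<Sum>m\<in>Poly_Mapping.keys q. Poly_Mapping.single m (Poly_Mapping.lookup q m)) =
      hall_inner g (f * (\<Sum>m\<in>Poly_Mapping.keys q. Poly_Mapping.single m (Poly_Mapping.lookup q m)))"
      by (simp add: sum_distrib_left hall_inner_sum *)
    then show "hall_inner g' q = hall_inner g (f * q)"
      by (simp flip: pm_sum_singles)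
  qed
qed

lemma perp_adjoint: "hall_inner (perp f g) q = hall_inner g (f * q)"
proof -
  have "\<exists>!g'. \<forall>q. hall_inner g' q = hall_inner g (f * q)"
    using perp_ex hall_inner_nondegenerate by metis
  from theI'[OF this] show ?thesis unfolding perp_def by blast
qed

lemma perp_eqI: "(\<And>q. hall_inner g' q = hall_inner g (f * q)) \<Longrightarrow> perp f g = g'"
  by (rule hall_inner_nondegenerate) (simp add: perp_adjoint)

text \<open>\<open>\<partial>/\<partial>p\<^sub>n\<close>\<close>

definition p_deriv :: "nat \<Rightarrow> sym \<Rightarrow> sym" where
  "p_deriv n g = (\<Sum>m\<in>Poly_Mapping.keys g. Poly_Mapping.single (m - Poly_Mapping.single (n - 1) 1)
     (of_nat (Poly_Mapping.lookup m (n - 1)) * Poly_Mapping.lookup g m))"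

lemma zee_add_single:
  "zee (Poly_Mapping.single k 1 + m) = zee m * (Suc k * Suc (Poly_Mapping.lookup m k))"
proof -
  let ?S = "insert k (Poly_Mapping.keys m)"
  let ?z = "\<lambda>m k. Suc k ^ Poly_Mapping.lookup m k * fact (Poly_Mapping.lookup m k)"
  have *: "zee m' = ?z m' k * (\<Prod>j\<in>?S - {k}. ?z m' j)" if "Poly_Mapping.keys m' \<subseteq> ?S" for m'
  proof -
    have "zee m' = (\<Prod>j\<in>?S. ?z m' j)"
      unfolding zee_def by (rule prod.mono_neutral_left) (use that in \<open>auto simp: in_keys_iff\<close>)
    then show ?thesis by (simp add: prod.insert_remove)
  qed
  define m1 where "m1 = Poly_Mapping.single k 1 + m"
  have l: "Poly_Mapping.lookup m1 j = (if j = k then Suc (Poly_Mapping.lookup m j) else Poly_Mapping.lookup m j)" for j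
    by (simp add: m1_def lookup_add lookup_single)
  have "Poly_Mapping.keys m1 \<subseteq> ?S" by (auto simp: in_keys_iff l split: if_splits)
  moreover have "(\<Prod>j\<in>?S - {k}. ?z m1 j) = (\<Prod>j\<in>?S - {k}. ?z m j)"
    by (rule prod.cong) (auto simp: l)
  ultimately have "zee m1 = ?z m1 k * (\<Prod>j\<in>?S - {k}. ?z m j)" using *[of m1] by simp
  also have "\<dots> = ?z m k * (\<Prod>j\<in>?S - {k}. ?z m j) * (Suc k * Suc (Poly_Mapping.lookup m k))"
    by (simp only: l refl if_True power_Suc fact_Suc of_nat_id mult_ac)
  also have "?z m k * (\<Prod>j\<in>?S - {k}. ?z m j) = zee m" using *[of m] by (simp add: subset_insertI)
  finally show ?thesis by (simp only: m1_def)
qed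

lemma perp_psym:
  assumes "n \<ge> 1"
  shows "perp (psym n) g = Const (of_nat n) * p_deriv n g"
proof (rule perp_eqI)
  fix q :: sym
  define k where "k = n - 1"
  have n: "n = Suc k" using assms by (simp add: k_def)
  let ?e = "Poly_Mapping.single k 1 :: nat \<Rightarrow>\<^sub>0 nat"
  let ?s = "\<lambda>g m. Poly_Mapping.single m (Poly_Mapping.lookup g m)"
  let ?d = "\<lambda>m. Poly_Mapping.single (m - ?e) (of_nat n * (of_nat (Poly_Mapping.lookup m k) * Poly_Mapping.lookup g m))"
  have *: "hall_inner (?d m) (?s q m') = hall_inner (?s g m) (psym n * ?s q m')" for m m'
  proof (cases "m = ?e + m'")
    case True
    then have "m - ?e = m'" "Poly_Mapping.lookup m k = Suc (Poly_Mapping.lookup m' k)"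
      by (simp_all add: lookup_add)
    moreover have "psym n * ?s q m' = Poly_Mapping.single m (Poly_Mapping.lookup q m')"
      using True by (simp add: n psym_def Var_def mult_single)
    moreover have "zee m = zee m' * (Suc k * Suc (Poly_Mapping.lookup m' k))"
      unfolding True by (rule zee_add_single)
    ultimately show ?thesis
      by (simp add: n hall_inner_single mult_ac del: mult_Suc mult_Suc_right of_nat_Suc)
  next
    case False
    have "m - ?e = m' \<longrightarrow> Poly_Mapping.lookup m k = 0"
    proof (rule impI, rule ccontr)
      assume "m - ?e = m'" "Poly_Mapping.lookup m k \<noteq> 0"
      then have "m = ?e + m'"
        by (intro poly_mapping_eqI) (auto simp: lookup_add lookup_minus lookup_single when_def)
      with False show False by blast
    qed
    with False show ?thesis
      by (auto simp: n psym_def Var_def mult_single hall_inner_single lookup_single when_def)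
  qed
  have "Const (of_nat n) * p_deriv n g = (\<Sum>m\<in>Poly_Mapping.keys g. ?d m)"
    by (simp add: p_deriv_def Const_def sum_distrib_left mult_single k_def del: single_of_nat)
  then have "hall_inner (Const (of_nat n) * p_deriv n g) (\<Sum>m\<in>Poly_Mapping.keys q. ?s q m) =
      hall_inner (\<Sum>m\<in>Poly_Mapping.keys g. ?s g m) (psym n * (\<Sum>m\<in>Poly_Mapping.keys q. ?s q m))"
    by (simp only: sum_distrib_left hall_inner_sum *)
  then show "hall_inner (Const (of_nat n) * p_deriv n g) q = hall_inner g (psym n * q)"
    by (simp flip: pm_sum_singles)
qed

end

theory Submission
  imports Defs "HOL-Combinatorics.Multiset_Permutations"
begin

text \<open>The operator series \<open>\<Sum>\<^sub>m (-z)\<^sup>m e\<^sub>m\<^sup>\<bottom>\<close> is the ring homomorphism \<open>p\<^sub>k \<mapsto> p\<^sub>k - z\<^sup>k\<close>, and it multiplies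
  \<open>E(-tu)H(u)\<close> by \<open>(1 - zu) / (1 - tzu)\<close>. Hence \<open>\<Gamma>\<^sup>+\<close> with index \<open>-\<lambda>\<^sub>1\<close> maps the coefficient for \<open>(\<lambda>\<^sub>2, \<dots>, \<lambda>\<^sub>l)\<close> to
  \<open>F\<^sub>\<lambda>\<close>, and the expansion of the modified functions in the \<open>F\<^sub>\<alpha>\<close> follows by multilinearity; it is finite because
  \<open>\<Gamma>\<^sup>+\<^sub>k f = 0\<close> for large \<open>k\<close>. A fixed monomial in \<open>t\<close> and the power sums occurs in only finitely many \<open>F\<^sub>\<beta>\<close>, so
  the inversion formula reduces to finitely many products of the absolutely convergent sums \<open>\<Sum>\<^sub>k B\<^sub>i\<^sub>k A\<^sub>k\<^sub>j\<close>.

  In finitely many variables \<open>p\<^sub>k \<mapsto> p\<^sub>k - x\<^sub>s\<^sup>k\<close> deletes \<open>x\<^sub>s\<close>. The partial fraction expansion of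
  \<open>\<Prod>\<^sub>s (1 - t x\<^sub>s u) / (1 - x\<^sub>s u)\<close> therefore turns \<open>\<Gamma>\<^sup>+\<close> with index \<open>-j < 0\<close> into the sum over \<open>s\<close> of
  \<open>(1 - t) x\<^sub>s\<^sup>j \<Prod>\<^sub>r (x\<^sub>s - t x\<^sub>r) / (x\<^sub>s - x\<^sub>r)\<close>, \<open>r \<noteq> s\<close>, times the evaluation without \<open>x\<^sub>s\<close>. The sum over \<open>S\<^sub>n\<close>,
  split by the value of \<open>\<sigma>(1)\<close>, satisfies the same recursion, and the \<open>n - l\<close> trailing zeros contribute
  \<open>\<Prod>\<^sub>i (1 - t\<^sup>i) / (1 - t)\<close>.\<close>

section \<open>Ring homomorphisms on symmetric functions\<close>

text \<open>The functions h_k and e_k are given by Newton's identities and e_m^perp by adjointness;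
  neither shows how a substitution acts on the generating series. Both are reached through
  logarithmic derivatives: if positive integers are invertible, u F'(u) = F(u) u P(u) and F(0)
  determine F. For the adjoints the same recursion is the z-derivative of exp(- sum of z^i d/dp_i),
  the Taylor form of p_i -> p_i - z^i.

  Two generalisations shape the inductions. What is indexed by 1, ..., l is stated for a, ..., l,
  because the outermost operator belongs to the first component and is peeled off. Evaluation takes
  place in an arbitrary finite set S of variables, because deleting x_s leaves a gap; the sum over
  S_n then becomes a sum over the orderings of S.

  Linearity of the operators is proved on \<Lambda>[t], where every argument is annihilated by
  e_m^perp for large m and all sums are finite. In the symmetrisation formula, the vanishing of
  A_(i,j) for i < 0 \<le> j confines the operators to strictly negative indices.\<close>

lemma mpoly_induct [case_names Const add Var]:
  fixes f :: "'a::comm_ring_1 mpoly"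
  assumes C: "\<And>c. P (Const c)" and A: "\<And>f g. P f \<Longrightarrow> P g \<Longrightarrow> P (f + g)"
    and V: "\<And>i f. P f \<Longrightarrow> P (Var i * f)"
  shows "P f"
proof -
  have pw: "P (Poly_Mapping.single (Poly_Mapping.single i k) 1 * f)" if "P f" for i k f
  proof (induction k)
    case (Suc k)
    have "Poly_Mapping.single (Poly_Mapping.single i (Suc k)) 1 * f =
        Var i * (Poly_Mapping.single (Poly_Mapping.single i k) 1 * f)"
      by (simp add: Var_def mult_single mult.assoc[symmetric] flip: single_add)
    then show ?case using V[OF Suc] by simp
  qed (use that in simp)
  have mon: "P (Poly_Mapping.single m c)" for m c
  proof (induction "card (Poly_Mapping.keys m)" arbitrary: m)
    case 0
    then have "m = 0" by simp
    then show ?case using C[of c] by (simp add: Const_def)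
  next
    case (Suc n)
    then obtain i where i: "i \<in> Poly_Mapping.keys m" by fastforce
    define m' where "m' = Poly_Mapping.update i 0 m"
    have k: "Poly_Mapping.keys m' = Poly_Mapping.keys m - {i}"
      by (auto simp: m'_def in_keys_iff lookup_update split: if_splits)
    have "Poly_Mapping.single m c =
        Poly_Mapping.single (Poly_Mapping.single i (Poly_Mapping.lookup m i)) 1 * Poly_Mapping.single m' c"
    proof -
      have "m = Poly_Mapping.single i (Poly_Mapping.lookup m i) + m'"
        by (rule poly_mapping_eqI) (auto simp: m'_def lookup_add lookup_single when_def lookup_update)
      then show ?thesis by (simp add: mult_single)
    qed
    moreover have "P (Poly_Mapping.single m' c)" using Suc i k by simp
    ultimately show ?case using pw by metis
  qed
  have s: "P (\<Sum>m\<in>M. Poly_Mapping.single m (Poly_Mapping.lookup f m))" for M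
    by (induction M rule: infinite_finite_induct) (use C[of 0] in \<open>auto intro: A mon simp: Const_hom\<close>)
  show ?thesis using s[of "Poly_Mapping.keys f"] by (simp flip: pm_sum_singles)
qed

text \<open>Compatibility with constants is not part of the notion, since the targets embed the
  coefficients in different ways; \<open>sym_hom_eqI\<close> compares the constants
  separately.\<close>

locale sym_hom =
  fixes \<phi> :: "'c::comm_ring_1 mpoly \<Rightarrow> 'a::comm_ring_1"
  assumes one: "\<phi> 1 = 1" and add: "\<phi> (f + g) = \<phi> f + \<phi> g" and mult: "\<phi> (f * g) = \<phi> f * \<phi> g"
begin

lemma zero: "\<phi> 0 = 0"
  using add[of 0 0] by simp

lemma uminus: "\<phi> (- f) = - \<phi> f"
  using add[of f "- f"] by (simp add: zero eq_neg_iff_add_eq_0 add.commute)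

lemma sum: "\<phi> (sum F S) = (\<Sum>a\<in>S. \<phi> (F a))"
  by (induction S rule: infinite_finite_induct) (simp_all add: zero add)

lemma power: "\<phi> (f ^ n) = \<phi> f ^ n"
  by (induction n) (simp_all add: one mult)

lemma of_nat: "\<phi> (of_nat n) = of_nat n"
  by (induction n) (simp_all add: one add zero)

end

lemma sym_hom_eval_mpoly:
  assumes "h 1 = 1" "h 0 = 0" "\<And>a b. h (a + b) = h a + h b" "\<And>a b. h (a * b) = h a * h b"
  shows "sym_hom (eval_mpoly h v)"
proof
  show "eval_mpoly h v 1 = 1"
    using eval_mpoly_Const[of h v 1] assms by (simp add: Const_hom)
qed (simp_all add: eval_mpoly_add eval_mpoly_mult assms)

lemma sym_hom_eqI:
  assumes "sym_hom \<phi>" "sym_hom \<psi>" "\<And>c. \<phi> (Const c) = \<psi> (Const c)" "\<And>i. \<phi> (Var i) = \<psi> (Var i)"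
  shows "\<phi> f = \<psi> f"
  by (induction f rule: mpoly_induct)
    (simp_all add: assms sym_hom.add[OF assms(1)] sym_hom.add[OF assms(2)]
      sym_hom.mult[OF assms(1)] sym_hom.mult[OF assms(2)])

lemma Const_inverse_Suc: "of_nat (Suc k) * Const (1 / of_nat (Suc k)) = (1 :: sym)"
proof -
  have "of_nat n = (Const (of_nat n) :: sym)" for n
    by (induction n) (simp_all add: Const_hom)
  then show ?thesis by (simp add: Const_hom(2) del: of_nat_Suc flip: Const_hom(4))
qed

section \<open>Generating functions\<close>

text \<open>The hypothesis is Newton's identity, with \<open>p i\<close> belonging to u^(i+1).
  Writing u F' = F u P instead of a quotient avoids division, and products of series still
  correspond to sums of the \<open>P\<close> (\<open>log_deriv_mult\<close>).\<close>

lemma newton_ode: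
  fixes a p :: "nat \<Rightarrow> 'a::comm_ring_1"
  assumes "\<And>k. of_nat (Suc k) * a (Suc k) = (\<Sum>i\<le>k. p i * a (k - i))"
  shows "fps_X * fps_deriv (Abs_fps a) = Abs_fps a * (fps_X * Abs_fps p)"
proof (rule fps_ext)
  fix k
  show "fps_nth (fps_X * fps_deriv (Abs_fps a)) k = fps_nth (Abs_fps a * (fps_X * Abs_fps p)) k"
  proof (cases k)
    case (Suc k')
    have "fps_nth (Abs_fps a * (fps_X * Abs_fps p)) (Suc k') = fps_nth (Abs_fps p * Abs_fps a) k'"
      by (simp add: mult.left_commute mult.commute)
    also have "\<dots> = (\<Sum>i\<le>k'. p i * a (k' - i))" by (simp add: fps_mult_nth atMost_atLeast0)
    also have "\<dots> = of_nat (Suc k') * a (Suc k')" using assms by simp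
    finally show ?thesis using Suc by simp
  qed simp
qed

text \<open>Coefficient k + 1 is determined by the lower ones once k + 1 can be cancelled. The ring
  is an arbitrary commutative one, so invertibility of the positive integers is a
  hypothesis.\<close>

lemma fps_log_deriv_unique:
  fixes F G P :: "'a::comm_ring_1 fps"
  assumes F: "fps_X * fps_deriv F = F * (fps_X * P)" and G: "fps_X * fps_deriv G = G * (fps_X * P)"
    and 0: "fps_nth F 0 = fps_nth G 0" and inv: "\<And>k. \<exists>c::'a. of_nat (Suc k) * c = 1"
  shows "F = G"
proof (rule fps_ext)
  have rec: "of_nat (Suc k) * fps_nth F (Suc k) = (\<Sum>i\<le>k. fps_nth P i * fps_nth F (k - i))"
    if F: "fps_X * fps_deriv F = F * (fps_X * P)" for k and F :: "'a fps"
  proof -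
    have "of_nat (Suc k) * fps_nth F (Suc k) = fps_nth (fps_X * fps_deriv F) (Suc k)" by simp
    also have "\<dots> = fps_nth (P * F) k" unfolding F mult.left_commute[of F fps_X P] mult.commute[of F P] by simp
    finally show ?thesis by (simp add: fps_mult_nth atMost_atLeast0)
  qed
  fix k show "fps_nth F k = fps_nth G k"
  proof (induction k rule: less_induct)
    case (less k)
    show ?case
    proof (cases k)
      case (Suc k')
      obtain c :: 'a where c: "of_nat (Suc k') * c = 1" using inv by blast
      have "of_nat (Suc k') * fps_nth F (Suc k') = of_nat (Suc k') * fps_nth G (Suc k')"
        unfolding rec[OF F] rec[OF G] by (intro sum.cong) (use less Suc in auto)
      then have "(of_nat (Suc k') * c) * fps_nth F (Suc k') = (of_nat (Suc k') * c) * fps_nth G (Suc k')"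
        by (metis mult.assoc mult.commute)
      then show ?thesis using c Suc by simp
    qed (use 0 in simp)
  qed
qed

lemma one_minus_ode:
  fixes c :: "'a::comm_ring_1"
  shows "fps_X * fps_deriv (1 - fps_const c * fps_X) =
    (1 - fps_const c * fps_X) * (fps_X * Abs_fps (\<lambda>k. - (c ^ Suc k)))"
proof (rule fps_ext)
  fix k
  show "fps_nth (fps_X * fps_deriv (1 - fps_const c * fps_X)) k =
      fps_nth ((1 - fps_const c * fps_X) * (fps_X * Abs_fps (\<lambda>k. - (c ^ Suc k)))) k"
    by (cases k; cases "k - 1") (simp_all add: left_diff_distrib mult.assoc)
qed

lemma geometric_fps:
  fixes c :: "'a::comm_ring_1"
  shows "(1 - fps_const c * fps_X) * Abs_fps (\<lambda>k. c ^ k) = 1"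
proof (rule fps_ext)
  fix k show "fps_nth ((1 - fps_const c * fps_X) * Abs_fps (\<lambda>k. c ^ k)) k = fps_nth 1 k"
    by (cases k) (simp_all add: left_diff_distrib mult.assoc)
qed

lemma geometric_ode:
  fixes c :: "'a::comm_ring_1"
  shows "fps_X * fps_deriv (Abs_fps (\<lambda>k. c ^ k)) = Abs_fps (\<lambda>k. c ^ k) * (fps_X * Abs_fps (\<lambda>k. c ^ Suc k))"
proof -
  let ?F = "1 - fps_const c * fps_X" and ?G = "Abs_fps (\<lambda>k. c ^ k)" and ?P = "Abs_fps (\<lambda>k. c ^ Suc k)"
  have P: "Abs_fps (\<lambda>k. - (c ^ Suc k)) = - ?P" by (rule fps_ext) simp
  have ring: "x * (a * b + c * d) = (x * c) * d + a * (x * b)" for x a b c d :: "'a fps"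
    by (simp add: algebra_simps)
  have ring2: "f * (x * - p) * g = - (x * p) * (f * g)" for f x p g :: "'a fps"
    by (simp add: algebra_simps)
  have ring3: "(f * g) * x = g * (f * x)" for f x g :: "'a fps"
    by (simp add: algebra_simps)
  \<comment> \<open>Differentiating (1 - c u) G = 1: the logarithmic derivative of the inverse is
    minus that of 1 - c u.\<close>
  have "0 = fps_X * fps_deriv (?F * ?G)" unfolding geometric_fps by simp
  also have "\<dots> = (fps_X * fps_deriv ?F) * ?G + ?F * (fps_X * fps_deriv ?G)"
    unfolding fps_deriv_mult by (rule ring)
  also have "(fps_X * fps_deriv ?F) * ?G = - (fps_X * ?P) * (?F * ?G)"
    unfolding one_minus_ode P by (rule ring2)
  finally have e: "?F * (fps_X * fps_deriv ?G) = fps_X * ?P" unfolding geometric_fps by simp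
  have "fps_X * fps_deriv ?G = (?F * ?G) * (fps_X * fps_deriv ?G)" unfolding geometric_fps by simp
  also have "\<dots> = ?G * (?F * (fps_X * fps_deriv ?G))" by (rule ring3)
  finally show ?thesis unfolding e .
qed

lemma log_deriv_mult:
  fixes F G P Q :: "'a::comm_ring_1 fps"
  assumes "fps_X * fps_deriv F = F * (fps_X * P)" "fps_X * fps_deriv G = G * (fps_X * Q)"
  shows "fps_X * fps_deriv (F * G) = (F * G) * (fps_X * (P + Q))"
proof -
  have "fps_X * fps_deriv (F * G) = (fps_X * fps_deriv F) * G + F * (fps_X * fps_deriv G)"
    by (simp add: algebra_simps)
  then show ?thesis unfolding assms by (simp add: algebra_simps)
qed

lemma log_deriv_prod:
  fixes F P :: "'i \<Rightarrow> 'a::comm_ring_1 fps"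
  assumes "\<And>s. fps_X * fps_deriv (F s) = F s * (fps_X * P s)"
  shows "fps_X * fps_deriv (\<Prod>s\<in>S. F s) = (\<Prod>s\<in>S. F s) * (fps_X * (\<Sum>s\<in>S. P s))"
proof (induction S rule: infinite_finite_induct)
  case (insert x S)
  show ?case using log_deriv_mult[OF assms insert.IH] insert.hyps by simp
qed simp_all

context
  fixes \<phi> :: "sym \<Rightarrow> 'a::comm_ring_1"
  assumes hom: "sym_hom \<phi>"
begin

interpretation sym_hom \<phi> by (rule hom)

text \<open>The constant 1 / (k + 1) of \<Lambda> is mapped to an inverse of k + 1, whatever the
  target ring.\<close>

lemma sym_hom_inverse_Suc: "\<exists>c::'a. of_nat (Suc k) * c = 1"
  using arg_cong[OF Const_inverse_Suc[of k], of \<phi>] unfolding mult of_nat one by blast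

lemma sym_hom_hsym_ode:
  "fps_X * fps_deriv (Abs_fps (\<lambda>k. \<phi> (hsym k))) =
    Abs_fps (\<lambda>k. \<phi> (hsym k)) * (fps_X * Abs_fps (\<lambda>k. \<phi> (psym (Suc k))))"
proof (rule newton_ode)
  fix k
  have "of_nat (Suc k) * hsym (Suc k) = (\<Sum>i\<le>k. psym (Suc i) * hsym (k - i))"
    by (simp only: hsym.simps mult.assoc[symmetric] Const_inverse_Suc mult_1_left)
  from arg_cong[OF this, of \<phi>]
  show "of_nat (Suc k) * \<phi> (hsym (Suc k)) = (\<Sum>i\<le>k. \<phi> (psym (Suc i)) * \<phi> (hsym (k - i)))"
    by (simp only: mult of_nat sum)
qed

lemma sym_hom_esym_ode:
  "fps_X * fps_deriv (Abs_fps (\<lambda>k. \<phi> (esym k))) =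
    Abs_fps (\<lambda>k. \<phi> (esym k)) * (fps_X * Abs_fps (\<lambda>k. (-1) ^ k * \<phi> (psym (Suc k))))"
proof (rule newton_ode)
  fix k
  have "of_nat (Suc k) * esym (Suc k) = (\<Sum>i\<le>k. (-1) ^ i * psym (Suc i) * esym (k - i))"
    by (simp only: esym.simps mult.assoc[symmetric] Const_inverse_Suc mult_1_left)
  from arg_cong[OF this, of \<phi>]
  show "of_nat (Suc k) * \<phi> (esym (Suc k)) = (\<Sum>i\<le>k. (-1) ^ i * \<phi> (psym (Suc i)) * \<phi> (esym (k - i)))"
    by (simp only: mult of_nat sum power uminus one)
qed

text \<open>The way in which all generating series below are computed: propose a product for the
  image of H(u) and check its logarithmic derivative against the images of the power sums.\<close>

lemma sym_hom_hsym_eq: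
  assumes "fps_X * fps_deriv F = F * (fps_X * Abs_fps (\<lambda>k. \<phi> (psym (Suc k))))" "fps_nth F 0 = 1"
  shows "Abs_fps (\<lambda>k. \<phi> (hsym k)) = F"
  by (rule fps_log_deriv_unique[OF sym_hom_hsym_ode assms(1) _ sym_hom_inverse_Suc])
    (simp add: assms(2) one)

lemma sym_hom_esym_eq:
  assumes "fps_X * fps_deriv F = F * (fps_X * Abs_fps (\<lambda>k. (-1) ^ k * \<phi> (psym (Suc k))))" "fps_nth F 0 = 1"
  shows "Abs_fps (\<lambda>k. \<phi> (esym k)) = F"
  by (rule fps_log_deriv_unique[OF sym_hom_esym_ode assms(1) _ sym_hom_inverse_Suc])
    (simp add: assms(2) one)

end

section \<open>The adjoints of the elementary symmetric functions\<close>

text \<open>\<open>\<Sum>\<^sub>m (-z)\<^sup>m e\<^sub>m\<^sup>\<bottom>\<close> is the ring homomorphism that removes a variable \<open>z\<close>, that is, maps \<open>p\<^sub>k\<close> to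
  \<open>p\<^sub>k - z\<^sup>k\<close>; \<open>eperp m\<close> is the coefficient of \<open>z\<^sup>m\<close>.\<close>

definition shift_hom :: "sym \<Rightarrow> sym poly" where
  "shift_hom = eval_mpoly (\<lambda>c. [:Const c:]) (\<lambda>k. [:psym (Suc k):] - monom 1 (Suc k))"

definition eperp :: "nat \<Rightarrow> sym \<Rightarrow> sym" where
  "eperp m f = poly.coeff (shift_hom f) m"

lemma sym_hom_shift_hom: "sym_hom shift_hom"
  unfolding shift_hom_def by (rule sym_hom_eval_mpoly) (simp_all add: Const_hom one_pCons)

lemma shift_hom_Const: "shift_hom (Const c) = [:Const c:]"
  unfolding shift_hom_def by (rule eval_mpoly_Const) (simp add: Const_hom)

lemma shift_hom_psym: "shift_hom (psym (Suc k)) = [:psym (Suc k):] - monom 1 (Suc k)"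
  unfolding shift_hom_def psym_def diff_Suc_1
  by (subst eval_mpoly_Var) (simp_all add: Const_hom one_pCons)

lemma eperp_zero: "eperp m 0 = 0"
  by (simp add: eperp_def sym_hom.zero[OF sym_hom_shift_hom])

lemma eperp_one: "eperp m 1 = (if m = 0 then 1 else 0)"
  by (simp add: eperp_def sym_hom.one[OF sym_hom_shift_hom])

lemma eperp_add: "eperp m (f + g) = eperp m f + eperp m g"
  by (simp add: eperp_def sym_hom.add[OF sym_hom_shift_hom])

lemma eperp_Const: "eperp m (Const c) = (if m = 0 then Const c else 0)"
  by (simp add: eperp_def shift_hom_Const coeff_pCons split: nat.split)

lemma eperp_mult: "eperp m (f * g) = (\<Sum>i\<le>m. eperp i f * eperp (m - i) g)"
  by (simp add: eperp_def sym_hom.mult[OF sym_hom_shift_hom] coeff_mult)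

lemma eperp_psym_mult:
  "eperp m (psym (Suc j) * f) = psym (Suc j) * eperp m f - (if Suc j \<le> m then eperp (m - Suc j) f else 0)"
proof -
  have e: "shift_hom (psym (Suc j) * f) = smult (psym (Suc j)) (shift_hom f) - monom 1 (Suc j) * shift_hom f"
    by (simp add: sym_hom.mult[OF sym_hom_shift_hom] shift_hom_psym left_diff_distrib)
  show ?thesis unfolding eperp_def e coeff_diff coeff_smult coeff_monom_mult by auto
qed

lemma eventually_eperp_zero: "\<exists>M. \<forall>m\<ge>M. eperp m f = 0"
  unfolding eperp_def by (metis coeff_eq_0 less_eq_Suc_le)

section \<open>Derivatives in the power sums and the identification of \<open>eperp\<close> with the
  Hall adjoints\<close>

lemma Const_of_nat: "Const (of_nat n) = (of_nat n :: 'a::comm_ring_1 mpoly)"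
  by (induction n) (simp_all add: Const_hom)

lemma lookup_Const_mult: "Poly_Mapping.lookup (Const c * f) m = c * Poly_Mapping.lookup (f :: 'a::comm_ring_1 mpoly) m"
  by (simp add: Const_def map.rep_eq when_def flip: mult_map_scale_conv_mult)

lemma p_deriv_superset:
  assumes "finite S" "Poly_Mapping.keys g \<subseteq> S"
  shows "p_deriv n g = (\<Sum>m\<in>S. Poly_Mapping.single (m - Poly_Mapping.single (n - 1) 1)
     (of_nat (Poly_Mapping.lookup m (n - 1)) * Poly_Mapping.lookup g m))"
  unfolding p_deriv_def by (rule sum.mono_neutral_left) (use assms in \<open>auto simp: in_keys_iff\<close>)

lemma p_deriv_add: "p_deriv n (f + g) = p_deriv n f + p_deriv n g"
proof -
  let ?S = "Poly_Mapping.keys f \<union> Poly_Mapping.keys g"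
  have *: "Poly_Mapping.keys (f + g) \<subseteq> ?S" by (rule keys_add)
  show ?thesis
    by (simp add: p_deriv_superset[of ?S] * lookup_add distrib_left single_add sum.distrib)
qed

lemma p_deriv_single: "p_deriv (Suc i) (Poly_Mapping.single m c) =
    Poly_Mapping.single (m - Poly_Mapping.single i 1) (of_nat (Poly_Mapping.lookup m i) * c)"
  by (subst p_deriv_superset[of "{m}"]) auto

lemma p_deriv_Const: "p_deriv (Suc i) (Const c) = 0"
  by (simp add: Const_def p_deriv_single)

lemma p_deriv_Var_mult:
  "p_deriv (Suc i) (Var j * f) = (if i = j then f else 0) + Var j * p_deriv (Suc i) f"
proof -
  have s: "p_deriv (Suc i) (Var j * Poly_Mapping.single m c) =
      (if i = j then Poly_Mapping.single m c else 0) + Var j * p_deriv (Suc i) (Poly_Mapping.single m c)" for m c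
  proof (cases "i = j")
    case True
    have e: "Poly_Mapping.single j 1 + m - Poly_Mapping.single j 1 = m" by simp
    show ?thesis
    \<comment> \<open>Subtraction of exponents is truncated. Where it truncates, the exponent
      occurring as a factor is zero and the term vanishes, so the exponents have to add up in the
      other case only.\<close>
    proof (cases "Poly_Mapping.lookup m j = 0")
      case False
      then have "Poly_Mapping.single j 1 + (m - Poly_Mapping.single j 1) = m"
        by (intro poly_mapping_eqI) (auto simp: lookup_add lookup_minus lookup_single when_def)
      with True show ?thesis
        by (simp add: Var_def mult_single p_deriv_single lookup_add e distrib_right flip: single_add)
    qed (use True in \<open>simp add: Var_def mult_single p_deriv_single lookup_add\<close>)
  next
    case False
    have "Poly_Mapping.single j 1 + m - Poly_Mapping.single i 1 = Poly_Mapping.single j 1 + (m - Poly_Mapping.single i 1)"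
      by (intro poly_mapping_eqI) (use False in \<open>auto simp: lookup_add lookup_minus lookup_single when_def\<close>)
    with False show ?thesis by (simp add: Var_def mult_single p_deriv_single lookup_add lookup_single)
  qed
  have z: "p_deriv n 0 = 0" for n by (simp add: p_deriv_def)
  have "p_deriv (Suc i) (Var j * (\<Sum>m\<in>S. Poly_Mapping.single m (Poly_Mapping.lookup f m))) =
      (if i = j then (\<Sum>m\<in>S. Poly_Mapping.single m (Poly_Mapping.lookup f m)) else 0) +
      Var j * p_deriv (Suc i) (\<Sum>m\<in>S. Poly_Mapping.single m (Poly_Mapping.lookup f m))" for S
    by (induction S rule: infinite_finite_induct) (simp_all add: z distrib_left p_deriv_add s)
  from this[of "Poly_Mapping.keys f"] show ?thesis by (simp flip: pm_sum_singles)
qed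

text \<open>On generating functions: S(z) = exp(- sum of z^i d/dp_i) satisfies z S'(z) = - (sum of i
  z^i d/dp_i) S(z). The induction over \<open>f\<close> uses only the effect of multiplication by a
  power sum on both sides.\<close>

lemma eperp_newton:
  "of_nat (Suc k) * eperp (Suc k) f = - (\<Sum>i\<le>k. of_nat (Suc i) * eperp (k - i) (p_deriv (Suc i) f))"
proof (induction f arbitrary: k rule: mpoly_induct)
  case (Const c)
  then show ?case by (simp add: eperp_Const p_deriv_Const eperp_zero)
next
  case (add f g)
  show ?case by (simp only: eperp_add p_deriv_add distrib_left add.IH sum.distrib minus_add_distrib)
next
  case (Var j f)
  have V: "Var j = psym (Suc j)" by (simp add: psym_def)
  have p_deriv_Var_mult: "p_deriv (Suc i) (psym (Suc j) * f) =
      (if i = j then f else 0) + psym (Suc j) * p_deriv (Suc i) f" for i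
    using p_deriv_Var_mult[of i j f] unfolding V .
  let ?S = "\<lambda>k. \<Sum>i\<le>k. of_nat (Suc i) * eperp (k - i) (p_deriv (Suc i) f)"
  have "(\<Sum>i\<le>k. of_nat (Suc i) * eperp (k - i) (p_deriv (Suc i) (Var j * f))) =
      (\<Sum>i\<le>k. (if i = j then of_nat (Suc i) * eperp (k - i) f else 0)
        + psym (Suc j) * (of_nat (Suc i) * eperp (k - i) (p_deriv (Suc i) f))
        - (if Suc j \<le> k - i then of_nat (Suc i) * eperp (k - i - Suc j) (p_deriv (Suc i) f) else 0))"
    unfolding p_deriv_Var_mult V eperp_add eperp_psym_mult
    by (intro sum.cong) (auto simp: algebra_simps eperp_zero)
  also have "\<dots> = (if j \<le> k then of_nat (Suc j) * eperp (k - j) f else 0) + psym (Suc j) * ?S k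
      - (\<Sum>i\<le>k. if Suc j \<le> k - i then of_nat (Suc i) * eperp (k - i - Suc j) (p_deriv (Suc i) f) else 0)"
    by (simp only: sum.distrib sum_subtractf sum_distrib_left) (simp add: sum.delta)
  also have "(\<Sum>i\<le>k. if Suc j \<le> k - i then of_nat (Suc i) * eperp (k - i - Suc j) (p_deriv (Suc i) f) else 0)
      = (if Suc j \<le> k then ?S (k - Suc j) else 0)"
  proof (cases "Suc j \<le> k")
    case True
    then show ?thesis
    proof -
      have e: "k - i - Suc j = k - Suc j - i" for i by simp
      have le: "Suc j \<le> k - i \<longleftrightarrow> i \<le> k - Suc j" for i using True by linarith
      have "{..k - Suc j} = {i\<in>{..k}. i \<le> k - Suc j}" by auto
      then show ?thesis unfolding if_P[OF True] e le
        by (simp only: sum.inter_filter[OF finite_atMost])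
    qed
  qed (auto intro!: sum.neutral)
  also have "psym (Suc j) * ?S k = - (of_nat (Suc k) * (psym (Suc j) * eperp (Suc k) f))"
    using Var.IH[of k] by (simp add: algebra_simps)
  \<comment> \<open>The hypothesis at \<open>k - Suc j\<close>. The range may be widened to
    \<open>j \<le> k\<close>, as the factor k - j is zero at the new point.\<close>
  also have "(if Suc j \<le> k then ?S (k - Suc j) else 0) =
      - (if j \<le> k then (of_nat (k - j)) * eperp (k - j) f else 0)"
  proof (cases "Suc j \<le> k")
    case True
    then have "Suc (k - Suc j) = k - j" by simp
    with True Var.IH[of "k - Suc j"] show ?thesis by simp
  qed auto
  \<comment> \<open>The Leibniz rule supplies j + 1 and the shifted hypothesis k - j, together the
    factor k + 1 of the claim.\<close>
  finally have "(\<Sum>i\<le>k. of_nat (Suc i) * eperp (k - i) (p_deriv (Suc i) (Var j * f))) =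
      (if j \<le> k then of_nat (Suc j + (k - j)) * eperp (k - j) f else 0)
      - of_nat (Suc k) * (psym (Suc j) * eperp (Suc k) f)"
    by (auto simp: algebra_simps)
  then show ?case unfolding V eperp_psym_mult by (auto simp: algebra_simps)
qed

lemma hall_inner_Const_mult:
  "hall_inner (Const c * f) g = c * hall_inner f g" "hall_inner f (Const c * g) = c * hall_inner f g"
proof -
  have "Poly_Mapping.keys (Const c * f) \<subseteq> Poly_Mapping.keys f"
    by (auto simp: in_keys_iff lookup_Const_mult)
  then show "hall_inner (Const c * f) g = c * hall_inner f g"
    by (subst (1 2) hall_inner_superset[of "Poly_Mapping.keys f"])
      (auto simp: lookup_Const_mult sum_distrib_left mult.left_commute mult.assoc)
  show "hall_inner f (Const c * g) = c * hall_inner f g"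
    unfolding hall_inner_def lookup_Const_mult sum_distrib_left by (simp only: mult_ac)
qed

lemma perp_mult: "perp (f * g) h = perp g (perp f h)"
  by (rule perp_eqI) (simp add: perp_adjoint mult.assoc)

lemma perp_sum: "perp (\<Sum>a\<in>S. f a) h = (\<Sum>a\<in>S. perp (f a) h)"
  by (rule perp_eqI) (simp add: perp_adjoint hall_inner_sum sum_distrib_right)

lemma perp_psym_Suc: "perp (psym (Suc n)) g = Const (of_nat (Suc n)) * p_deriv (Suc n) g"
  by (rule perp_psym) simp

lemma perp_Const_mult_left: "perp (Const c * f) h = Const c * perp f h"
  by (rule perp_eqI) (simp add: perp_adjoint hall_inner_Const_mult mult.assoc)

lemma perp_Const_mult_right: "perp f (Const c * h) = Const c * perp f h"
  by (rule perp_eqI) (simp add: perp_adjoint hall_inner_Const_mult)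

text \<open>Both sides obey the same recursion in m: taking adjoints in Newton's identity for e_m
  and replacing p_i^perp by i d/dp_i gives \<open>eperp_newton\<close> up to signs.\<close>

lemma eperp_eq_perp: "eperp m f = (-1) ^ m * perp (esym m) f"
proof (induction m arbitrary: f rule: less_induct)
  case (less m)
  show ?case
  proof (cases m)
    case 0
    have "perp 1 f = f" by (rule perp_eqI) simp
    moreover have "eperp 0 f = f"
    proof (induction f rule: mpoly_induct)
      case (Var i f)
      then show ?case using eperp_psym_mult[of 0 i f] by (simp add: psym_def)
    qed (simp_all add: eperp_Const eperp_add)
    ultimately show ?thesis using 0 by simp
  next
    case (Suc k)
    have neg: "((-1) ^ i :: sym) = Const ((-1) ^ i)" for i
    proof (induction i)
      case (Suc i)
      have "Const (- 1) = (- 1 :: sym)" by (simp add: Const_def single_uminus)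
      with Suc show ?case by (metis power_Suc Const_hom(4))
    qed (simp add: Const_hom)
    have e: "esym (Suc k) = Const (1 / of_nat (Suc k)) * (\<Sum>i\<le>k. Const ((-1) ^ i) * (psym (Suc i) * esym (k - i)))"
      unfolding esym.simps neg mult.assoc ..
    have t: "perp (psym (Suc i) * esym (k - i)) f =
         Const (of_nat (Suc i)) * perp (esym (k - i)) (p_deriv (Suc i) f)" for i
      unfolding perp_mult[of "psym (Suc i)"] perp_psym_Suc perp_Const_mult_right ..
    have "perp (esym (Suc k)) f = Const (1 / of_nat (Suc k)) *
        (\<Sum>i\<le>k. Const ((-1) ^ i) * (Const (of_nat (Suc i)) * perp (esym (k - i)) (p_deriv (Suc i) f)))"
      unfolding e perp_Const_mult_left perp_sum t ..
    also have "\<dots> = Const (1 / of_nat (Suc k)) *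
        (\<Sum>i\<le>k. (-1) ^ k * (of_nat (Suc i) * eperp (k - i) (p_deriv (Suc i) f)))"
    proof (rule arg_cong2[OF refl sum.cong[OF refl], where f = "(*)"])
      fix i assume "i \<in> {..k}"
      then have i: "i \<le> k" by simp
      have "eperp (k - i) (p_deriv (Suc i) f) = (-1) ^ (k - i) * perp (esym (k - i)) (p_deriv (Suc i) f)"
        using Suc by (intro less) simp
      \<comment> \<open>The sign of Newton's identity and that of the hypothesis combine to (-1)^k,
        which is the same for all i and leaves the sum.\<close>
      moreover have "((-1) ^ k * (-1) ^ (k - i) :: sym) = (-1) ^ i"
        proof -
        have "((-1) ^ k :: sym) = (-1) ^ i * (-1) ^ (k - i)"
          using i by (simp flip: power_add)
        then show ?thesis by (simp only: mult.assoc minus_one_mult_self mult_1_right)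
      qed
      moreover have "a * (b * (c * d)) = (a * c) * (b * d)" for a b c d :: sym
        by (simp only: mult_ac)
      ultimately show "Const ((-1) ^ i) * (Const (of_nat (Suc i)) * perp (esym (k - i)) (p_deriv (Suc i) f)) =
          (-1) ^ k * (of_nat (Suc i) * eperp (k - i) (p_deriv (Suc i) f))"
        unfolding neg[symmetric] Const_of_nat by simp
    qed
    also have "\<dots> = Const (1 / of_nat (Suc k)) * ((-1) ^ k * - (of_nat (Suc k) * eperp (Suc k) f))"
      unfolding eperp_newton minus_minus sum_distrib_left ..
    also have "\<dots> = (-1) ^ Suc k * ((of_nat (Suc k) * Const (1 / of_nat (Suc k))) * eperp (Suc k) f)"
    proof -
      have "a * (b * - (c * d)) = - b * ((c * a) * d)" for a b c d :: sym
        by (simp add: algebra_simps)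
      then show ?thesis by simp
    qed
    finally show ?thesis unfolding Const_inverse_Suc Suc
      by (simp only: left_minus_one_mult_self mult_1_left)
  qed
qed

section \<open>The adjoints applied to complete and elementary symmetric functions\<close>

lemma sym_hom_const_poly: "sym_hom (\<lambda>f::sym. [:f:])"
  by standard (simp_all add: one_pCons)

text \<open>Removing the variable z deletes the factor 1 / (1 - z u) of H(u). Here z is
  \<open>monom 1 1\<close>, and \<open>fps_X\<close> is u.\<close>

lemma shift_hom_hsym_fps:
  "Abs_fps (\<lambda>k. shift_hom (hsym k)) =
    Abs_fps (\<lambda>k. [:hsym k:]) * (1 - fps_const (monom 1 1) * fps_X)"
proof (rule sym_hom_hsym_eq[OF sym_hom_shift_hom])
  have e: "Abs_fps (\<lambda>k. [:psym (Suc k):]) + Abs_fps (\<lambda>k. - (monom 1 1 ^ Suc k)) =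
      Abs_fps (\<lambda>k. shift_hom (psym (Suc k)))"
    by (rule fps_ext) (simp add: shift_hom_psym monom_power del: power_Suc)
  show "fps_X * fps_deriv (Abs_fps (\<lambda>k. [:hsym k:]) * (1 - fps_const (monom 1 1) * fps_X)) =
      Abs_fps (\<lambda>k. [:hsym k:]) * (1 - fps_const (monom 1 1) * fps_X) *
      (fps_X * Abs_fps (\<lambda>k. shift_hom (psym (Suc k))))"
    using log_deriv_mult[OF sym_hom_hsym_ode[OF sym_hom_const_poly] one_minus_ode[of "monom 1 1"]] unfolding e .
qed (simp add: one_pCons)

text \<open>The deleted factor of E(u) is 1 + z u, so E(u) is multiplied by the geometric series in
  - z u.\<close>

lemma shift_hom_esym_fps:
  "Abs_fps (\<lambda>k. shift_hom (esym k)) = Abs_fps (\<lambda>k. [:esym k:]) * Abs_fps (\<lambda>k. monom (-1) 1 ^ k)"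
proof (rule sym_hom_esym_eq[OF sym_hom_shift_hom])
  have e: "Abs_fps (\<lambda>k. (-1) ^ k * [:psym (Suc k):]) + Abs_fps (\<lambda>k. monom (-1) 1 ^ Suc k) =
      Abs_fps (\<lambda>k. (-1) ^ k * shift_hom (psym (Suc k)))"
  proof (rule fps_ext)
    fix k
    have "(monom (-1) 1 :: sym poly) = - monom 1 1" by (simp add: minus_monom)
    then have "(monom (-1) 1 :: sym poly) ^ Suc k = - ((-1) ^ k * monom 1 (Suc k))"
      by (simp only: power_minus[of "monom 1 1"] monom_power) simp
    then show "fps_nth (Abs_fps (\<lambda>k. (-1) ^ k * [:psym (Suc k):]) + Abs_fps (\<lambda>k. monom (-1) 1 ^ Suc k)) k =
        fps_nth (Abs_fps (\<lambda>k. (-1) ^ k * shift_hom (psym (Suc k)))) k"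
      by (simp add: shift_hom_psym right_diff_distrib del: power_Suc)
  qed
  show "fps_X * fps_deriv (Abs_fps (\<lambda>k. [:esym k:]) * Abs_fps (\<lambda>k. monom (-1) 1 ^ k)) =
      Abs_fps (\<lambda>k. [:esym k:]) * Abs_fps (\<lambda>k. monom (-1) 1 ^ k) *
      (fps_X * Abs_fps (\<lambda>k. (-1) ^ k * shift_hom (psym (Suc k))))"
    using log_deriv_mult[OF sym_hom_esym_ode[OF sym_hom_const_poly] geometric_ode[of "monom (-1) 1"]] unfolding e .
qed (simp add: one_pCons)

text \<open>The factor 1 - z u is linear in z, so only two terms of the product rule
  survive.\<close>

lemma eperp_hsym_mult:
  "eperp 0 (hsym k * f) = hsym k * eperp 0 f"
  "eperp (Suc m) (hsym 0 * f) = hsym 0 * eperp (Suc m) f"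
  "eperp (Suc m) (hsym (Suc k) * f) = hsym (Suc k) * eperp (Suc m) f - hsym k * eperp m f"
proof -
  have "shift_hom (hsym k) = fps_nth (Abs_fps (\<lambda>k. [:hsym k:]) * (1 - fps_const (monom 1 1) * fps_X)) k" for k
    using arg_cong[OF shift_hom_hsym_fps, of "\<lambda>F. fps_nth F k"] by simp
  also have "\<dots> k = [:hsym k:] - (if k = 0 then 0 else monom 1 1 * [:hsym (k - 1):])" for k
    by (simp add: right_diff_distrib mult.assoc[symmetric] del: hsym.simps)
  finally have s: "shift_hom (hsym k * f) = smult (hsym k) (shift_hom f) -
      (if k = 0 then 0 else monom 1 1 * smult (hsym (k - 1)) (shift_hom f))" for k
    by (simp add: sym_hom.mult[OF sym_hom_shift_hom] left_diff_distrib mult.assoc del: hsym.simps)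
  show "eperp 0 (hsym k * f) = hsym k * eperp 0 f"
    by (simp add: eperp_def s coeff_monom_mult del: hsym.simps)
  show "eperp (Suc m) (hsym 0 * f) = hsym 0 * eperp (Suc m) f"
    by (simp add: eperp_def s)
  show "eperp (Suc m) (hsym (Suc k) * f) = hsym (Suc k) * eperp (Suc m) f - hsym k * eperp m f"
    by (simp add: eperp_def s coeff_monom_mult del: hsym.simps)
qed

lemma eperp_esym: "eperp m (esym k) = (if m \<le> k then (-1) ^ m * esym (k - m) else 0)"
proof -
  have "shift_hom (esym k) = (\<Sum>i\<le>k. monom (-1) 1 ^ i * [:esym (k - i):])"
    using arg_cong[OF shift_hom_esym_fps, of "\<lambda>F. fps_nth F k"]
    by (simp add: mult.commute[of "Abs_fps (\<lambda>k. [:esym k:])"] fps_mult_nth atMost_atLeast0)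
  moreover have "poly.coeff (monom (-1) 1 ^ i * [:esym (k - i):]) m = (if i = m then (-1) ^ m * esym (k - m) else 0)" for i
    by (simp add: monom_power mult.commute)
  ultimately have "eperp m (esym k) = (\<Sum>i\<le>k. if i = m then (-1) ^ m * esym (k - m) else 0)"
    unfolding eperp_def by (simp only: coeff_sum)
  then show ?thesis by simp
qed

section \<open>The coefficients of the generating function \<open>E(-tu)H(u)\<close>\<close>

definition fps_eperp :: "nat \<Rightarrow> sym fps \<Rightarrow> sym fps" where
  "fps_eperp m F = Abs_fps (\<lambda>n. eperp m (fps_nth F n))"

lemma fps_eperp_nth [simp]: "fps_nth (fps_eperp m F) n = eperp m (fps_nth F n)"
  by (simp add: fps_eperp_def)

lemma eperp_sum: "eperp m (sum f S) = (\<Sum>a\<in>S. eperp m (f a))"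
  by (induction S rule: infinite_finite_induct) (simp_all add: eperp_zero eperp_add)

lemma fps_eperp_zero: "fps_eperp m 0 = 0"
  by (rule fps_ext) (simp add: eperp_zero)

lemma fps_eperp_one: "fps_eperp m 1 = (if m = 0 then 1 else 0)"
  by (rule fps_ext) (simp add: eperp_zero eperp_one)

lemma fps_eperp_add: "fps_eperp m (F + G) = fps_eperp m F + fps_eperp m G"
  by (rule fps_ext) (simp add: eperp_add)

lemma fps_eperp_sum: "fps_eperp m (sum F S) = (\<Sum>a\<in>S. fps_eperp m (F a))"
  by (induction S rule: infinite_finite_induct) (simp_all add: fps_eperp_zero fps_eperp_add)

lemma fps_eperp_mult: "fps_eperp m (F * G) = (\<Sum>i\<le>m. fps_eperp i F * fps_eperp (m - i) G)"
proof (rule fps_ext)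
  fix n
  have "fps_nth (fps_eperp m (F * G)) n =
      (\<Sum>a=0..n. \<Sum>i\<le>m. eperp i (fps_nth F a) * eperp (m - i) (fps_nth G (n - a)))"
    by (simp add: fps_mult_nth eperp_sum eperp_mult)
  also have "\<dots> = fps_nth (\<Sum>i\<le>m. fps_eperp i F * fps_eperp (m - i) G) n"
    by (subst sum.swap) (simp add: fps_sum_nth fps_mult_nth)
  finally show "fps_nth (fps_eperp m (F * G)) n = fps_nth (\<Sum>i\<le>m. fps_eperp i F * fps_eperp (m - i) G) n" .
qed

text \<open>The hypotheses say that \<open>c\<close> is invariant under p_k -> p_k - z^k, as powers
  of t and complex scalars are.\<close>

lemma fps_eperp_const_mult:
  assumes "\<And>k. 0 < k \<Longrightarrow> fps_eperp k c = 0" "fps_eperp 0 c = c"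
  shows "fps_eperp m (c * F) = c * fps_eperp m F"
proof -
  have "fps_eperp m (c * F) = (\<Sum>i\<in>{0}. fps_eperp i c * fps_eperp (m - i) F)"
    unfolding fps_eperp_mult by (rule sum.mono_neutral_right) (auto simp: assms(1))
  then show ?thesis by (simp add: assms(2))
qed

lemma eperp_neg_one: "eperp m (-1) = (if m = 0 then -1 else 0)"
proof -
  have "(-1 :: sym) = Const (-1)" by (simp add: Const_def single_uminus)
  then show ?thesis using eperp_Const[of m "-1"] by metis
qed

lemma fps_eperp_X_power_mult: "fps_eperp m ((- fps_X) ^ i * F) = (- fps_X) ^ i * fps_eperp m F"
proof (induction i arbitrary: F)
  case (Suc i)
  have X: "fps_eperp k (- fps_X) = (if k = 0 then - fps_X else 0)" for k
    by (rule fps_ext) (simp add: eperp_neg_one eperp_zero fps_X_def)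
  have "fps_eperp m ((- fps_X) ^ Suc i * F) = fps_eperp m ((- fps_X) ^ i * (- fps_X * F))"
    by (simp only: power_Suc2 mult.assoc)
  also have "\<dots> = (- fps_X) ^ i * (- fps_X * fps_eperp m F)"
    unfolding Suc by (subst fps_eperp_const_mult) (auto simp: X)
  finally show ?case by (simp only: power_Suc2 mult.assoc)
qed simp

lemma scalar_eperp: "fps_eperp m (scalar c * F) = scalar c * fps_eperp m F"
proof (rule fps_eperp_const_mult)
  show "fps_eperp k (scalar c) = 0" if "0 < k" for k
    by (rule fps_ext) (use that in \<open>simp add: scalar_def eperp_zero eperp_Const\<close>)
  show "fps_eperp 0 (scalar c) = scalar c"
    by (rule fps_ext) (simp add: scalar_def eperp_zero eperp_Const)
qed

lemma fps_eperp_fps_const: "fps_eperp m (fps_const f) = fps_const (eperp m f)"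
  by (rule fps_ext) (simp add: eperp_zero)

lemma hl_q_int: "hl_q (int k) = (\<Sum>i\<le>k. (- fps_X) ^ i * fps_const (esym i * hsym (k - i)))"
  by (simp add: hl_q_def)

lemma hl_q_neg: "k < 0 \<Longrightarrow> hl_q k = 0"
  by (simp add: hl_q_def)

lemma hl_q_0: "hl_q 0 = 1"
  using hl_q_int[of 0] by simp

text \<open>The coefficient of z^m u^k in E(-tu) H(u) / (1 - t z u): only the elementary factors are
  shifted, and the sign in \<open>eperp_esym\<close> cancels that of (-t)^m.\<close>

lemma sum_eperp_esym_hsym:
  "(\<Sum>i\<le>k. (- fps_X) ^ i * fps_const (hsym (k - i) * eperp m (esym i))) = fps_X ^ m * hl_q (int k - int m)"
proof (cases "m \<le> k")
  case False
  then show ?thesis by (simp add: hl_q_neg eperp_esym)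
next
  case True
  have sq: "(- fps_X) ^ (m + i) * fps_const (h * ((-1) ^ m * e)) = fps_X ^ m * ((- fps_X) ^ i * fps_const (e * h))"
    for i and e h :: sym
  proof -
    have "(- fps_X :: sym fps) ^ m * fps_const ((-1) ^ m) = fps_X ^ m"
    proof -
      have "fps_const ((-1) ^ m :: sym) = (-1) ^ m" by (metis fps_const_power fps_const_neg fps_const_1_eq_1)
      then show ?thesis unfolding power_mult_distrib[symmetric] by (simp only: power_mult_distrib[symmetric] minus_mult_minus mult_1_right)
    qed
    moreover have "a * b * (c * (d * e)) = (a * d) * (b * (e * c))" for a b c d e :: "sym fps"
      by (simp only: mult_ac)
    ultimately show ?thesis unfolding power_add fps_const_mult[symmetric] by metis
  qed
  have "(\<Sum>i\<le>k. (- fps_X) ^ i * fps_const (hsym (k - i) * eperp m (esym i))) =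
      (\<Sum>i\<in>{m..k}. (- fps_X) ^ i * fps_const (hsym (k - i) * ((-1) ^ m * esym (i - m))))"
    by (rule sum.mono_neutral_cong_right) (auto simp: eperp_esym)
  also have "\<dots> = (\<Sum>i\<in>{0..k - m}. (- fps_X) ^ (m + i) * fps_const (hsym (k - (m + i)) * ((-1) ^ m * esym i)))"
    using True by (intro sum.reindex_bij_witness[of _ "\<lambda>i. m + i" "\<lambda>i. i - m"]) auto
  also have "\<dots> = fps_X ^ m * hl_q (int (k - m))"
    unfolding sq hl_q_int sum_distrib_left by (rule sum.cong) auto
  finally show ?thesis using True by (simp add: of_nat_diff)
qed

text \<open>With z = 1/u_i and u = u_j the factor (1 - z u) / (1 - t z u) is the one belonging to
  the pair (i, j), which is why its coefficients are \<open>hl_c\<close>.\<close>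

lemma fps_eperp_hl_q: "fps_eperp m (hl_q k) = hl_c m * hl_q (k - int m)"
proof (cases "k < 0")
  case True
  then show ?thesis by (simp add: hl_q_neg fps_eperp_zero)
next
  case False
  then obtain j where k: "k = int j" by (metis nat_int_comparison(1) not_le zero_le_imp_eq_int)
  have e: "fps_eperp m (hl_q k) = (\<Sum>i\<le>j. (- fps_X) ^ i * fps_const (eperp m (hsym (j - i) * esym i)))" for m
    unfolding k hl_q_int fps_eperp_sum fps_eperp_X_power_mult fps_eperp_fps_const
    by (simp only: mult.commute[of "hsym _"])
  show ?thesis
  proof (cases m)
    case 0
    then show ?thesis unfolding e by (simp only: eperp_hsym_mult sum_eperp_esym_hsym) (simp add: hl_c_def k)
  next
    case [simp]: (Suc m')
    show ?thesis
    proof (cases j)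
      case 0
      then show ?thesis by (simp add: k hl_q_0 hl_q_neg fps_eperp_one)
    next
      case [simp]: (Suc j')
      \<comment> \<open>The two parts come from the terms 1 and - z u of the numerator. The summand
        \<open>i = j\<close> carries h_0, for which the second part is absent.\<close>
      have "fps_eperp m (hl_q k) = (\<Sum>i\<le>j. (- fps_X) ^ i * fps_const (hsym (j - i) * eperp m (esym i))
          - (if i \<le> j' then (- fps_X) ^ i * fps_const (hsym (j' - i) * eperp m' (esym i)) else 0))"
        unfolding e
      proof (rule sum.cong[OF refl])
        fix i assume "i \<in> {..j}"
        then consider "i \<le> j'" "j - i = Suc (j' - i)" | "\<not> i \<le> j'" "j - i = 0" by force
        then show "(- fps_X) ^ i * fps_const (eperp m (hsym (j - i) * esym i)) =
            (- fps_X) ^ i * fps_const (hsym (j - i) * eperp m (esym i))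
          - (if i \<le> j' then (- fps_X) ^ i * fps_const (hsym (j' - i) * eperp m' (esym i)) else 0)"
        proof cases
          case 1
          show ?thesis unfolding 1(2) \<open>m = Suc m'\<close> eperp_hsym_mult if_P[OF 1(1)]
            by (simp only: fps_const_sub[symmetric] right_diff_distrib)
        next
          case 2
          show ?thesis unfolding 2(2) \<open>m = Suc m'\<close> eperp_hsym_mult if_not_P[OF 2(1)] by simp
        qed
      qed
      also have "\<dots> = fps_X ^ m * hl_q (int j - int m)
          - (\<Sum>i\<le>j. if i \<le> j' then (- fps_X) ^ i * fps_const (hsym (j' - i) * eperp m' (esym i)) else 0)"
        unfolding sum_subtractf sum_eperp_esym_hsym ..
      also have "(\<Sum>i\<le>j. if i \<le> j' then (- fps_X) ^ i * fps_const (hsym (j' - i) * eperp m' (esym i)) else 0)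
          = fps_X ^ m' * hl_q (int j' - int m')"
        unfolding sum_eperp_esym_hsym[symmetric] by (rule sum.mono_neutral_cong_right) auto
      finally show ?thesis by (simp add: hl_c_def k left_diff_distrib del: power_Suc)
    qed
  qed
qed

section \<open>Vertex operators on \<open>\<Lambda>[t]\<close>\<close>

definition Lambda_t :: "sym fps set" where
  "Lambda_t = range fps_of_poly"

lemma Lambda_t_iff: "F \<in> Lambda_t \<longleftrightarrow> (\<exists>N. \<forall>n>N. fps_nth F n = 0)"
proof
  assume "F \<in> Lambda_t"
  then obtain p where p: "F = fps_of_poly p" unfolding Lambda_t_def by blast
  then have "\<forall>n>degree p. fps_nth F n = 0" by (simp add: coeff_eq_0)
  then show "\<exists>N. \<forall>n>N. fps_nth F n = 0" by blast
next
  assume "\<exists>N. \<forall>n>N. fps_nth F n = 0"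
  then obtain N where N: "\<And>n. n > N \<Longrightarrow> fps_nth F n = 0" by blast
  then have "\<forall>\<^sub>\<infinity>n. fps_nth F n = 0" by (auto simp: MOST_nat)
  then have "F = fps_of_poly (Abs_poly (fps_nth F))"
    by (intro fps_ext) (simp add: Abs_poly_inverse)
  then show "F \<in> Lambda_t" unfolding Lambda_t_def by blast
qed

lemma Lambda_t_closed:
  "0 \<in> Lambda_t" "1 \<in> Lambda_t" "fps_X \<in> Lambda_t" "fps_const f \<in> Lambda_t"
  "F \<in> Lambda_t \<Longrightarrow> G \<in> Lambda_t \<Longrightarrow> F + G \<in> Lambda_t"
  "F \<in> Lambda_t \<Longrightarrow> G \<in> Lambda_t \<Longrightarrow> F - G \<in> Lambda_t"
  "F \<in> Lambda_t \<Longrightarrow> G \<in> Lambda_t \<Longrightarrow> F * G \<in> Lambda_t"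
  "F \<in> Lambda_t \<Longrightarrow> - F \<in> Lambda_t"
proof -
  show "0 \<in> Lambda_t" unfolding Lambda_t_def by (metis fps_of_poly_0 rangeI)
  show "1 \<in> Lambda_t" unfolding Lambda_t_def by (metis fps_of_poly_1 rangeI)
  show "fps_X \<in> Lambda_t" unfolding Lambda_t_def by (metis fps_of_poly_fps_X rangeI)
  show "fps_const f \<in> Lambda_t" unfolding Lambda_t_def by (metis fps_of_poly_const rangeI)
  show "F \<in> Lambda_t \<Longrightarrow> G \<in> Lambda_t \<Longrightarrow> F + G \<in> Lambda_t" unfolding Lambda_t_def by (elim rangeE) (metis fps_of_poly_add rangeI)
  show "F \<in> Lambda_t \<Longrightarrow> G \<in> Lambda_t \<Longrightarrow> F - G \<in> Lambda_t" unfolding Lambda_t_def by (elim rangeE) (metis fps_of_poly_diff rangeI)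
  show "F \<in> Lambda_t \<Longrightarrow> G \<in> Lambda_t \<Longrightarrow> F * G \<in> Lambda_t" unfolding Lambda_t_def by (elim rangeE) (metis fps_of_poly_mult rangeI)
  show "F \<in> Lambda_t \<Longrightarrow> - F \<in> Lambda_t" unfolding Lambda_t_def by (elim rangeE) (metis fps_of_poly_uminus rangeI)
qed

lemma Lambda_t_sum:
  assumes "\<And>a. a \<in> S \<Longrightarrow> f a \<in> Lambda_t"
  shows "sum f S \<in> Lambda_t"
  using assms by (induction S rule: infinite_finite_induct) (auto intro: Lambda_t_closed)

lemma Lambda_t_prod:
  assumes "\<And>a. a \<in> S \<Longrightarrow> f a \<in> Lambda_t"
  shows "prod f S \<in> Lambda_t"
  using assms by (induction S rule: infinite_finite_induct) (auto intro: Lambda_t_closed)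

lemma Lambda_t_power: "F \<in> Lambda_t \<Longrightarrow> F ^ n \<in> Lambda_t"
  by (induction n) (simp_all add: Lambda_t_closed)

lemma Lambda_t_scalar: "scalar c \<in> Lambda_t"
  unfolding scalar_def by (rule Lambda_t_closed)

lemma Lambda_t_hl_q: "hl_q k \<in> Lambda_t"
  by (auto simp: hl_q_def intro!: Lambda_t_sum Lambda_t_power Lambda_t_closed)

lemma Lambda_t_hl_c: "hl_c k \<in> Lambda_t"
  by (auto simp: hl_c_def intro!: Lambda_t_power Lambda_t_closed)

lemma Lambda_t_fps_eperp: "F \<in> Lambda_t \<Longrightarrow> fps_eperp m F \<in> Lambda_t"
  unfolding Lambda_t_iff fps_eperp_nth by (metis eperp_zero)

text \<open>Here polynomiality in t enters: the bounds for the single coefficients have a maximum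
  because only finitely many coefficients are non-zero.\<close>

lemma fps_eperp_eventually_zero:
  assumes "F \<in> Lambda_t"
  shows "\<exists>M. \<forall>m\<ge>M. fps_eperp m F = 0"
proof -
  obtain N where N: "\<And>n. n > N \<Longrightarrow> fps_nth F n = 0" using assms unfolding Lambda_t_iff by blast
  obtain M where M: "\<And>n m. m \<ge> M n \<Longrightarrow> eperp m (fps_nth F n) = 0"
  proof -
    have "\<forall>n. \<exists>M. \<forall>m\<ge>M. eperp m (fps_nth F n) = 0" using eventually_eperp_zero by blast
    from choice[OF this] that show ?thesis by blast
  qed
  have "fps_eperp m F = 0" if m: "m \<ge> Max (M ` {..N})" for m
  proof (rule fps_ext)
    fix n
    show "fps_nth (fps_eperp m F) n = fps_nth 0 n"
    proof (cases "n > N")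
      case False
      then have "M n \<le> Max (M ` {..N})" by (intro Max_ge) auto
      with m have "M n \<le> m" by (rule order_trans[rotated])
      with M show ?thesis by simp
    qed (simp add: N eperp_zero)
  qed
  then show ?thesis by blast
qed

lemma fps_fam_sum_eq_sum:
  assumes "finite I" "I \<subseteq> S" "\<And>a. a \<in> S - I \<Longrightarrow> f a = 0"
  shows "fps_fam_sum f S = sum f I"
proof (rule fps_ext)
  fix n
  have "sum' (\<lambda>a. fps_nth (f a) n) S = sum' (\<lambda>a. fps_nth (f a) n) I"
    by (rule sum.mono_neutral_right') (use assms in auto)
  then show "fps_nth (fps_fam_sum f S) n = fps_nth (sum f I) n"
    by (simp add: fps_fam_sum_def fps_sum_nth assms(1))
qed

text \<open>The bound \<open>M\<close> is left free, so that the series for several arguments can be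
  cut off at a common place.\<close>

lemma hl_Gamma_eq_sum:
  assumes "\<And>m. m \<ge> M \<Longrightarrow> fps_eperp m F = 0"
  shows "hl_Gamma k F = (\<Sum>m<M. hl_q (int m - k) * fps_eperp m F)"
proof -
  have e: "(-1) ^ m * hl_q (int m - k) * Abs_fps (\<lambda>n. perp (esym m) (fps_nth F n)) =
      hl_q (int m - k) * fps_eperp m F" for m
  proof -
    have c: "((-1) ^ m :: sym fps) = fps_const ((-1) ^ m)"
      by (metis fps_const_power fps_const_neg fps_const_1_eq_1)
    have "(-1) ^ m * Abs_fps (\<lambda>n. perp (esym m) (fps_nth F n)) = fps_eperp m F"
      unfolding c by (rule fps_ext) (simp add: eperp_eq_perp)
    moreover have "a * b * c = b * (a * c)" for a b c :: "sym fps" by (simp only: mult_ac)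
    ultimately show ?thesis by simp
  qed
  show ?thesis unfolding hl_Gamma_def e
    by (rule fps_fam_sum_eq_sum) (auto simp: assms)
qed

lemma hl_Gamma_add:
  assumes "F \<in> Lambda_t" "G \<in> Lambda_t"
  shows "hl_Gamma k (F + G) = hl_Gamma k F + hl_Gamma k G"
proof -
  obtain M N where M: "\<And>m. m \<ge> M \<Longrightarrow> fps_eperp m F = 0" "\<And>m. m \<ge> N \<Longrightarrow> fps_eperp m G = 0"
    using fps_eperp_eventually_zero[OF assms(1)] fps_eperp_eventually_zero[OF assms(2)] by blast
  show ?thesis
    by (subst (1 2 3) hl_Gamma_eq_sum[where M = "max M N"])
      (auto simp: M fps_eperp_add distrib_left sum.distrib)
qed

lemma hl_Gamma_scalar_mult:
  assumes "F \<in> Lambda_t"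
  shows "hl_Gamma k (scalar c * F) = scalar c * hl_Gamma k F"
proof -
  obtain M where M: "\<And>m. m \<ge> M \<Longrightarrow> fps_eperp m F = 0"
    using fps_eperp_eventually_zero[OF assms] by blast
  show ?thesis
    by (subst (1 2) hl_Gamma_eq_sum[where M = M])
      (auto simp: M scalar_eperp sum_distrib_left mult.left_commute)
qed

lemma Lambda_t_hl_Gamma:
  assumes "F \<in> Lambda_t"
  shows "hl_Gamma k F \<in> Lambda_t"
proof -
  obtain M where "\<And>m. m \<ge> M \<Longrightarrow> fps_eperp m F = 0"
    using fps_eperp_eventually_zero[OF assms] by blast
  then show ?thesis using assms
    by (subst hl_Gamma_eq_sum[where M = M])
      (auto intro!: Lambda_t_sum Lambda_t_hl_q Lambda_t_fps_eperp Lambda_t_closed)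
qed

lemma hl_Gamma_zero: "hl_Gamma k 0 = 0"
  by (subst hl_Gamma_eq_sum[of 0]) (auto simp: fps_eperp_zero)

lemma hl_Gamma_sum:
  "(\<And>a. a \<in> S \<Longrightarrow> F a \<in> Lambda_t) \<Longrightarrow> hl_Gamma k (sum F S) = (\<Sum>a\<in>S. hl_Gamma k (F a))"
proof (induction S rule: infinite_finite_induct)
  case (insert x S)
  have "F x \<in> Lambda_t" "sum F S \<in> Lambda_t" using insert.prems by (auto intro!: Lambda_t_sum)
  from hl_Gamma_add[OF this] show ?case using insert by simp
qed (simp_all add: hl_Gamma_zero)

lemma hl_Gamma_eventually_zero:
  assumes "F \<in> Lambda_t"
  shows "\<exists>K. \<forall>k>K. hl_Gamma k F = 0"
proof -
  obtain M where M: "\<And>m. m \<ge> M \<Longrightarrow> fps_eperp m F = 0"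
    using fps_eperp_eventually_zero[OF assms] by blast
  have "hl_Gamma k F = 0" if "k > int M" for k
    by (subst hl_Gamma_eq_sum[where M = M]) (use that in \<open>auto simp: M hl_q_neg\<close>)
  then show ?thesis by blast
qed

section \<open>The recursion for \<open>F\<^sub>\<lambda>\<close>\<close>

definition pairs_from :: "nat \<Rightarrow> nat \<Rightarrow> (nat \<times> nat) set" where
  "pairs_from a l = {(i, j). a \<le> i \<and> i < j \<and> j \<le> l}"

definition hl_arg :: "nat \<Rightarrow> nat \<Rightarrow> (nat \<Rightarrow> int) \<Rightarrow> (nat \<times> nat \<Rightarrow> nat) \<Rightarrow> nat \<Rightarrow> int" where
  "hl_arg a l lam s i = lam i + (\<Sum>j\<in>{i<..l}. int (s (i, j))) - (\<Sum>j\<in>{a..<i}. int (s (j, i)))"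

definition hl_summand :: "nat \<Rightarrow> nat \<Rightarrow> (nat \<Rightarrow> int) \<Rightarrow> (nat \<times> nat \<Rightarrow> nat) \<Rightarrow> sym fps" where
  "hl_summand a l lam s = (\<Prod>p\<in>pairs_from a l. hl_c (s p)) * (\<Prod>i=a..l. hl_q (hl_arg a l lam s i))"

definition hl_support :: "nat \<Rightarrow> nat \<Rightarrow> (nat \<Rightarrow> int) \<Rightarrow> (nat \<times> nat \<Rightarrow> nat) set" where
  "hl_support a l lam = {s \<in> pairs_from a l \<rightarrow>\<^sub>E UNIV. \<forall>i\<in>{a..l}. 0 \<le> hl_arg a l lam s i}"

text \<open>\<open>F\<^sub>\<lambda>\<close> for the sequence \<open>\<lambda>\<^sub>a, \<dots>, \<lambda>\<^sub>l\<close>.\<close>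

definition hl_F_from :: "nat \<Rightarrow> nat \<Rightarrow> (nat \<Rightarrow> int) \<Rightarrow> sym fps" where
  "hl_F_from a l lam = sum' (hl_summand a l lam) (pairs_from a l \<rightarrow>\<^sub>E UNIV)"

lemma hl_F_eq_hl_F_from: "hl_F l = hl_F_from 1 l"
  by (rule ext) (simp add: hl_F_def hl_F_from_def hl_summand_def[abs_def] hl_arg_def pairs_def pairs_from_def)

lemma finite_pairs_from: "finite (pairs_from a l)"
  by (rule finite_subset[of _ "{..l} \<times> {..l}"]) (auto simp: pairs_from_def)

lemma hl_summand_eq_0:
  assumes "s \<in> pairs_from a l \<rightarrow>\<^sub>E UNIV" "s \<notin> hl_support a l lam"
  shows "hl_summand a l lam s = 0"
proof -
  obtain i where "i \<in> {a..l}" "hl_arg a l lam s i < 0"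
    using assms by (auto simp: hl_support_def not_le)
  then have "(\<Prod>i=a..l. hl_q (hl_arg a l lam s i)) = 0"
    by (intro prod_zero) (auto intro!: bexI[of _ i] simp: hl_q_neg)
  then show ?thesis by (simp add: hl_summand_def)
qed

text \<open>The exponents \<open>f\<close> of the pairs (a, j) are separated from the exponents
  \<open>s\<close> of the pairs within a + 1, ..., l, since the operator for u_a creates exactly the
  former.\<close>

definition join_pairs :: "nat \<Rightarrow> nat \<Rightarrow> (nat \<times> nat \<Rightarrow> nat) \<Rightarrow> (nat \<Rightarrow> nat) \<Rightarrow> nat \<times> nat \<Rightarrow> nat" where
  "join_pairs a l s f p = (if fst p = a \<and> snd p \<in> {a<..l} then f (snd p) else s p)"

lemma bij_betw_join_pairs:
  "bij_betw (\<lambda>(s, f). join_pairs a l s f)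
    ((pairs_from (Suc a) l \<rightarrow>\<^sub>E UNIV) \<times> ({a<..l} \<rightarrow>\<^sub>E UNIV)) (pairs_from a l \<rightarrow>\<^sub>E UNIV)"
proof (rule bij_betw_byWitness[where f' = "\<lambda>s. (restrict s (pairs_from (Suc a) l), restrict (\<lambda>j. s (a, j)) {a<..l})"])
  show "\<forall>sf\<in>(pairs_from (Suc a) l \<rightarrow>\<^sub>E UNIV) \<times> ({a<..l} \<rightarrow>\<^sub>E UNIV).
      (restrict ((\<lambda>(s, f). join_pairs a l s f) sf) (pairs_from (Suc a) l),
        \<lambda>j\<in>{a<..l}. ((\<lambda>(s, f). join_pairs a l s f) sf) (a, j)) = sf"
  proof (clarify, intro conjI ext)
    fix s :: "nat \<times> nat \<Rightarrow> nat" and f :: "nat \<Rightarrow> nat" and p j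
    assume s: "s \<in> pairs_from (Suc a) l \<rightarrow>\<^sub>E UNIV" and f: "f \<in> {a<..l} \<rightarrow>\<^sub>E UNIV"
    show "restrict (join_pairs a l s f) (pairs_from (Suc a) l) p = s p"
      using s by (cases p) (auto simp: join_pairs_def pairs_from_def restrict_def PiE_def extensional_def)
    show "restrict (\<lambda>j. join_pairs a l s f (a, j)) {a<..l} j = f j"
      using f by (auto simp: join_pairs_def restrict_def PiE_def extensional_def)
  qed
  show "\<forall>s\<in>pairs_from a l \<rightarrow>\<^sub>E UNIV. (\<lambda>(s, f). join_pairs a l s f)
      (restrict s (pairs_from (Suc a) l), \<lambda>j\<in>{a<..l}. s (a, j)) = s"
    by (force simp: join_pairs_def pairs_from_def restrict_def PiE_def extensional_def fun_eq_iff)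
  show "(\<lambda>(s, f). join_pairs a l s f) ` ((pairs_from (Suc a) l \<rightarrow>\<^sub>E UNIV) \<times> ({a<..l} \<rightarrow>\<^sub>E UNIV)) \<subseteq> pairs_from a l \<rightarrow>\<^sub>E UNIV"
    by (auto simp: join_pairs_def pairs_from_def PiE_def extensional_def)
  show "(\<lambda>s. (restrict s (pairs_from (Suc a) l), \<lambda>j\<in>{a<..l}. s (a, j))) ` (pairs_from a l \<rightarrow>\<^sub>E UNIV)
      \<subseteq> (pairs_from (Suc a) l \<rightarrow>\<^sub>E UNIV) \<times> ({a<..l} \<rightarrow>\<^sub>E UNIV)"
    by auto
qed

lemma hl_arg_join_pairs:
  "hl_arg a l lam (join_pairs a l s f) a = lam a + int (\<Sum>j\<in>{a<..l}. f j)"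
  "i \<in> {a<..l} \<Longrightarrow> hl_arg a l lam (join_pairs a l s f) i = hl_arg (Suc a) l lam s i - int (f i)"
proof -
  show "hl_arg a l lam (join_pairs a l s f) a = lam a + int (\<Sum>j\<in>{a<..l}. f j)"
    by (auto simp: hl_arg_def join_pairs_def intro!: sum.cong)
  assume i: "i \<in> {a<..l}"
  then have e: "{a..<i} = insert a {Suc a..<i}" by auto
  have "(\<Sum>j\<in>{i<..l}. int (join_pairs a l s f (i, j))) = (\<Sum>j\<in>{i<..l}. int (s (i, j)))"
    by (rule sum.cong) (use i in \<open>auto simp: join_pairs_def\<close>)
  moreover have "(\<Sum>j\<in>{a..<i}. int (join_pairs a l s f (j, i))) = int (f i) + (\<Sum>j\<in>{Suc a..<i}. int (s (j, i)))"
    unfolding e using i by (simp add: join_pairs_def)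
  ultimately show "hl_arg a l lam (join_pairs a l s f) i = hl_arg (Suc a) l lam s i - int (f i)"
    by (simp add: hl_arg_def)
qed

lemma hl_summand_join_pairs:
  assumes "a \<le> l"
  shows "hl_summand a l lam (join_pairs a l s f) =
    hl_q (lam a + int (\<Sum>j\<in>{a<..l}. f j)) * ((\<Prod>p\<in>pairs_from (Suc a) l. hl_c (s p)) *
      (\<Prod>i\<in>{a<..l}. hl_c (f i) * hl_q (hl_arg (Suc a) l lam s i - int (f i))))"
proof -
  have e: "{a..l} = insert a {a<..l}" using assms by auto
  have p: "pairs_from a l = Pair a ` {a<..l} \<union> pairs_from (Suc a) l" by (auto simp: pairs_from_def)
  have "(\<Prod>p\<in>pairs_from a l. hl_c (join_pairs a l s f p)) =
      (\<Prod>p\<in>Pair a ` {a<..l}. hl_c (join_pairs a l s f p)) * (\<Prod>p\<in>pairs_from (Suc a) l. hl_c (join_pairs a l s f p))"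
    unfolding p by (rule prod.union_disjoint) (use finite_pairs_from in \<open>auto simp: pairs_from_def\<close>)
  also have "(\<Prod>p\<in>Pair a ` {a<..l}. hl_c (join_pairs a l s f p)) = (\<Prod>i\<in>{a<..l}. hl_c (f i))"
    by (subst prod.reindex) (auto simp: inj_on_def join_pairs_def intro!: prod.cong)
  also have "(\<Prod>p\<in>pairs_from (Suc a) l. hl_c (join_pairs a l s f p)) = (\<Prod>p\<in>pairs_from (Suc a) l. hl_c (s p))"
    by (rule prod.cong) (auto simp: join_pairs_def pairs_from_def)
  finally have 1: "(\<Prod>p\<in>pairs_from a l. hl_c (join_pairs a l s f p)) =
      (\<Prod>i\<in>{a<..l}. hl_c (f i)) * (\<Prod>p\<in>pairs_from (Suc a) l. hl_c (s p))" .
  have 2: "(\<Prod>i=a..l. hl_q (hl_arg a l lam (join_pairs a l s f) i)) = hl_q (lam a + int (\<Sum>j\<in>{a<..l}. f j)) *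
      (\<Prod>i\<in>{a<..l}. hl_q (hl_arg (Suc a) l lam s i - int (f i)))"
    unfolding e by (simp add: hl_arg_join_pairs)
  have "c * d * (q * r) = q * (d * (c * r))" for c d q r :: "sym fps" by (simp only: mult_ac)
  then show ?thesis unfolding hl_summand_def 1 2 prod.distrib .
qed

text \<open>Dropping the pairs that contain \<open>a\<close> adds \<open>f i\<close> to the i-th
  argument. The smaller family therefore lies in its own support, and its i-th argument bounds
  \<open>f i\<close>.\<close>

lemma finite_hl_support: "finite (hl_support a l lam)"
proof (cases "a \<le> l")
  case True
  then show ?thesis
  proof (induction rule: inc_induct)
    case base
    have "pairs_from l l = {}" by (auto simp: pairs_from_def)
    then show ?case by (auto simp: hl_support_def intro: finite_subset[of _ "{\<lambda>_. undefined}"])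
  next
    case (step a)
    let ?D = "SIGMA s:hl_support (Suc a) l lam. PiE {a<..l} (\<lambda>i. {..nat (hl_arg (Suc a) l lam s i)})"
    have "hl_support a l lam \<subseteq> (\<lambda>(s, f). join_pairs a l s f) ` ?D"
    proof
      fix s assume s: "s \<in> hl_support a l lam"
      then have "s \<in> (\<lambda>(s, f). join_pairs a l s f) ` ((pairs_from (Suc a) l \<rightarrow>\<^sub>E UNIV) \<times> ({a<..l} \<rightarrow>\<^sub>E UNIV))"
        using bij_betw_imp_surj_on[OF bij_betw_join_pairs] by (auto simp: hl_support_def)
      then obtain s' f where s': "s = join_pairs a l s' f" "s' \<in> pairs_from (Suc a) l \<rightarrow>\<^sub>E UNIV" "f \<in> {a<..l} \<rightarrow>\<^sub>E UNIV"
        by auto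
      have f: "int (f i) \<le> hl_arg (Suc a) l lam s' i" if "i \<in> {a<..l}" for i
      proof -
        have "0 \<le> hl_arg a l lam s i" using s that by (simp add: hl_support_def)
        then show ?thesis unfolding s'(1) hl_arg_join_pairs(2)[OF that] by simp
      qed
      have "0 \<le> hl_arg (Suc a) l lam s' i" if "i \<in> {Suc a..l}" for i
        using f[of i] that by simp
      then have "s' \<in> hl_support (Suc a) l lam" using s'(2) by (simp add: hl_support_def)
      moreover have "f \<in> PiE {a<..l} (\<lambda>i. {..nat (hl_arg (Suc a) l lam s' i)})"
      proof (rule PiE_I)
        fix i assume "i \<in> {a<..l}"
        from f[OF this] show "f i \<in> {..nat (hl_arg (Suc a) l lam s' i)}" by simp
      next
        fix i assume "i \<notin> {a<..l}"
        with s'(3) show "f i = undefined" by (rule PiE_arb)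
      qed
      ultimately show "s \<in> (\<lambda>(s, f). join_pairs a l s f) ` ?D" using s'(1) by auto
    qed
    then show ?case
      by (rule finite_subset) (auto intro!: finite_imageI finite_SigmaI finite_PiE step.IH)
  qed
next
  case False
  then have "pairs_from a l = {}" by (auto simp: pairs_from_def)
  then show ?thesis by (auto simp: hl_support_def intro: finite_subset[of _ "{\<lambda>_. undefined}"])
qed

lemma hl_F_from_eq_sum:
  "hl_F_from a l lam = (\<Sum>s\<in>hl_support a l lam. hl_summand a l lam s)"
proof -
  have "hl_F_from a l lam = sum' (hl_summand a l lam) (hl_support a l lam)"
    unfolding hl_F_from_def
    by (rule sum.mono_neutral_right') (use hl_summand_eq_0 in \<open>auto simp: hl_support_def\<close>)
  then show ?thesis by (simp add: finite_hl_support)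
qed

lemma Lambda_t_hl_F_from: "hl_F_from a l lam \<in> Lambda_t"
  unfolding hl_F_from_eq_sum hl_summand_def
  by (intro Lambda_t_sum Lambda_t_closed Lambda_t_prod Lambda_t_hl_c Lambda_t_hl_q)

lemma hl_F_from_empty: "hl_F_from (Suc l) l lam = 1"
proof -
  have "pairs_from (Suc l) l = {}" by (auto simp: pairs_from_def)
  then show ?thesis by (simp add: hl_F_from_def hl_summand_def)
qed

lemma finite_fixed_sum_PiE:
  assumes "finite J"
  shows "finite {f \<in> J \<rightarrow>\<^sub>E (UNIV::nat set). sum f J \<le> m}"
proof (rule finite_subset)
  show "{f \<in> J \<rightarrow>\<^sub>E UNIV. sum f J \<le> m} \<subseteq> J \<rightarrow>\<^sub>E {..m}"
  proof clarify
    fix f :: "'a \<Rightarrow> nat" assume f: "f \<in> J \<rightarrow>\<^sub>E UNIV" "sum f J \<le> m"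
    have "f i \<le> m" if "i \<in> J" for i
      using member_le_sum[OF that, of f] f(2) assms by simp
    with f(1) show "f \<in> J \<rightarrow>\<^sub>E {..m}" by (auto simp: PiE_def)
  qed
  show "finite (J \<rightarrow>\<^sub>E {..m})" using assms by (intro finite_PiE) auto
qed

text \<open>A homomorphism acts on each factor separately, so the power z^m is distributed over the
  factors; the share \<open>f i\<close> of factor i becomes the exponent of the pair (a, i).\<close>

lemma fps_eperp_prod_hl_q:
  assumes "finite J"
  shows "fps_eperp m (\<Prod>i\<in>J. hl_q (e i)) =
    (\<Sum>f | f \<in> J \<rightarrow>\<^sub>E UNIV \<and> sum f J = m. \<Prod>i\<in>J. hl_c (f i) * hl_q (e i - int (f i)))"
  using assms
proof (induction J arbitrary: m rule: finite_induct)
  case empty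
  have "{f. f = (\<lambda>x. undefined::nat) \<and> 0 = m} = (if m = 0 then {\<lambda>x. undefined} else {})" by auto
  then show ?case by (simp add: fps_eperp_one)
next
  case (insert x J)
  let ?G = "\<lambda>J m. {f. f \<in> J \<rightarrow>\<^sub>E (UNIV::nat set) \<and> sum f J = m}"
  let ?P = "\<lambda>J f. \<Prod>i\<in>J. hl_c (f i) * hl_q (e i - int (f i))"
  have fin: "finite (?G J m)" for m
    by (rule finite_subset[OF _ finite_fixed_sum_PiE[OF insert.hyps(1), of m]]) auto
  have "fps_eperp m (\<Prod>i\<in>insert x J. hl_q (e i)) =
      (\<Sum>i\<le>m. hl_c i * hl_q (e x - int i) * (\<Sum>f\<in>?G J (m - i). ?P J f))"
    using insert.hyps by (simp add: fps_eperp_mult fps_eperp_hl_q insert.IH)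
  also have "\<dots> = (\<Sum>(i, f)\<in>(SIGMA i:{..m}. ?G J (m - i)). hl_c i * hl_q (e x - int i) * ?P J f)"
    by (subst sum.Sigma[symmetric]) (use fin in \<open>auto simp: sum_distrib_left\<close>)
  also have "\<dots> = (\<Sum>g\<in>?G (insert x J) m. ?P (insert x J) g)"
  proof (rule sum.reindex_bij_witness[where j = "\<lambda>(i, f). f(x := i)" and i = "\<lambda>g. (g x, g(x := undefined))"], goal_cases)
    case (1 p)
    then show ?case using insert.hyps by (auto simp: PiE_def extensional_def fun_eq_iff)
  next
    case (2 p)
    have "sum (f(x := i)) J = sum f J" for f :: "'a \<Rightarrow> nat" and i
      by (rule sum.cong) (use insert.hyps in auto)
    with 2 show ?case using insert.hyps by (auto simp: PiE_def extensional_def)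
  next
    case (3 g)
    then show ?case by simp
  next
    case (4 g)
    have "sum (g(x := i)) J = sum g J" for i
      by (rule sum.cong) (use insert.hyps in auto)
    with 4 show ?case using insert.hyps by (auto simp: PiE_def extensional_def)
  next
    case (5 p)
    have "?P J (f(x := i)) = ?P J f" for f :: "'a \<Rightarrow> nat" and i
      by (rule prod.cong) (use insert.hyps in auto)
    with 5 show ?case using insert.hyps by auto
  qed
  finally show ?case .
qed

lemma fps_eperp_hl_c_mult: "fps_eperp m (hl_c s * F) = hl_c s * fps_eperp m F"
proof -
  have X: "fps_eperp m (fps_X ^ i * F) = fps_X ^ i * fps_eperp m F" for i
  proof (induction i)
    case (Suc i)
    have neg: "fps_eperp m (- G) = - fps_eperp m G" for G
      using fps_eperp_add[of m G "- G"] by (simp add: fps_eperp_zero eq_neg_iff_add_eq_0 add.commute)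
    have "fps_eperp m (fps_X ^ Suc i * F) = - fps_eperp m ((- fps_X) ^ 1 * (fps_X ^ i * F))"
      by (simp add: neg mult.assoc)
    then show ?case unfolding fps_eperp_X_power_mult Suc by (simp add: mult.assoc)
  qed simp
  have diff: "fps_eperp m (G - H) = fps_eperp m G - fps_eperp m H" for G H
    using fps_eperp_add[of m "G - H" H] by simp
  show ?thesis by (simp add: hl_c_def X diff left_diff_distrib)
qed

lemma fps_eperp_prod_hl_c_mult:
  "fps_eperp m ((\<Prod>p\<in>P. hl_c (s p)) * F) = (\<Prod>p\<in>P. hl_c (s p)) * fps_eperp m F"
  by (induction P rule: infinite_finite_induct) (simp_all add: fps_eperp_hl_c_mult mult.assoc)

lemma hl_Gamma_hl_F_from:
  assumes "a \<le> l"
  shows "hl_Gamma (- lam a) (hl_F_from (Suc a) l lam) = hl_F_from a l lam"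
proof -
  define J where "J = {a<..l}"
  have J: "{Suc a..l} = J" and finJ: "finite J" by (auto simp: J_def)
  define N where "N = hl_support (Suc a) l lam"
  define e where "e = (\<lambda>s i. hl_arg (Suc a) l lam s i)"
  define C where "C = (\<lambda>s. \<Prod>p\<in>pairs_from (Suc a) l. hl_c (s p))"
  define P where "P = (\<lambda>s f. \<Prod>i\<in>J. hl_c (f i) * hl_q (e s i - int (f i)))"
  define G where "G = (\<lambda>m. {f. f \<in> J \<rightarrow>\<^sub>E (UNIV::nat set) \<and> sum f J = m})"
  have finN: "finite N" by (simp add: N_def finite_hl_support)
  obtain M0 where M0: "\<And>m. m \<ge> M0 \<Longrightarrow> fps_eperp m (hl_F_from (Suc a) l lam) = 0"
    using fps_eperp_eventually_zero[OF Lambda_t_hl_F_from] by blast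
  \<comment> \<open>The first bound cuts off the operator series. The second ensures that for
    \<open>s\<close> in \<open>N\<close> every \<open>f\<close> outside \<open>B\<close> makes some
    index \<open>e s i - f i\<close> negative and so contributes zero.\<close>
  define M where "M = max M0 (Suc (\<Sum>s\<in>N. nat (\<Sum>i\<in>J. e s i)))"
  define B where "B = {f \<in> J \<rightarrow>\<^sub>E (UNIV::nat set). sum f J < M}"
  have finB: "finite B"
    by (rule finite_subset[OF _ finite_fixed_sum_PiE[OF finJ, of M]]) (auto simp: B_def)
  have F: "hl_F_from (Suc a) l lam = (\<Sum>s\<in>N. C s * (\<Prod>i\<in>J. hl_q (e s i)))"
    by (simp add: hl_F_from_eq_sum hl_summand_def N_def C_def e_def J)
  have summand: "hl_summand a l lam (join_pairs a l s f) = hl_q (int (sum f J) + lam a) * (C s * P s f)" for s f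
    unfolding hl_summand_join_pairs[OF assms] C_def P_def J_def e_def by (simp add: add.commute)
  have "hl_Gamma (- lam a) (hl_F_from (Suc a) l lam) =
      (\<Sum>m<M. hl_q (int m + lam a) * fps_eperp m (hl_F_from (Suc a) l lam))"
    using hl_Gamma_eq_sum[of M "hl_F_from (Suc a) l lam" "- lam a"] M0 by (simp add: M_def)
  also have "\<dots> = (\<Sum>m<M. hl_q (int m + lam a) * (\<Sum>s\<in>N. C s * (\<Sum>f\<in>G m. P s f)))"
    unfolding F fps_eperp_sum C_def fps_eperp_prod_hl_c_mult fps_eperp_prod_hl_q[OF finJ] G_def P_def ..
  also have "\<dots> = (\<Sum>m<M. \<Sum>s\<in>N. \<Sum>f\<in>G m. hl_summand a l lam (join_pairs a l s f))"
    unfolding sum_distrib_left summand by (intro sum.cong refl) (simp add: G_def)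
  also have "\<dots> = (\<Sum>s\<in>N. \<Sum>m<M. \<Sum>f\<in>G m. hl_summand a l lam (join_pairs a l s f))"
    by (rule sum.swap)
  also have "\<dots> = (\<Sum>s\<in>N. \<Sum>f\<in>B. hl_summand a l lam (join_pairs a l s f))"
  proof (rule sum.cong[OF refl])
    fix s
    have "G m = {f\<in>B. sum f J = m}" if "m \<in> {..<M}" for m using that by (auto simp: G_def B_def)
    then have "(\<Sum>m<M. \<Sum>f\<in>G m. hl_summand a l lam (join_pairs a l s f)) =
        (\<Sum>m<M. \<Sum>f | f \<in> B \<and> sum f J = m. hl_summand a l lam (join_pairs a l s f))"
      by (intro sum.cong) auto
    also have "\<dots> = (\<Sum>f\<in>B. hl_summand a l lam (join_pairs a l s f))"
      by (rule sum.group[OF finB]) (auto simp: B_def)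
    finally show "(\<Sum>m<M. \<Sum>f\<in>G m. hl_summand a l lam (join_pairs a l s f)) =
        (\<Sum>f\<in>B. hl_summand a l lam (join_pairs a l s f))" .
  qed
  also have "\<dots> = (\<Sum>(s, f)\<in>N \<times> B. hl_summand a l lam (join_pairs a l s f))"
    by (rule sum.cartesian_product)
  also have "\<dots> = hl_F_from a l lam"
  proof -
    let ?j = "\<lambda>(s, f). join_pairs a l s f"
    have NB: "N \<times> B \<subseteq> (pairs_from (Suc a) l \<rightarrow>\<^sub>E UNIV) \<times> ({a<..l} \<rightarrow>\<^sub>E UNIV)"
      by (auto simp: N_def hl_support_def B_def J_def)
    have bij: "bij_betw ?j ((pairs_from (Suc a) l \<rightarrow>\<^sub>E UNIV) \<times> ({a<..l} \<rightarrow>\<^sub>E UNIV)) (pairs_from a l \<rightarrow>\<^sub>E UNIV)"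
      by (rule bij_betw_join_pairs)
    have zero: "hl_summand a l lam r = 0" if r: "r \<in> pairs_from a l \<rightarrow>\<^sub>E UNIV" "r \<notin> ?j ` (N \<times> B)" for r
    proof -
      obtain s f where sf: "r = join_pairs a l s f" "s \<in> pairs_from (Suc a) l \<rightarrow>\<^sub>E UNIV" "f \<in> {a<..l} \<rightarrow>\<^sub>E UNIV"
      proof -
        have "r \<in> ?j ` ((pairs_from (Suc a) l \<rightarrow>\<^sub>E UNIV) \<times> ({a<..l} \<rightarrow>\<^sub>E UNIV))"
          using r(1) bij_betw_imp_surj_on[OF bij] by (simp only:)
        then show ?thesis using that by auto
      qed
      have "\<exists>i\<in>J. e s i - int (f i) < 0"
      proof (rule ccontr)
        assume "\<not> (\<exists>i\<in>J. e s i - int (f i) < 0)"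
        then have le: "int (f i) \<le> e s i" if "i \<in> J" for i using that by force
        then have pos: "0 \<le> e s i" if "i \<in> J" for i using that by force
        then have s: "s \<in> N" using sf(2) by (auto simp: N_def hl_support_def J e_def)
        have "int (sum f J) \<le> (\<Sum>i\<in>J. e s i)" using le by (simp add: sum_mono)
        then have "sum f J \<le> nat (\<Sum>i\<in>J. e s i)" by linarith
        also have "\<dots> \<le> (\<Sum>s\<in>N. nat (\<Sum>i\<in>J. e s i))" by (rule member_le_sum[OF s _ finN]) simp
        also have "\<dots> < M" by (simp add: M_def)
        finally have "f \<in> B" using sf(3) by (simp add: B_def J_def)
        with s sf(1) r(2) show False by auto
      qed
      then obtain i where "i \<in> J" "e s i - int (f i) < 0" by blast
      then have "P s f = 0" unfolding P_def by (intro prod_zero[OF finJ] bexI[of _ i]) (auto simp: hl_q_neg)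
      then show ?thesis unfolding sf(1) summand by simp
    qed
    have "hl_F_from a l lam = sum' (hl_summand a l lam) (?j ` (N \<times> B))"
      unfolding hl_F_from_def
    proof (rule sum.mono_neutral_right')
      show "?j ` (N \<times> B) \<subseteq> pairs_from a l \<rightarrow>\<^sub>E UNIV"
        using image_mono[OF NB, of ?j] unfolding bij_betw_imp_surj_on[OF bij] .
      show "\<forall>r\<in>(pairs_from a l \<rightarrow>\<^sub>E UNIV) - ?j ` (N \<times> B). hl_summand a l lam r = 0"
        by (rule ballI, erule DiffE, rule zero)
    qed
    also have "\<dots> = sum (hl_summand a l lam) (?j ` (N \<times> B))"
      using finN finB by simp
    also have "\<dots> = (\<Sum>sf\<in>N \<times> B. hl_summand a l lam (?j sf))"
      by (subst sum.reindex[OF inj_on_subset[OF bij_betw_imp_inj_on[OF bij] NB]]) (simp only: comp_def)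
    finally show ?thesis by (simp add: case_prod_unfold)
  qed
  finally show ?thesis .
qed

lemma hl_F_from_cong:
  assumes "\<And>i. i \<in> {a..l} \<Longrightarrow> lam i = mu i"
  shows "hl_F_from a l lam = hl_F_from a l mu"
proof -
  have "hl_summand a l lam s = hl_summand a l mu s" for s
    unfolding hl_summand_def
    by (intro arg_cong2[where f = "(*)"] refl prod.cong) (auto simp: hl_arg_def assms)
  then show ?thesis unfolding hl_F_from_def by presburger
qed

section \<open>Linear combinations of vertex operators\<close>

definition Zvec_from :: "nat \<Rightarrow> nat \<Rightarrow> (nat \<Rightarrow> int) set" where
  "Zvec_from a l = {v. \<forall>i. i \<notin> {a..l} \<longrightarrow> v i = 0}"

lemma Zvec_eq_Zvec_from: "Zvec l = Zvec_from 1 l"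
  by (simp add: Zvec_def Zvec_from_def)

definition tF_from :: "(int \<Rightarrow> int \<Rightarrow> complex) \<Rightarrow> nat \<Rightarrow> nat \<Rightarrow> (nat \<Rightarrow> int) \<Rightarrow> sym fps" where
  "tF_from A a l lam = foldr (\<lambda>i. tGamma A (- lam i)) [a..<Suc l] 1"

lemma tF_eq_tF_from: "tF A l = tF_from A 1 l"
  by (rule ext) (simp add: tF_def tF_from_def del: upt_Suc)

lemma tF_from_empty: "tF_from A (Suc l) l lam = 1"
  by (simp add: tF_from_def)

lemma tF_from_step: "a \<le> l \<Longrightarrow> tF_from A a l lam = tGamma A (- lam a) (tF_from A (Suc a) l lam)"
  by (simp add: tF_from_def upt_conv_Cons del: upt_Suc)

lemma scalar_mult: "scalar (a * b) = scalar a * scalar b"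
  by (simp add: scalar_def Const_hom)

lemma scalar_1: "scalar 1 = 1"
  by (simp add: scalar_def Const_hom)

lemma scalar_0: "scalar 0 = 0"
  by (simp add: scalar_def Const_hom)

lemma tGamma_eq_sum:
  assumes "finite S" "\<And>j. j \<notin> S \<Longrightarrow> scalar (A i j) * hl_Gamma j F = 0"
  shows "tGamma A i F = (\<Sum>j\<in>S. scalar (A i j) * hl_Gamma j F)"
  unfolding tGamma_def by (rule fps_fam_sum_eq_sum) (use assms in auto)

definition tF_term :: "(int \<Rightarrow> int \<Rightarrow> complex) \<Rightarrow> nat \<Rightarrow> nat \<Rightarrow> (nat \<Rightarrow> int) \<Rightarrow> (nat \<Rightarrow> int) \<Rightarrow> sym fps" where
  "tF_term A a l lam \<alpha> = scalar (\<Prod>i=a..l. A (- lam i) (- \<alpha> i)) * hl_F_from a l \<alpha>"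

text \<open>The operator with index j is the coefficient of u^(-j), so applying it to the term of
  \<beta> prepends the component - j.\<close>

lemma tF_term_step:
  assumes "a \<le> l"
  shows "tF_term A a l lam (\<beta>(a := - j)) =
    scalar (A (- lam a) j) * hl_Gamma j (tF_term A (Suc a) l lam \<beta>)"
proof -
  have e: "{a..l} = insert a {Suc a..l}" using assms by auto
  have "(\<Prod>i=Suc a..l. A (- lam i) (- (\<beta>(a := - j)) i)) = (\<Prod>i=Suc a..l. A (- lam i) (- \<beta> i))"
    by (rule prod.cong) auto
  then have w: "(\<Prod>i=a..l. A (- lam i) (- (\<beta>(a := - j)) i)) = A (- lam a) j * (\<Prod>i=Suc a..l. A (- lam i) (- \<beta> i))"
    unfolding e by simp
  have "hl_F_from a l (\<beta>(a := - j)) = hl_Gamma j (hl_F_from (Suc a) l (\<beta>(a := - j)))"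
    using hl_Gamma_hl_F_from[OF assms, of "\<beta>(a := - j)"] by simp
  also have "hl_F_from (Suc a) l (\<beta>(a := - j)) = hl_F_from (Suc a) l \<beta>"
    by (rule hl_F_from_cong) auto
  finally show ?thesis
    unfolding tF_term_def w scalar_mult hl_Gamma_scalar_mult[OF Lambda_t_hl_F_from] by (simp only: mult.assoc)
qed

lemma Lambda_t_tF_term: "tF_term A a l lam \<alpha> \<in> Lambda_t"
  unfolding tF_term_def by (intro Lambda_t_closed Lambda_t_scalar Lambda_t_hl_F_from)

context
  fixes A :: "int \<Rightarrow> int \<Rightarrow> complex"
  assumes row_bounded: "\<And>i. \<exists>N. \<forall>j<N. A i j = 0"
begin

lemma finite_tGamma_support:
  assumes "F \<in> Lambda_t"
  shows "finite {j. scalar (A i j) * hl_Gamma j F \<noteq> 0}"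
proof -
  obtain K where K: "\<And>k. k > K \<Longrightarrow> hl_Gamma k F = 0" using hl_Gamma_eventually_zero[OF assms] by blast
  obtain N where N: "\<And>j. j < N \<Longrightarrow> A i j = 0" using row_bounded[of i] by blast
  have "{j. scalar (A i j) * hl_Gamma j F \<noteq> 0} \<subseteq> {N..K}"
  proof
    fix j assume "j \<in> {j. scalar (A i j) * hl_Gamma j F \<noteq> 0}"
    then have "\<not> j < N" "\<not> j > K" using N[of j] K[of j] by (auto simp: scalar_0)
    then show "j \<in> {N..K}" by simp
  qed
  then show ?thesis by (rule finite_subset) simp
qed

text \<open>Finiteness and expansion go through the induction together: the next operator may be
  applied termwise only because the previous expansion is a finite sum in \<Lambda>[t].\<close>

lemma tF_from_expansion_aux:
  assumes "a \<le> Suc l"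
  shows "finite {\<alpha> \<in> Zvec_from a l. tF_term A a l lam \<alpha> \<noteq> 0} \<and>
    tF_from A a l lam = (\<Sum>\<alpha> | \<alpha> \<in> Zvec_from a l \<and> tF_term A a l lam \<alpha> \<noteq> 0. tF_term A a l lam \<alpha>)"
  using assms
proof (induction rule: inc_induct)
  case base
  have "Zvec_from (Suc l) l = {\<lambda>_. 0}" by (auto simp: Zvec_from_def)
  moreover have "tF_term A (Suc l) l lam \<alpha> = 1" for \<alpha>
    by (simp add: tF_term_def hl_F_from_empty scalar_1)
  ultimately show ?case by (simp add: tF_from_empty)
next
  case (step a)
  then have al: "a \<le> l" by simp
  define S where "S = {\<beta> \<in> Zvec_from (Suc a) l. tF_term A (Suc a) l lam \<beta> \<noteq> 0}"
  have finS: "finite S" and tF: "tF_from A (Suc a) l lam = (\<Sum>\<beta>\<in>S. tF_term A (Suc a) l lam \<beta>)"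
    using step.IH by (simp_all add: S_def)
  \<comment> \<open>Outside \<open>K\<close> no summand survives, so the operator series becomes a
    sum over \<open>K\<close>, and all indices of non-zero terms have the form
    \<open>\<beta>(a := - j)\<close> with \<open>j\<close> in \<open>K\<close> and
    \<open>\<beta>\<close> in \<open>S\<close>.\<close>
  define K where "K = (\<Union>\<beta>\<in>S. {j. scalar (A (- lam a) j) * hl_Gamma j (tF_term A (Suc a) l lam \<beta>) \<noteq> 0})"
  have finK: "finite K" unfolding K_def by (intro finite_UN_I finS finite_tGamma_support Lambda_t_tF_term)
  have G: "hl_Gamma j (tF_from A (Suc a) l lam) = (\<Sum>\<beta>\<in>S. hl_Gamma j (tF_term A (Suc a) l lam \<beta>))" for j
    unfolding tF by (rule hl_Gamma_sum) (rule Lambda_t_tF_term)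
  have "tF_from A a l lam = (\<Sum>j\<in>K. scalar (A (- lam a) j) * hl_Gamma j (tF_from A (Suc a) l lam))"
    unfolding tF_from_step[OF al]
    by (rule tGamma_eq_sum[OF finK]) (auto simp: G K_def sum_distrib_left intro!: sum.neutral)
  also have "\<dots> = (\<Sum>(j, \<beta>)\<in>K \<times> S. tF_term A a l lam (\<beta>(a := - j)))"
    unfolding G sum_distrib_left tF_term_step[OF al] by (rule sum.cartesian_product)
  also have "\<dots> = (\<Sum>\<alpha>\<in>(\<lambda>(j, \<beta>). \<beta>(a := - j)) ` (K \<times> S). tF_term A a l lam \<alpha>)"
  proof (subst sum.reindex)
    show "inj_on (\<lambda>(j, \<beta>). \<beta>(a := - j)) (K \<times> S)"
    proof (rule inj_onI, clarify)
      fix j \<beta> j' \<beta>' assume b: "\<beta> \<in> S" "\<beta>' \<in> S" and e: "\<beta>(a := - j) = \<beta>'(a := - j')"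
      have "\<beta> i = \<beta>' i" for i
        using fun_cong[OF e, of i] b by (cases "i = a") (auto simp: S_def Zvec_from_def)
      then show "j = j' \<and> \<beta> = \<beta>'" using fun_cong[OF e, of a] by auto
    qed
  qed (simp add: case_prod_unfold)
  finally have sum: "tF_from A a l lam = (\<Sum>\<alpha>\<in>(\<lambda>(j, \<beta>). \<beta>(a := - j)) ` (K \<times> S). tF_term A a l lam \<alpha>)" .
  have sub: "{\<alpha> \<in> Zvec_from a l. tF_term A a l lam \<alpha> \<noteq> 0} \<subseteq> (\<lambda>(j, \<beta>). \<beta>(a := - j)) ` (K \<times> S)"
  proof
    fix \<alpha> assume \<alpha>: "\<alpha> \<in> {\<alpha> \<in> Zvec_from a l. tF_term A a l lam \<alpha> \<noteq> 0}"
    define \<beta> where "\<beta> = \<alpha>(a := 0)"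
    have e: "\<alpha> = \<beta>(a := - (- \<alpha> a))" by (simp add: \<beta>_def)
    have "tF_term A a l lam \<alpha> = scalar (A (- lam a) (- \<alpha> a)) * hl_Gamma (- \<alpha> a) (tF_term A (Suc a) l lam \<beta>)"
      by (subst e, subst tF_term_step[OF al]) (simp add: \<beta>_def)
    with \<alpha> have ne: "scalar (A (- lam a) (- \<alpha> a)) * hl_Gamma (- \<alpha> a) (tF_term A (Suc a) l lam \<beta>) \<noteq> 0" by simp
    then have "tF_term A (Suc a) l lam \<beta> \<noteq> 0" by (auto simp: hl_Gamma_zero)
    then have "\<beta> \<in> S" using \<alpha> by (auto simp: S_def \<beta>_def Zvec_from_def)
    moreover from this ne have "- \<alpha> a \<in> K" by (auto simp: K_def)
    ultimately show "\<alpha> \<in> (\<lambda>(j, \<beta>). \<beta>(a := - j)) ` (K \<times> S)" using e by (intro image_eqI[of _ _ "(- \<alpha> a, \<beta>)"]) auto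
  qed
  have zv: "(\<lambda>(j, \<beta>). \<beta>(a := - j)) ` (K \<times> S) \<subseteq> Zvec_from a l"
    using al by (auto simp: S_def Zvec_from_def)
  have "tF_from A a l lam = (\<Sum>\<alpha> | \<alpha> \<in> Zvec_from a l \<and> tF_term A a l lam \<alpha> \<noteq> 0. tF_term A a l lam \<alpha>)"
    unfolding sum by (rule sum.mono_neutral_right) (use finK finS sub zv in auto)
  then show ?case using finite_subset[OF sub] finK finS by simp
qed

lemma finite_tF_support: "finite {\<alpha> \<in> Zvec l. scalar (\<Prod>i=1..l. A (- lam i) (- \<alpha> i)) * hl_F l \<alpha> \<noteq> 0}"
  using tF_from_expansion_aux[of 1 l lam] by (simp add: Zvec_eq_Zvec_from tF_term_def hl_F_eq_hl_F_from)

lemma tF_expansion: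
  "tF A l lam = sum' (\<lambda>\<alpha>. scalar (\<Prod>i=1..l. A (- lam i) (- \<alpha> i)) * hl_F l \<alpha>) (Zvec l)"
proof -
  let ?f = "\<lambda>\<alpha>. scalar (\<Prod>i=1..l. A (- lam i) (- \<alpha> i)) * hl_F l \<alpha>"
  have "sum' ?f (Zvec l) = sum' ?f {\<alpha> \<in> Zvec l. ?f \<alpha> \<noteq> 0}"
    by (rule sum.non_neutral'[symmetric])
  also have "\<dots> = sum ?f {\<alpha> \<in> Zvec l. ?f \<alpha> \<noteq> 0}"
    using finite_tF_support by simp
  also have "\<dots> = tF A l lam"
    using tF_from_expansion_aux[of 1 l lam]
    by (simp add: Zvec_eq_Zvec_from tF_term_def hl_F_eq_hl_F_from tF_eq_tF_from)
  finally show ?thesis ..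
qed

lemma Lambda_t_tF_from: "a \<le> Suc l \<Longrightarrow> tF_from A a l lam \<in> Lambda_t"
  using tF_from_expansion_aux[of a l lam] by (auto intro!: Lambda_t_sum Lambda_t_tF_term)

lemma Lambda_t_tF: "tF A l lam \<in> Lambda_t"
  unfolding tF_eq_tF_from by (rule Lambda_t_tF_from) simp

end

section \<open>Symmetry and stability\<close>

lemma sym_hom_subst_vars: "sym_hom (subst_vars v)"
  unfolding subst_vars_def by (rule sym_hom_eval_mpoly) (simp_all add: Const_hom)

lemma subst_vars_Const: "subst_vars v (Const c) = Const c"
  unfolding subst_vars_def by (rule eval_mpoly_Const) (simp add: Const_hom)

lemma subst_vars_Var: "subst_vars v (Var i) = v i"
  unfolding subst_vars_def by (rule eval_mpoly_Var) (simp_all add: Const_hom)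

lemma sym_hom_sym_at: "sym_hom (sym_at n)"
  by standard (simp_all only: sym_at_hom)

text \<open>Symmetry and stability in one statement: the variables enter \<open>at_vars\<close> only
  through their power sums, so a substitution that matches the power sums matches the
  values.\<close>

lemma subst_vars_at_vars:
  assumes "\<And>i. (\<Sum>j=1..n. v j ^ Suc i) = (\<Sum>j=1..n'. Var j ^ Suc i)"
  shows "subst_vars v (at_vars n F) = at_vars n' F"
proof -
  interpret v: sym_hom "subst_vars v" by (rule sym_hom_subst_vars)
  have V: "sym_at n (Var i) = (\<Sum>j=1..n. Var j ^ Suc i)" for n i
    using sym_at_hom(7)[of n i] by (simp only: psym_def diff_Suc_1)
  have "subst_vars v (sym_at n f) = sym_at n' f" for f
  proof (rule sym_hom_eqI[where \<phi> = "\<lambda>f. subst_vars v (sym_at n f)"])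
    show "sym_hom (\<lambda>f. subst_vars v (sym_at n f))"
      by standard (simp_all only: sym_at_hom v.one v.add v.mult)
    show "subst_vars v (sym_at n (Var i)) = sym_at n' (Var i)" for i
      unfolding V v.sum v.power subst_vars_Var by (rule assms)
  qed (rule sym_hom_sym_at, simp only: sym_at_hom subst_vars_Const)
  then show ?thesis
    unfolding at_vars_def Let_def v.sum v.mult subst_vars_Const by simp
qed

lemma symmetric_poly_at_vars: "symmetric_poly n (at_vars n F)"
  unfolding symmetric_poly_def
proof (intro allI impI subst_vars_at_vars)
  fix \<sigma> i assume "\<sigma> permutes {1..n}"
  from sum.permute[OF this, of "\<lambda>j. Var j ^ Suc i"]
  show "(\<Sum>j=1..n. Var (\<sigma> j) ^ Suc i) = (\<Sum>j=1..n. (Var j :: xpoly) ^ Suc i)"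
    unfolding comp_def by (rule sym)
qed

lemma at_vars_stable: "subst_vars (Var(Suc n := 0)) (at_vars (Suc n) F) = at_vars n F"
  by (rule subst_vars_at_vars) simp

section \<open>Inversion\<close>

definition weight :: "(nat \<Rightarrow>\<^sub>0 nat) \<Rightarrow> nat" where
  "weight m = (\<Sum>k\<in>Poly_Mapping.keys m. Suc k * Poly_Mapping.lookup m k)"

lemma weight_add: "weight (m + m') = weight m + weight m'"
proof -
  let ?S = "Poly_Mapping.keys m \<union> Poly_Mapping.keys m'"
  have *: "weight k = (\<Sum>i\<in>?S. Suc i * Poly_Mapping.lookup k i)" if "Poly_Mapping.keys k \<subseteq> ?S" for k
    unfolding weight_def by (rule sum.mono_neutral_left) (use that in \<open>auto simp: in_keys_iff\<close>)
  have k: "Poly_Mapping.keys (m + m') \<subseteq> ?S" by (rule keys_add)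
  show ?thesis
    unfolding *[OF k] *[OF Un_upper1] *[OF Un_upper2]
    by (simp add: lookup_add distrib_left sum.distrib)
qed

text \<open>Lower bounds pass easily through sums and products, and at a fixed non-zero coefficient
  they turn into upper bounds for the exponents.\<close>

definition order_ge :: "nat \<Rightarrow> nat \<Rightarrow> sym fps \<Rightarrow> bool" where
  "order_ge e d F \<longleftrightarrow> (\<forall>n m. coeff_at F n m \<noteq> 0 \<longrightarrow> e \<le> weight m \<and> d \<le> n)"

lemma order_ge_0: "order_ge 0 0 F"
  by (simp add: order_ge_def)

lemma coeff_at_add: "coeff_at (F + G) n m = coeff_at F n m + coeff_at G n m"
  by (simp add: coeff_at_def lookup_add)

lemma coeff_at_zero: "coeff_at 0 n m = 0"
  by (simp add: coeff_at_def)

lemma coeff_at_sum: "coeff_at (sum F S) n m = (\<Sum>a\<in>S. coeff_at (F a) n m)"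
  by (induction S rule: infinite_finite_induct) (simp_all add: coeff_at_zero coeff_at_add)

lemma coeff_at_scalar_mult: "coeff_at (scalar c * F) n m = c * coeff_at F n m"
  by (simp add: coeff_at_def scalar_def lookup_Const_mult)

lemma order_ge_sum:
  assumes "\<And>a. a \<in> S \<Longrightarrow> order_ge e d (F a)"
  shows "order_ge e d (sum F S)"
  unfolding order_ge_def coeff_at_sum
proof (intro allI impI)
  fix n m assume "(\<Sum>a\<in>S. coeff_at (F a) n m) \<noteq> 0"
  then obtain a where "a \<in> S" "coeff_at (F a) n m \<noteq> 0" by (rule sum.not_neutral_contains_not_neutral)
  with assms show "e \<le> weight m \<and> d \<le> n" by (auto simp: order_ge_def)
qed

lemma order_ge_mult:
  assumes F: "order_ge e d F" and G: "order_ge e' d' G"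
  shows "order_ge (e + e') (d + d') (F * G)"
  unfolding order_ge_def
proof (intro allI impI)
  fix n m assume "coeff_at (F * G) n m \<noteq> 0"
  then have "(\<Sum>i=0..n. Poly_Mapping.lookup (fps_nth F i * fps_nth G (n - i)) m) \<noteq> 0"
    by (simp add: coeff_at_def fps_mult_nth lookup_sum)
  then obtain i where i: "i \<in> {0..n}" "Poly_Mapping.lookup (fps_nth F i * fps_nth G (n - i)) m \<noteq> 0"
    by (rule sum.not_neutral_contains_not_neutral)
  then have "m \<in> Poly_Mapping.keys (fps_nth F i * fps_nth G (n - i))" by (simp add: in_keys_iff)
  then obtain a b where ab: "m = a + b" "a \<in> Poly_Mapping.keys (fps_nth F i)" "b \<in> Poly_Mapping.keys (fps_nth G (n - i))"
    using keys_mult[of "fps_nth F i" "fps_nth G (n - i)"] by blast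
  have "e \<le> weight a \<and> d \<le> i" using F ab(2) by (simp add: order_ge_def coeff_at_def in_keys_iff)
  moreover have "e' \<le> weight b \<and> d' \<le> n - i" using G ab(3) by (simp add: order_ge_def coeff_at_def in_keys_iff)
  ultimately show "e + e' \<le> weight m \<and> d + d' \<le> n" using i(1) by (auto simp: ab(1) weight_add)
qed

lemma order_ge_prod:
  assumes "\<And>a. a \<in> S \<Longrightarrow> order_ge (e a) (d a) (F a)"
  shows "order_ge (sum e S) (sum d S) (prod F S)"
  using assms by (induction S rule: infinite_finite_induct) (simp_all add: order_ge_0 order_ge_mult)

lemma order_ge_const_psym: "order_ge (Suc i) 0 (fps_const (psym (Suc i)))"
proof -
  have "weight (Poly_Mapping.single i 1) = Suc i" by (simp add: weight_def)
  then show ?thesis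
    by (auto simp: order_ge_def coeff_at_def psym_def Var_def lookup_single when_def split: if_splits)
qed

lemma order_ge_newton:
  assumes "\<And>k. f (Suc k) = Const (1 / of_nat (Suc k)) * (\<Sum>i\<le>k. c i * psym (Suc i) * f (k - i))"
  shows "order_ge k 0 (fps_const (f k))"
proof (induction k rule: less_induct)
  case (less k)
  show ?case
  proof (cases k)
    case [simp]: (Suc k')
    have "order_ge k 0 (fps_const (c i) * fps_const (psym (Suc i)) * fps_const (f (k' - i)))" if "i \<in> {..k'}" for i
    proof -
      have "order_ge (0 + Suc i + (k' - i)) (0 + 0 + 0) (fps_const (c i) * fps_const (psym (Suc i)) * fps_const (f (k' - i)))"
        by (intro order_ge_mult order_ge_0 order_ge_const_psym less) simp
      with that show ?thesis by simp
    qed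
    then have s: "order_ge k 0 (\<Sum>i\<le>k'. fps_const (c i) * fps_const (psym (Suc i)) * fps_const (f (k' - i)))"
      by (rule order_ge_sum)
    have cs: "fps_const (sum g S) = (\<Sum>i\<in>S. fps_const (g i))" for g :: "nat \<Rightarrow> sym" and S
      by (rule fps_ext) (simp add: fps_sum_nth sum.If_cases)
    show ?thesis
      using order_ge_mult[OF order_ge_0[of "fps_const (Const (1 / of_nat (Suc k')))"] s]
      by (simp only: Suc assms fps_const_mult cs[symmetric] add_0)
  qed (simp add: order_ge_0)
qed

lemma order_ge_const_hsym: "order_ge k 0 (fps_const (hsym k))"
  by (rule order_ge_newton[where c = "\<lambda>_. 1"]) simp

lemma order_ge_const_esym: "order_ge k 0 (fps_const (esym k))"
  by (rule order_ge_newton[where c = "\<lambda>i. (-1) ^ i"]) simp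

lemma order_ge_hl_q: "order_ge (nat k) 0 (hl_q k)"
proof (cases "k < 0")
  case False
  have "order_ge (nat k) 0 ((- fps_X) ^ i * fps_const (esym i * hsym (nat k - i)))" if "i \<in> {..nat k}" for i
  proof -
    have "order_ge (0 + (i + (nat k - i))) (0 + (0 + 0)) ((- fps_X) ^ i * (fps_const (esym i) * fps_const (hsym (nat k - i))))"
      by (intro order_ge_mult order_ge_0 order_ge_const_esym order_ge_const_hsym)
    with that show ?thesis by simp
  qed
  then have "order_ge (nat k) 0 (\<Sum>i\<le>nat k. (- fps_X) ^ i * fps_const (esym i * hsym (nat k - i)))"
    by (rule order_ge_sum)
  then show ?thesis using False by (simp add: hl_q_def)
qed (simp add: order_ge_0)

text \<open>t^s - t^(s-1) is divisible by t^(s-1); truncated subtraction gives the right bound for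
  \<open>hl_c 0 = 1\<close>.\<close>

lemma order_ge_hl_c: "order_ge 0 (s - 1) (hl_c s)"
proof (cases s)
  case (Suc s')
  then show ?thesis
    by (auto simp: order_ge_def hl_c_def coeff_at_def fps_X_power_nth split: if_splits)
qed (simp add: order_ge_0)

lemma order_ge_hl_summand:
  "order_ge (\<Sum>i=a..l. nat (hl_arg a l lam s i)) (\<Sum>p\<in>pairs_from a l. s p - 1) (hl_summand a l lam s)"
proof -
  have "order_ge ((\<Sum>p\<in>pairs_from a l. 0) + (\<Sum>i=a..l. nat (hl_arg a l lam s i)))
      ((\<Sum>p\<in>pairs_from a l. s p - 1) + (\<Sum>i=a..l. 0)) (hl_summand a l lam s)"
    unfolding hl_summand_def by (intro order_ge_mult order_ge_prod order_ge_hl_q order_ge_hl_c)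
  then show ?thesis by simp
qed

text \<open>Every pair contributes at least \<open>t\<^sup>s\<^sup>-\<^sup>1\<close> and \<open>F\<^sub>\<beta>\<close> is homogeneous of degree \<open>\<Sum>\<^sub>i \<beta>\<^sub>i\<close>, so a given monomial
  bounds \<open>s\<close> and all \<open>\<beta>\<^sub>i\<close>.\<close>

lemma finite_hl_F_coeff: "finite {\<beta> \<in> Zvec l. coeff_at (hl_F l \<beta>) n m \<noteq> 0}"
proof -
  \<comment> \<open>The i-th argument lies between 0 and the weight, and differs from \<beta>_i by
    two sums of at most l exponents. Each exponent is at most n + 1, as
    \<open>s p - 1 \<le> n\<close>.\<close>
  define K where "K = int (weight m) + int l * int (Suc n)"
  have "{\<beta> \<in> Zvec l. coeff_at (hl_F l \<beta>) n m \<noteq> 0} \<subseteq>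
      {\<beta>. \<forall>i. (i \<in> {1..l} \<longrightarrow> \<beta> i \<in> {- K..K}) \<and> (i \<notin> {1..l} \<longrightarrow> \<beta> i = 0)}"
  proof clarify
    fix \<beta> i assume \<beta>: "\<beta> \<in> Zvec l" "coeff_at (hl_F l \<beta>) n m \<noteq> 0"
    from \<beta>(2) obtain s where s: "s \<in> hl_support 1 l \<beta>" "coeff_at (hl_summand 1 l \<beta> s) n m \<noteq> 0"
      unfolding hl_F_eq_hl_F_from hl_F_from_eq_sum coeff_at_sum by (rule sum.not_neutral_contains_not_neutral)
    have bd: "(\<Sum>i=1..l. nat (hl_arg 1 l \<beta> s i)) \<le> weight m" "(\<Sum>p\<in>pairs_from 1 l. s p - 1) \<le> n"
      using order_ge_hl_summand[of 1 l \<beta> s] s(2) by (auto simp: order_ge_def)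
    have sp: "s p \<le> Suc n" if "p \<in> pairs_from 1 l" for p
      using member_le_sum[OF that, of "\<lambda>p. s p - 1"] bd(2) finite_pairs_from by fastforce
    have "- K \<le> \<beta> i \<and> \<beta> i \<le> K" if i: "i \<in> {1..l}"
    proof -
      have arg: "0 \<le> hl_arg 1 l \<beta> s i" using s(1) i by (simp add: hl_support_def)
      have "nat (hl_arg 1 l \<beta> s i) \<le> weight m"
        using member_le_sum[OF i, of "\<lambda>i. nat (hl_arg 1 l \<beta> s i)"] bd(1) by simp
      then have arg': "hl_arg 1 l \<beta> s i \<le> int (weight m)" by linarith
      have c: "(\<Sum>j\<in>S. int (g j)) \<le> int l * int (Suc n)" if "\<And>j. j \<in> S \<Longrightarrow> g j \<le> Suc n" "card S \<le> l" for g S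
      proof -
        have "(\<Sum>j\<in>S. int (g j)) \<le> of_nat (card S) * int (Suc n)"
          by (rule sum_bounded_above) (use that(1) in fastforce)
        also have "\<dots> \<le> int l * int (Suc n)" using that(2) by (intro mult_right_mono) auto
        finally show ?thesis .
      qed
      have 1: "(\<Sum>j\<in>{i<..l}. int (s (i, j))) \<le> int l * int (Suc n)"
        by (rule c) (use i in \<open>auto intro!: sp simp: pairs_from_def\<close>)
      have 2: "(\<Sum>j\<in>{1..<i}. int (s (j, i))) \<le> int l * int (Suc n)"
        by (rule c) (use i in \<open>auto intro!: sp simp: pairs_from_def\<close>)
      have 3: "0 \<le> (\<Sum>j\<in>{i<..l}. int (s (i, j)))" "0 \<le> (\<Sum>j\<in>{1..<i}. int (s (j, i)))"
        by (simp_all add: sum_nonneg)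
      show ?thesis using arg arg' 1 2 3 unfolding hl_arg_def K_def by linarith
    qed
    then show "(i \<in> {1..l} \<longrightarrow> \<beta> i \<in> {- K..K}) \<and> (i \<notin> {1..l} \<longrightarrow> \<beta> i = 0)"
      using \<beta>(1) by (simp add: Zvec_def)
  qed
  then show ?thesis by (rule finite_subset) (rule finite_set_of_finite_funs; simp)
qed

text \<open>Unconditional convergence of complex families is absolute convergence, which makes the
  product family summable.\<close>

lemma has_sum_complex_Times:
  fixes f :: "'a \<Rightarrow> complex" and g :: "'b \<Rightarrow> complex"
  assumes f: "(f has_sum x) I" and g: "(g has_sum y) J"
  shows "((\<lambda>(a, b). f a * g b) has_sum x * y) (I \<times> J)"
proof (rule has_sum_SigmaI[where g = "\<lambda>a. f a * y"])
  show "((\<lambda>b. case (a, b) of (a, b) \<Rightarrow> f a * g b) has_sum f a * y) J" for a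
    using has_sum_cmult_right[OF g, of "f a"] by simp
  show "((\<lambda>a. f a * y) has_sum x * y) I" by (rule has_sum_cmult_left[OF f])
  have nf: "(\<lambda>a. norm (f a)) summable_on I" and ng: "(\<lambda>b. norm (g b)) summable_on J"
    using f g by (auto simp: summable_on_iff_abs_summable_on_complex dest!: has_sum_imp_summable)
  have "(\<lambda>ab. norm (case ab of (a, b) \<Rightarrow> f a * g b)) summable_on (I \<times> J)"
    unfolding Infinite_Sum.abs_summable_on_Sigma_iff
  proof (intro conjI ballI)
    show "(\<lambda>b. norm (case (a, b) of (a, b) \<Rightarrow> f a * g b)) summable_on J" for a
      using summable_on_cmult_right[OF ng, of "norm (f a)"] by (simp add: norm_mult)
    show "(\<lambda>a. norm (infsum (\<lambda>b. norm (case (a, b) of (a, b) \<Rightarrow> f a * g b)) J)) summable_on I"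
    proof -
      have "infsum (\<lambda>b. norm (f a * g b)) J = norm (f a) * infsum (\<lambda>b. norm (g b)) J" for a
        by (simp add: norm_mult infsum_cmult_right ng)
      then show ?thesis
        using summable_on_cmult_left[OF nf, of "infsum (\<lambda>b. norm (g b)) J"]
        by (simp add: abs_mult infsum_nonneg)
    qed
  qed
  then show "(\<lambda>(a, b). f a * g b) summable_on (SIGMA a:I. J)"
    by (simp add: summable_on_iff_abs_summable_on_complex)
qed

lemma has_sum_prod_Zvec_from:
  fixes f :: "nat \<Rightarrow> int \<Rightarrow> complex"
  assumes f: "\<And>i. i \<in> {a..l} \<Longrightarrow> (f i has_sum x i) UNIV" and "a \<le> Suc l"
  shows "((\<lambda>v. \<Prod>i=a..l. f i (v i)) has_sum (\<Prod>i=a..l. x i)) (Zvec_from a l)"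
  using assms(2,1)
proof (induction rule: inc_induct)
  case base
  have "Zvec_from (Suc l) l = {\<lambda>_. 0}" by (auto simp: Zvec_from_def)
  then show ?case by (auto intro!: has_sum_finiteI)
next
  case (step a)
  then have e: "{a..l} = insert a {Suc a..l}" by auto
  let ?j = "\<lambda>(k, v). v(a := k)"
  have bij: "bij_betw ?j (UNIV \<times> Zvec_from (Suc a) l) (Zvec_from a l)"
    by (rule bij_betw_byWitness[where f' = "\<lambda>v. (v a, v(a := 0))"])
      (use step.hyps in \<open>auto simp: Zvec_from_def fun_eq_iff\<close>)
  have t: "(\<Prod>i=a..l. f i (?j kv i)) = (case kv of (k, v) \<Rightarrow> f a k * (\<Prod>i=Suc a..l. f i (v i)))" for kv
  proof -
    obtain k v where kv: "kv = (k, v)" by (cases kv)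
    have "(\<Prod>i=Suc a..l. f i ((v(a := k)) i)) = (\<Prod>i=Suc a..l. f i (v i))" by (rule prod.cong) auto
    then show ?thesis unfolding kv e by simp
  qed
  have "((\<lambda>(k, v). f a k * (\<Prod>i=Suc a..l. f i (v i))) has_sum x a * (\<Prod>i=Suc a..l. x i)) (UNIV \<times> Zvec_from (Suc a) l)"
    by (intro has_sum_complex_Times step.IH step.prems) (use step.hyps in auto)
  moreover have "x a * (\<Prod>i=Suc a..l. x i) = (\<Prod>i=a..l. x i)" unfolding e by simp
  ultimately show ?case unfolding has_sum_reindex_bij_betw[OF bij, symmetric] t by simp
qed

lemma has_sum_finite_sum:
  fixes f :: "'i \<Rightarrow> 'a \<Rightarrow> complex"
  assumes "\<And>b. b \<in> S \<Longrightarrow> (f b has_sum x b) I"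
  shows "((\<lambda>a. \<Sum>b\<in>S. f b a) has_sum (\<Sum>b\<in>S. x b)) I"
  using assms by (induction S rule: infinite_finite_induct) (auto intro: has_sum_add)

context
  fixes A :: "int \<Rightarrow> int \<Rightarrow> complex"
  assumes row_bounded: "\<And>i. \<exists>N. \<forall>j<N. A i j = 0"
begin

text \<open>The finite index set depends on the chosen coefficient but not on \<open>lam\<close>.
  This permits the interchange with the sum over \<open>lam\<close> in the inversion
  formula.\<close>

lemma coeff_at_tF:
  "coeff_at (tF A l lam) n m = (\<Sum>\<beta> | \<beta> \<in> Zvec l \<and> coeff_at (hl_F l \<beta>) n m \<noteq> 0.
    (\<Prod>i=1..l. A (- lam i) (- \<beta> i)) * coeff_at (hl_F l \<beta>) n m)"
proof -
  let ?f = "\<lambda>\<beta>. scalar (\<Prod>i=1..l. A (- lam i) (- \<beta> i)) * hl_F l \<beta>"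
  let ?D = "{\<beta> \<in> Zvec l. ?f \<beta> \<noteq> 0}" and ?E = "{\<beta> \<in> Zvec l. coeff_at (hl_F l \<beta>) n m \<noteq> 0}"
  have fin: "finite ?D" "finite ?E" by (rule finite_tF_support[OF row_bounded], rule finite_hl_F_coeff)
  have "tF A l lam = sum ?f ?D"
    unfolding tF_expansion[OF row_bounded] by (subst sum.non_neutral'[symmetric]) (rule sum.eq_sum[OF fin(1)])
  then have "coeff_at (tF A l lam) n m = (\<Sum>\<beta>\<in>?D. coeff_at (?f \<beta>) n m)" by (simp add: coeff_at_sum)
  also have "\<dots> = (\<Sum>\<beta>\<in>?D \<union> ?E. coeff_at (?f \<beta>) n m)"
    by (rule sum.mono_neutral_left) (use fin in \<open>auto simp: coeff_at_zero\<close>)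
  also have "\<dots> = (\<Sum>\<beta>\<in>?E. coeff_at (?f \<beta>) n m)"
    by (rule sum.mono_neutral_right) (use fin in \<open>auto simp: coeff_at_scalar_mult\<close>)
  finally show ?thesis by (simp only: coeff_at_scalar_mult)
qed

lemma coeff_at_inverse_term:
  "coeff_at (scalar (\<Prod>i=1..l. B (- \<alpha> i) (- lam i)) * tF A l lam) n m =
    (\<Sum>\<beta> | \<beta> \<in> Zvec l \<and> coeff_at (hl_F l \<beta>) n m \<noteq> 0.
      (\<Prod>i=1..l. B (- \<alpha> i) (- lam i) * A (- lam i) (- \<beta> i)) * coeff_at (hl_F l \<beta>) n m)"
  unfolding coeff_at_scalar_mult coeff_at_tF sum_distrib_left prod.distrib by (simp only: mult.assoc)

lemma has_coeff_sum_inverse: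
  assumes B: "left_inverse B A" and \<alpha>: "\<alpha> \<in> Zvec l"
  shows "has_coeff_sum (\<lambda>lam. scalar (\<Prod>i=1..l. B (- \<alpha> i) (- lam i)) * tF A l lam) (hl_F l \<alpha>) (Zvec l)"
  unfolding has_coeff_sum_def coeff_at_inverse_term
proof (intro allI)
  fix n m
  let ?E = "{\<beta> \<in> Zvec l. coeff_at (hl_F l \<beta>) n m \<noteq> 0}"
  have "((\<lambda>k. B (- \<alpha> i) (- k) * A (- k) (- \<beta> i)) has_sum (if \<alpha> i = \<beta> i then 1 else 0)) UNIV" for \<beta> i
  proof -
    have bij: "bij_betw uminus (UNIV :: int set) UNIV" by (rule bij_uminus)
    have "((\<lambda>k. B (- \<alpha> i) k * A k (- \<beta> i)) has_sum (if - \<alpha> i = - \<beta> i then 1 else 0)) UNIV"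
      using B unfolding left_inverse_def by blast
    from iffD2[OF has_sum_reindex_bij_betw[OF bij] this] show ?thesis by simp
  qed
  then have p: "((\<lambda>lam. \<Prod>i=1..l. B (- \<alpha> i) (- lam i) * A (- lam i) (- \<beta> i)) has_sum
      (\<Prod>i=1..l. if \<alpha> i = \<beta> i then 1 else 0)) (Zvec l)" for \<beta>
    unfolding Zvec_eq_Zvec_from by (intro has_sum_prod_Zvec_from) auto
  have delta: "(\<Prod>i=1..l. if \<alpha> i = \<beta> i then 1 else 0) = (if \<alpha> = \<beta> then 1 else (0::complex))" if "\<beta> \<in> Zvec l" for \<beta>
  proof (cases "\<alpha> = \<beta>")
    case False
    then obtain i where i: "\<alpha> i \<noteq> \<beta> i" by blast
    have "\<alpha> i = 0" "\<beta> i = 0" if "i \<notin> {1..l}" using \<alpha> \<open>\<beta> \<in> Zvec l\<close> that unfolding Zvec_def by blast+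
    with i have "i \<in> {1..l}" by metis
    with i False show ?thesis by (auto intro!: prod_zero)
  qed simp
  have "((\<lambda>lam. \<Sum>\<beta>\<in>?E. (\<Prod>i=1..l. B (- \<alpha> i) (- lam i) * A (- lam i) (- \<beta> i)) * coeff_at (hl_F l \<beta>) n m)
      has_sum (\<Sum>\<beta>\<in>?E. (\<Prod>i=1..l. if \<alpha> i = \<beta> i then 1 else 0) * coeff_at (hl_F l \<beta>) n m)) (Zvec l)"
    by (intro has_sum_finite_sum has_sum_cmult_left p)
  also have "(\<Sum>\<beta>\<in>?E. (\<Prod>i=1..l. if \<alpha> i = \<beta> i then 1 else 0) * coeff_at (hl_F l \<beta>) n m) =
      (\<Sum>\<beta>\<in>?E. if \<alpha> = \<beta> then coeff_at (hl_F l \<alpha>) n m else 0)"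
  proof (rule sum.cong[OF refl])
    fix \<beta> assume "\<beta> \<in> ?E"
    then have "\<beta> \<in> Zvec l" by simp
    then show "(\<Prod>i=1..l. if \<alpha> i = \<beta> i then 1 else 0) * coeff_at (hl_F l \<beta>) n m =
        (if \<alpha> = \<beta> then coeff_at (hl_F l \<alpha>) n m else 0)"
      unfolding delta[OF \<open>\<beta> \<in> Zvec l\<close>] by simp
  qed
  also have "\<dots> = coeff_at (hl_F l \<alpha>) n m"
    using finite_hl_F_coeff[of l n m] \<alpha> by (simp add: sum.delta)
  finally show "((\<lambda>lam. \<Sum>\<beta>\<in>?E. (\<Prod>i=1..l. B (- \<alpha> i) (- lam i) * A (- lam i) (- \<beta> i)) * coeff_at (hl_F l \<beta>) n m)
      has_sum coeff_at (hl_F l \<alpha>) n m) (Zvec l)" .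
qed

text \<open>A contributing \<open>lam\<close> admits a \<beta> from the finite set for which no
  factor B A vanishes, so its components lie in one finite set \<open>K\<close>.\<close>

lemma finite_inverse_support:
  assumes "\<And>i j. finite {k. B i k * A k j \<noteq> 0}"
  shows "finite {lam \<in> Zvec l. coeff_at (scalar (\<Prod>i=1..l. B (- \<alpha> i) (- lam i)) * tF A l lam) n m \<noteq> 0}"
proof -
  let ?E = "{\<beta> \<in> Zvec l. coeff_at (hl_F l \<beta>) n m \<noteq> 0}"
  define K where "K = (\<Union>\<beta>\<in>?E. \<Union>i\<in>{1..l}. uminus ` {k. B (- \<alpha> i) k * A k (- \<beta> i) \<noteq> 0})"
  have fin: "finite K" unfolding K_def using finite_hl_F_coeff assms by blast
  have "{lam \<in> Zvec l. coeff_at (scalar (\<Prod>i=1..l. B (- \<alpha> i) (- lam i)) * tF A l lam) n m \<noteq> 0}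
      \<subseteq> {lam. \<forall>i. (i \<in> {1..l} \<longrightarrow> lam i \<in> K) \<and> (i \<notin> {1..l} \<longrightarrow> lam i = 0)}"
  proof clarify
    fix lam i
    assume lam: "lam \<in> Zvec l" "coeff_at (scalar (\<Prod>i=1..l. B (- \<alpha> i) (- lam i)) * tF A l lam) n m \<noteq> 0"
    obtain \<beta> where \<beta>: "\<beta> \<in> ?E" "(\<Prod>i=1..l. B (- \<alpha> i) (- lam i) * A (- lam i) (- \<beta> i)) * coeff_at (hl_F l \<beta>) n m \<noteq> 0"
      using lam(2) unfolding coeff_at_inverse_term by (rule sum.not_neutral_contains_not_neutral)
    have "lam i \<in> K" if i: "i \<in> {1..l}"
    proof -
      have "B (- \<alpha> i) (- lam i) * A (- lam i) (- \<beta> i) \<noteq> 0" using \<beta>(2) i by auto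
      then have "lam i \<in> uminus ` {k. B (- \<alpha> i) k * A k (- \<beta> i) \<noteq> 0}" by (intro image_eqI[of _ _ "- lam i"]) auto
      with i \<beta>(1) show ?thesis unfolding K_def by blast
    qed
    with lam(1) show "(i \<in> {1..l} \<longrightarrow> lam i \<in> K) \<and> (i \<notin> {1..l} \<longrightarrow> lam i = 0)" by (simp add: Zvec_def)
  qed
  then show ?thesis by (rule finite_subset) (rule finite_set_of_finite_funs; simp add: fin)
qed

text \<open>The inversion formula read at u^\<alpha>: the product of the B_(-\<alpha>_i,
  -\<lambda>_i) is the coefficient of u^\<alpha> in the product of the g_(\<lambda>_i)(u_i).\<close>

lemma has_dist_sum_inverse:
  assumes "left_inverse B A"
  shows "has_dist_sum l (\<lambda>lam \<alpha>. tF A l lam * scalar (dist_prod l (\<lambda>i. g_dist B (lam i)) \<alpha>)) (hl_F l) (Zvec l)"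
  unfolding has_dist_sum_def dist_prod_def g_dist_def mult.commute[of "tF A l _"]
  using has_coeff_sum_inverse[OF assms] by blast

end

section \<open>Partial fractions\<close>

text \<open>For distinct x_r, and up to the factor (1 - t) x_s, the residue at y = x_s of the
  product of (y - t x_r) / (y - x_r) over S.\<close>

definition pf_weight :: "('i \<Rightarrow> 'a::field) \<Rightarrow> 'a \<Rightarrow> 'i set \<Rightarrow> 'i \<Rightarrow> 'a" where
  "pf_weight x t S s = (\<Prod>r\<in>S - {s}. (x s - t * x r) / (x s - x r))"

lemma pf_weight_insert:
  assumes "finite S" "r \<notin> S"
  shows "s \<in> S \<Longrightarrow> pf_weight x t (insert r S) s = pf_weight x t S s * ((x s - t * x r) / (x s - x r))"
    and "pf_weight x t (insert r S) r = (\<Prod>s\<in>S. (x r - t * x s) / (x r - x s))"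
proof -
  assume s: "s \<in> S"
  then have "insert r S - {s} = insert r (S - {s})" using assms by auto
  then show "pf_weight x t (insert r S) s = pf_weight x t S s * ((x s - t * x r) / (x s - x r))"
    using assms by (simp add: pf_weight_def mult.commute)
next
  have "insert r S - {r} = S" using assms by auto
  then show "pf_weight x t (insert r S) r = (\<Prod>s\<in>S. (x r - t * x s) / (x r - x s))"
    by (simp add: pf_weight_def)
qed

text \<open>The form with a value y is needed at y = x_r: the weight of a newly inserted r is this
  product over the old S, here and in the version for power series.\<close>

lemma partial_fractions:
  fixes x :: "'i \<Rightarrow> 'a::field"
  assumes "finite S" "inj_on x S" "y \<notin> x ` S"
  shows "(\<Prod>s\<in>S. (y - t * x s) / (y - x s)) =
    t ^ card S + (1 - t) * (\<Sum>s\<in>S. pf_weight x t S s * (y / (y - x s)))"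
  using assms
proof (induction S arbitrary: y rule: finite_induct)
  case (insert r S)
  have r: "x r \<notin> x ` S" and inj: "inj_on x S" using insert.prems(1) insert.hyps by auto
  have y: "y \<noteq> x r" "y \<notin> x ` S" using insert.prems by auto
  let ?w = "pf_weight x t S" and ?n = "t ^ card S"
  have wr: "pf_weight x t (insert r S) r = ?n + (1 - t) * (\<Sum>s\<in>S. ?w s * (x r / (x r - x s)))"
    unfolding pf_weight_insert(2)[OF insert.hyps(1,2)] by (rule insert.IH[OF inj r])
  \<comment> \<open>The pole at x_s receives its new weight; the parts with the pole at x_r,
    collected over all s, make up the weight \<open>wr\<close> of r.\<close>
  have id: "(y - t * x r) / (y - x r) * (y / (y - x s)) =
      (x s - t * x r) / (x s - x r) * (y / (y - x s)) + (1 - t) * (x r / (x r - x s)) * (y / (y - x r))"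
    if "s \<in> S" for s
  proof -
    have "y \<noteq> x s" "x s \<noteq> x r" using y r that by (metis image_eqI)+
    then show ?thesis using y(1) by (simp add: divide_simps) (simp add: algebra_simps)
  qed
  have id0: "(y - t * x r) / (y - x r) = t + (1 - t) * (y / (y - x r))"
    using y(1) by (simp add: divide_simps) (simp add: algebra_simps)
  have "(\<Prod>s\<in>insert r S. (y - t * x s) / (y - x s)) =
      (y - t * x r) / (y - x r) * (?n + (1 - t) * (\<Sum>s\<in>S. ?w s * (y / (y - x s))))"
    using insert.hyps insert.IH[OF inj y(2)] by simp
  also have "\<dots> = ?n * ((y - t * x r) / (y - x r)) +
      (1 - t) * (\<Sum>s\<in>S. ?w s * ((y - t * x r) / (y - x r) * (y / (y - x s))))"
  proof -
    have "(\<Sum>s\<in>S. ?w s * ((y - t * x r) / (y - x r) * (y / (y - x s)))) =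
        (y - t * x r) / (y - x r) * (\<Sum>s\<in>S. ?w s * (y / (y - x s)))"
      unfolding sum_distrib_left by (rule sum.cong) (simp_all only: mult.left_commute)
    moreover have "a * (b + c * d) = b * a + c * (a * d)" for a b c d :: 'a by (simp add: algebra_simps)
    ultimately show ?thesis by simp
  qed
  also have "(\<Sum>s\<in>S. ?w s * ((y - t * x r) / (y - x r) * (y / (y - x s)))) =
      (\<Sum>s\<in>S. ?w s * ((x s - t * x r) / (x s - x r)) * (y / (y - x s))) +
      (1 - t) * (\<Sum>s\<in>S. ?w s * (x r / (x r - x s))) * (y / (y - x r))"
  proof -
    have "?w s * ((y - t * x r) / (y - x r) * (y / (y - x s))) =
        ?w s * ((x s - t * x r) / (x s - x r)) * (y / (y - x s)) +
        (1 - t) * (?w s * (x r / (x r - x s))) * (y / (y - x r))" if "s \<in> S" for s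
      unfolding id[OF that] distrib_left by (simp only: mult_ac)
    then show ?thesis by (simp only: sum_distrib_left sum_distrib_right sum.distrib cong: sum.cong)
  qed
  also have "(\<Sum>s\<in>S. ?w s * ((x s - t * x r) / (x s - x r)) * (y / (y - x s))) =
      (\<Sum>s\<in>S. pf_weight x t (insert r S) s * (y / (y - x s)))"
    by (rule sum.cong) (simp_all add: pf_weight_insert(1)[OF insert.hyps(1,2)])
  also have "?n * ((y - t * x r) / (y - x r)) + (1 - t) *
      ((\<Sum>s\<in>S. pf_weight x t (insert r S) s * (y / (y - x s))) +
      (1 - t) * (\<Sum>s\<in>S. ?w s * (x r / (x r - x s))) * (y / (y - x r))) =
      t * ?n + (1 - t) * (pf_weight x t (insert r S) r * (y / (y - x r)) +
        (\<Sum>s\<in>S. pf_weight x t (insert r S) s * (y / (y - x s))))"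
  proof -
    have "n * (t + (1 - t) * z) + (1 - t) * (a + (1 - t) * b * z) =
        t * n + (1 - t) * ((n + (1 - t) * b) * z + a)" for n z a b :: 'a
      by (simp add: algebra_simps)
    then show ?thesis unfolding wr id0 by blast
  qed
  finally show ?case using insert.hyps by simp
qed simp

abbreviation geom_fps :: "'a::comm_ring_1 \<Rightarrow> 'a fps" where
  "geom_fps c \<equiv> Abs_fps (\<lambda>k. c ^ k)"

lemma geom_fps_mult:
  fixes x r :: "'a::field"
  assumes "x \<noteq> r"
  shows "geom_fps r * geom_fps x = fps_const (x / (x - r)) * geom_fps x + fps_const (r / (r - x)) * geom_fps r"
proof -
  let ?p = "\<lambda>c. 1 - fps_const c * fps_X :: 'a fps"
  have c: "fps_const (x / (x - r)) * ?p r + fps_const (r / (r - x)) * ?p x = 1"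
  proof -
    have e: "x / (x - r) + r / (r - x) = 1" "x / (x - r) * r + r / (r - x) * x = 0"
      using assms by (simp_all add: divide_simps) (simp_all add: algebra_simps)
    have ring: "a * (1 - b * z) + a' * (1 - b' * z) = (a + a') - (a * b + a' * b') * z" for a b a' b' z :: "'a fps"
      by (simp add: algebra_simps)
    show ?thesis unfolding ring fps_const_mult fps_const_add e by simp
  qed
  have "geom_fps r * geom_fps x = (fps_const (x / (x - r)) * ?p r + fps_const (r / (r - x)) * ?p x) * (geom_fps r * geom_fps x)"
    unfolding c by simp
  also have "\<dots> = fps_const (x / (x - r)) * ((?p r * geom_fps r) * geom_fps x) +
      fps_const (r / (r - x)) * ((?p x * geom_fps x) * geom_fps r)"
  proof -
    have "(a * p + b * q) * (g * h) = a * ((p * g) * h) + b * ((q * h) * g)" for a p b q g h :: "'a fps"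
      by (simp add: algebra_simps)
    then show ?thesis .
  qed
  finally show ?thesis unfolding geometric_fps by simp
qed

text \<open>The same expansion with y = 1/u: (y - t x) / (y - x) = (1 - t x u) / (1 - x u) and y /
  (y - x) = 1 / (1 - x u).\<close>

lemma partial_fractions_fps:
  fixes x :: "'i \<Rightarrow> 'a::field"
  assumes "finite S" "inj_on x S"
  shows "(\<Prod>s\<in>S. (1 - fps_const (t * x s) * fps_X) * geom_fps (x s)) =
    fps_const (t ^ card S) + (\<Sum>s\<in>S. fps_const ((1 - t) * pf_weight x t S s) * geom_fps (x s))"
  using assms
proof (induction S rule: finite_induct)
  case (insert r S)
  have r: "x r \<notin> x ` S" and inj: "inj_on x S" using insert.prems insert.hyps by auto
  let ?w = "pf_weight x t S" and ?n = "t ^ card S"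
  have wr: "pf_weight x t (insert r S) r = ?n + (1 - t) * (\<Sum>s\<in>S. ?w s * (x r / (x r - x s)))"
    unfolding pf_weight_insert(2)[OF insert.hyps(1,2)] by (rule partial_fractions[OF insert.hyps(1) inj r])
  have g: "(1 - fps_const (t * x r) * fps_X) * geom_fps (x r) = fps_const t + fps_const (1 - t) * geom_fps (x r)"
  proof -
    have "(1 - fps_const (t * x r) * fps_X) * geom_fps (x r) =
        fps_const t * ((1 - fps_const (x r) * fps_X) * geom_fps (x r)) + fps_const (1 - t) * geom_fps (x r)"
    proof -
      have "(1 - a * b * z) * g = a * ((1 - b * z) * g) + (1 - a) * g" for a b z g :: "'a fps"
        by (simp add: algebra_simps)
      moreover have "fps_const (1 - t) = 1 - fps_const t" by (rule fps_ext) simp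
      ultimately show ?thesis unfolding fps_const_mult[symmetric] by (simp only:)
    qed
    then show ?thesis unfolding geometric_fps by simp
  qed
  have "(\<Prod>s\<in>insert r S. (1 - fps_const (t * x s) * fps_X) * geom_fps (x s)) =
      (fps_const t + fps_const (1 - t) * geom_fps (x r)) *
      (fps_const ?n + (\<Sum>s\<in>S. fps_const ((1 - t) * ?w s) * geom_fps (x s)))"
    using insert.hyps insert.IH[OF inj] g by simp
  also have "\<dots> = fps_const (t * ?n) + fps_const ((1 - t) * ?n) * geom_fps (x r) +
      (\<Sum>s\<in>S. fps_const t * (fps_const ((1 - t) * ?w s) * geom_fps (x s)) +
        fps_const ((1 - t) * ((1 - t) * ?w s)) * (geom_fps (x r) * geom_fps (x s)))"
  proof -
    have "(a + b * g) * (n + \<Sigma>) = a * n + b * n * g + (a * \<Sigma> + b * g * \<Sigma>)" for a b g n \<Sigma> :: "'a fps"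
      by (simp add: algebra_simps)
    moreover have "b * g * (c * h) = b * c * (g * h)" for b c g h :: "'a fps" by (simp only: mult_ac)
    ultimately show ?thesis
      by (simp only: fps_const_mult[symmetric] sum.distrib sum_distrib_left)
  qed
  also have "(\<Sum>s\<in>S. fps_const t * (fps_const ((1 - t) * ?w s) * geom_fps (x s)) +
        fps_const ((1 - t) * ((1 - t) * ?w s)) * (geom_fps (x r) * geom_fps (x s))) =
      (\<Sum>s\<in>S. fps_const ((1 - t) * pf_weight x t (insert r S) s) * geom_fps (x s) +
        fps_const ((1 - t) * ((1 - t) * (?w s * (x r / (x r - x s))))) * geom_fps (x r))"
  proof (rule sum.cong[OF refl])
    fix s assume s: "s \<in> S"
    then have ne: "x s \<noteq> x r" using r by (metis image_eqI)
    have 1: "(1 - t) * pf_weight x t (insert r S) s = t * ((1 - t) * ?w s) + ((1 - t) * ((1 - t) * ?w s)) * (x s / (x s - x r))"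
    proof -
      have "(x s - t * x r) / (x s - x r) = t + (1 - t) * (x s / (x s - x r))"
        using ne by (simp add: divide_simps) (simp add: algebra_simps)
      moreover have "(1 - t) * (w * (t + (1 - t) * z)) = t * ((1 - t) * w) + ((1 - t) * ((1 - t) * w)) * z" for w z
        by (simp add: algebra_simps)
      ultimately show ?thesis unfolding pf_weight_insert(1)[OF insert.hyps(1,2) s] by (simp only:)
    qed
    have 2: "(1 - t) * ((1 - t) * (?w s * (x r / (x r - x s)))) = ((1 - t) * ((1 - t) * ?w s)) * (x r / (x r - x s))"
      by (simp only: mult.assoc)
    have "a * (b * g) + c * (d * g + e * h) = (a * b + c * d) * g + c * e * h" for a b c d e g h :: "'a fps"
      by (simp add: algebra_simps)
    then show "fps_const t * (fps_const ((1 - t) * ?w s) * geom_fps (x s)) +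
        fps_const ((1 - t) * ((1 - t) * ?w s)) * (geom_fps (x r) * geom_fps (x s)) =
        fps_const ((1 - t) * pf_weight x t (insert r S) s) * geom_fps (x s) +
        fps_const ((1 - t) * ((1 - t) * (?w s * (x r / (x r - x s))))) * geom_fps (x r)"
      unfolding geom_fps_mult[OF ne] 1 2 fps_const_add[symmetric] fps_const_mult[symmetric] .
  qed
  also have "fps_const (t * ?n) + fps_const ((1 - t) * ?n) * geom_fps (x r) + \<dots> =
      fps_const (t * ?n) + (fps_const ((1 - t) * pf_weight x t (insert r S) r) * geom_fps (x r) +
        (\<Sum>s\<in>S. fps_const ((1 - t) * pf_weight x t (insert r S) s) * geom_fps (x s)))"
  proof -
    have cs: "fps_const (sum g S) = (\<Sum>i\<in>S. fps_const (g i))" for g :: "'i \<Rightarrow> 'a"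
      by (rule fps_ext) (simp add: fps_sum_nth sum.If_cases)
    have "(1 - t) * pf_weight x t (insert r S) r = (1 - t) * ?n + (\<Sum>s\<in>S. (1 - t) * ((1 - t) * (?w s * (x r / (x r - x s)))))"
      unfolding wr by (simp only: distrib_left sum_distrib_left)
    moreover have "a + b * g + (s + c * g) = a + ((b + c) * g + s)" for a b c g s :: "'a fps"
      by (simp add: algebra_simps)
    ultimately show ?thesis
      by (simp only: sum.distrib sum_distrib_right[symmetric] cs fps_const_add[symmetric])
  qed
  finally show ?case using insert.hyps by simp
qed simp

section \<open>Evaluation at a finite set of variables\<close>

lemma to_rat_hom: "to_rat 0 = 0" "to_rat 1 = 1" "to_rat (f + g) = to_rat f + to_rat g"
  "to_rat (f * g) = to_rat f * to_rat g"
  by (simp_all add: to_rat_def Zero_fract_def One_fract_def)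

lemma to_rat_eq_iff: "to_rat f = to_rat g \<longleftrightarrow> f = g"
  by (simp add: to_rat_def eq_fract)

lemma to_rat_sum: "to_rat (sum f S) = (\<Sum>a\<in>S. to_rat (f a))"
  by (induction S rule: infinite_finite_induct) (simp_all add: to_rat_hom)

lemma to_rat_power: "to_rat (f ^ n) = to_rat f ^ n"
  by (induction n) (simp_all add: to_rat_hom)

definition const_rat :: "complex \<Rightarrow> xpoly fract" where
  "const_rat c = to_rat (Const [:c:])"

lemma const_rat_hom: "const_rat 0 = 0" "const_rat 1 = 1" "const_rat (a + b) = const_rat a + const_rat b"
  "const_rat (a * b) = const_rat a * const_rat b"
  by (simp_all only: const_rat_def cc_hom to_rat_hom)

definition ev_sym :: "nat set \<Rightarrow> sym \<Rightarrow> xpoly fract" where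
  "ev_sym S = eval_mpoly const_rat (\<lambda>k. \<Sum>s\<in>S. X s ^ Suc k)"

lemma sym_hom_ev_sym: "sym_hom (ev_sym S)"
  unfolding ev_sym_def by (rule sym_hom_eval_mpoly) (simp_all add: const_rat_hom)

lemma ev_sym_Const: "ev_sym S (Const c) = const_rat c"
  unfolding ev_sym_def by (rule eval_mpoly_Const) (rule const_rat_hom)

lemma ev_sym_Var: "ev_sym S (Var k) = (\<Sum>s\<in>S. X s ^ Suc k)"
  unfolding ev_sym_def by (rule eval_mpoly_Var) (rule const_rat_hom)+

lemma ev_sym_psym: "ev_sym S (psym (Suc k)) = (\<Sum>s\<in>S. X s ^ Suc k)"
  by (simp add: psym_def ev_sym_Var)

lemma to_rat_sym_at: "to_rat (sym_at n f) = ev_sym {1..n} f"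
proof (rule sym_hom_eqI[where \<phi> = "\<lambda>f. to_rat (sym_at n f)"])
  show "sym_hom (\<lambda>f. to_rat (sym_at n f))"
    by standard (simp_all only: sym_at_hom to_rat_hom)
  show "to_rat (sym_at n (Var i)) = ev_sym {1..n} (Var i)" for i
    using sym_at_hom(7)[of n i] by (simp only: psym_def diff_Suc_1 ev_sym_Var to_rat_sum to_rat_power X_def)
qed (rule sym_hom_ev_sym, simp only: sym_at_hom ev_sym_Const const_rat_def)

section \<open>Specialisation of t\<close>

lemma poly_eq_sum_bound:
  fixes p :: "'a::comm_semiring_1 poly"
  assumes "\<And>i. i > N \<Longrightarrow> poly.coeff p i = 0"
  shows "poly p x = (\<Sum>i\<le>N. poly.coeff p i * x ^ i)"
proof -
  have "degree p \<le> N" using assms by (intro degree_le) auto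
  then have "(\<Sum>i\<le>degree p. poly.coeff p i * x ^ i) = (\<Sum>i\<le>N. poly.coeff p i * x ^ i)"
    by (intro sum.mono_neutral_left) (auto simp: coeff_eq_0)
  then show ?thesis by (simp add: poly_altdef)
qed

context
  fixes \<phi> :: "sym \<Rightarrow> 'a::comm_ring_1"
  assumes hom: "sym_hom \<phi>"
begin

interpretation sym_hom \<phi> by (rule hom)

lemma map_poly_one: "map_poly \<phi> 1 = 1"
  by (rule poly_eqI) (simp add: coeff_map_poly zero one coeff_1 if_distrib[of \<phi>] cong: if_cong)

lemma map_poly_add: "map_poly \<phi> (p + q) = map_poly \<phi> p + map_poly \<phi> q"
  by (rule poly_eqI) (simp add: coeff_map_poly zero add)

lemma map_poly_mult: "map_poly \<phi> (p * q) = map_poly \<phi> p * map_poly \<phi> q"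
  by (rule poly_eqI) (simp add: coeff_map_poly zero sum mult coeff_mult)

end

text \<open>Putting \<open>T\<close> for t requires a polynomial; outside \<open>Lambda_t\<close>
  the value of \<open>inv fps_of_poly\<close> is arbitrary, hence the membership hypotheses
  below.\<close>

definition ev :: "nat set \<Rightarrow> sym fps \<Rightarrow> xpoly fract" where
  "ev S F = poly (map_poly (ev_sym S) (inv fps_of_poly F)) T"

lemma ev_fps_of_poly: "ev S (fps_of_poly p) = poly (map_poly (ev_sym S) p) T"
proof -
  have "inj (fps_of_poly :: sym poly \<Rightarrow> sym fps)" by (rule injI) (simp add: fps_of_poly_eq_iff)
  then show ?thesis by (simp add: ev_def)
qed

lemma ev_add: "F \<in> Lambda_t \<Longrightarrow> G \<in> Lambda_t \<Longrightarrow> ev S (F + G) = ev S F + ev S G"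
  unfolding Lambda_t_def
  by (elim rangeE)
    (simp add: fps_of_poly_add[symmetric] ev_fps_of_poly map_poly_add[OF sym_hom_ev_sym])

lemma ev_mult: "F \<in> Lambda_t \<Longrightarrow> G \<in> Lambda_t \<Longrightarrow> ev S (F * G) = ev S F * ev S G"
  unfolding Lambda_t_def
  by (elim rangeE)
    (simp add: fps_of_poly_mult[symmetric] ev_fps_of_poly map_poly_mult[OF sym_hom_ev_sym])

lemma ev_one: "ev S 1 = 1"
  using ev_fps_of_poly[of S 1] by (simp add: map_poly_one[OF sym_hom_ev_sym])

lemma ev_eq_sum:
  assumes "\<And>n. n > N \<Longrightarrow> fps_nth F n = 0"
  shows "ev S F = (\<Sum>n\<le>N. ev_sym S (fps_nth F n) * T ^ n)"
proof -
  have "F \<in> Lambda_t" using assms unfolding Lambda_t_iff by blast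
  then obtain p where p: "F = fps_of_poly p" unfolding Lambda_t_def by blast
  have z: "ev_sym S 0 = 0" by (rule sym_hom.zero[OF sym_hom_ev_sym])
  show ?thesis unfolding p ev_fps_of_poly fps_of_poly_nth
    using assms by (subst poly_eq_sum_bound[where N = N]) (simp_all add: coeff_map_poly z p)
qed

lemma ev_zero: "ev S 0 = 0"
  by (subst ev_eq_sum[of 0]) (simp_all add: sym_hom.zero[OF sym_hom_ev_sym])

lemma ev_fps_const: "ev S (fps_const f) = ev_sym S f"
  by (subst ev_eq_sum[of 0]) simp_all

lemma ev_X: "ev S (- fps_X) = - T"
  by (subst ev_eq_sum[of 1])
    (simp_all add: fps_X_def sym_hom.zero[OF sym_hom_ev_sym] sym_hom.one[OF sym_hom_ev_sym] sym_hom.uminus[OF sym_hom_ev_sym])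

lemma ev_power: "F \<in> Lambda_t \<Longrightarrow> ev S (F ^ n) = ev S F ^ n"
  by (induction n) (simp_all add: ev_one ev_mult Lambda_t_power)

lemma ev_sum: "(\<And>a. a \<in> I \<Longrightarrow> F a \<in> Lambda_t) \<Longrightarrow> ev S (sum F I) = (\<Sum>a\<in>I. ev S (F a))"
proof (induction I rule: infinite_finite_induct)
  case (insert x I)
  have "F x \<in> Lambda_t" "sum F I \<in> Lambda_t" using insert.prems by (auto intro!: Lambda_t_sum)
  from ev_add[OF this] show ?case using insert by simp
qed (simp_all add: ev_zero)

lemma to_rat_at_vars:
  assumes "F \<in> Lambda_t"
  shows "to_rat (at_vars n F) = ev {1..n} F"
proof -
  obtain p where p: "F = fps_of_poly p" using assms unfolding Lambda_t_def by blast
  have the: "(THE q. fps_of_poly q = fps_of_poly p) = p" by (simp add: fps_of_poly_eq_iff)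
  have Cp: "to_rat (Const ([:0, 1:] ^ k)) = T ^ k" for k
  proof (induction k)
    case (Suc k)
    then show ?case unfolding power_Suc Const_hom(4) to_rat_hom(4) by (simp only: T_def)
  qed (simp add: Const_hom to_rat_hom)
  have "to_rat (at_vars n F) = (\<Sum>k\<le>degree p. T ^ k * ev_sym {1..n} (poly.coeff p k))"
    unfolding at_vars_def p the Let_def to_rat_sum to_rat_hom(4) Cp to_rat_sym_at ..
  also have "\<dots> = ev {1..n} F"
    by (subst ev_eq_sum[where N = "degree p"]) (simp_all add: p coeff_eq_0 mult.commute)
  finally show ?thesis .
qed

section \<open>Generating series in finitely many variables\<close>

lemma ev_sym_hsym_fps: "Abs_fps (\<lambda>k. ev_sym S (hsym k)) = (\<Prod>s\<in>S. geom_fps (X s))"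
proof (rule sym_hom_hsym_eq[OF sym_hom_ev_sym])
  have e: "(\<Sum>s\<in>S. Abs_fps (\<lambda>k. X s ^ Suc k)) = Abs_fps (\<lambda>k. ev_sym S (psym (Suc k)))"
    by (rule fps_ext) (simp add: fps_sum_nth ev_sym_psym)
  show "fps_X * fps_deriv (\<Prod>s\<in>S. geom_fps (X s)) =
      (\<Prod>s\<in>S. geom_fps (X s)) * (fps_X * Abs_fps (\<lambda>k. ev_sym S (psym (Suc k))))"
    unfolding e[symmetric] by (rule log_deriv_prod) (rule geometric_ode)
  show "fps_nth (\<Prod>s\<in>S. geom_fps (X s)) 0 = 1"
    by (induction S rule: infinite_finite_induct) simp_all
qed

lemma ev_sym_esym_fps: "Abs_fps (\<lambda>k. ev_sym S (esym k)) = (\<Prod>s\<in>S. 1 - fps_const (- X s) * fps_X)"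
proof (rule sym_hom_esym_eq[OF sym_hom_ev_sym])
  have e: "(\<Sum>s\<in>S. Abs_fps (\<lambda>k. - ((- X s) ^ Suc k))) = Abs_fps (\<lambda>k. (-1) ^ k * ev_sym S (psym (Suc k)))"
  proof (rule fps_ext)
    fix k
    have "- ((- X s) ^ Suc k) = (-1) ^ k * X s ^ Suc k" for s
      by (subst power_minus) simp
    then show "fps_nth (\<Sum>s\<in>S. Abs_fps (\<lambda>k. - ((- X s) ^ Suc k))) k =
        fps_nth (Abs_fps (\<lambda>k. (-1) ^ k * ev_sym S (psym (Suc k)))) k"
      by (simp add: fps_sum_nth ev_sym_psym sum_distrib_left del: power_Suc)
  qed
  show "fps_X * fps_deriv (\<Prod>s\<in>S. 1 - fps_const (- X s) * fps_X) =
      (\<Prod>s\<in>S. 1 - fps_const (- X s) * fps_X) * (fps_X * Abs_fps (\<lambda>k. (-1) ^ k * ev_sym S (psym (Suc k))))"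
    unfolding e[symmetric] by (rule log_deriv_prod) (rule one_minus_ode)
  show "fps_nth (\<Prod>s\<in>S. 1 - fps_const (- X s) * fps_X) 0 = 1"
    by (induction S rule: infinite_finite_induct) simp_all
qed

text \<open>The substitution u -> c u, used to pass from E(u) to E(-tu).\<close>

lemma fps_scale_prod:
  fixes F :: "'i \<Rightarrow> 'a::comm_ring_1 fps"
  shows "Abs_fps (\<lambda>k. c ^ k * fps_nth (\<Prod>s\<in>S. F s) k) = (\<Prod>s\<in>S. Abs_fps (\<lambda>k. c ^ k * fps_nth (F s) k))"
proof (induction S rule: infinite_finite_induct)
  case (insert x S)
  have "Abs_fps (\<lambda>k. c ^ k * fps_nth (G * H) k) =
      Abs_fps (\<lambda>k. c ^ k * fps_nth G k) * Abs_fps (\<lambda>k. c ^ k * fps_nth H k)" for G H :: "'a fps"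
  proof (rule fps_ext)
    fix k
    have "c ^ k * (fps_nth G i * fps_nth H (k - i)) = (c ^ i * fps_nth G i) * (c ^ (k - i) * fps_nth H (k - i))"
      if "i \<in> {0..k}" for i
    proof -
      have "c ^ k = c ^ i * c ^ (k - i)" using that by (simp flip: power_add)
      then show ?thesis by (simp only: mult_ac)
    qed
    then show "fps_nth (Abs_fps (\<lambda>k. c ^ k * fps_nth (G * H) k)) k =
        fps_nth (Abs_fps (\<lambda>k. c ^ k * fps_nth G k) * Abs_fps (\<lambda>k. c ^ k * fps_nth H k)) k"
      by (simp add: fps_mult_nth sum_distrib_left)
  qed
  then show ?case using insert by simp
qed (auto intro!: fps_ext)

lemma X_eq_iff: "X i = X j \<longleftrightarrow> i = j"
proof -
  have "Var i = (Var j :: xpoly) \<longleftrightarrow> i = j"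
  proof
    assume "Var i = (Var j :: xpoly)"
    then have "Poly_Mapping.keys (Var i :: xpoly) = Poly_Mapping.keys (Var j :: xpoly)" by simp
    then have "Poly_Mapping.single i (1::nat) = Poly_Mapping.single j 1" by (simp add: Var_def)
    then have "Poly_Mapping.keys (Poly_Mapping.single i (1::nat)) = Poly_Mapping.keys (Poly_Mapping.single j (1::nat))" by simp
    then show "i = j" by simp
  qed simp
  then show ?thesis by (simp add: X_def to_rat_eq_iff)
qed

lemma T_power_ne_1: "0 < k \<Longrightarrow> T ^ k \<noteq> 1"
proof -
  assume k: "0 < k"
  have "Const ([:0, 1:] ^ k) \<noteq> (Const 1 :: xpoly)"
  proof
    assume "Const ([:0, 1:] ^ k) = (Const 1 :: xpoly)"
    then have "Poly_Mapping.lookup (Const ([:0, 1:] ^ k) :: xpoly) 0 = Poly_Mapping.lookup (Const 1 :: xpoly) 0" by simp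
    then have "[:0, 1::complex:] ^ k = 1" by (simp add: Const_def)
    then have "poly ([:0, 1::complex:] ^ k) 0 = 1" by simp
    with k show False by (simp add: zero_power)
  qed
  moreover have "(Const ([:0, 1:] ^ k) :: xpoly) = Const [:0, 1:] ^ k"
    by (induction k) (simp_all only: power_0 power_Suc Const_hom)
  ultimately show ?thesis
    unfolding T_def to_rat_power[symmetric] to_rat_hom(2)[symmetric] to_rat_eq_iff Const_hom(2) by simp
qed

abbreviation hl_weight :: "nat set \<Rightarrow> nat \<Rightarrow> xpoly fract" where
  "hl_weight \<equiv> pf_weight X T"

lemma ev_hl_q:
  assumes "finite S"
  shows "ev S (hl_q (int k)) = (if k = 0 then T ^ card S else 0) + (1 - T) * (\<Sum>s\<in>S. hl_weight S s * X s ^ k)"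
proof -
  have inj: "inj_on X S" by (rule inj_onI) (simp add: X_eq_iff)
  have "Abs_fps (\<lambda>i. (- T) ^ i * ev_sym S (esym i)) = (\<Prod>s\<in>S. Abs_fps (\<lambda>k. (- T) ^ k * fps_nth (1 - fps_const (- X s) * fps_X) k))"
    using arg_cong[OF ev_sym_esym_fps[of S], of fps_nth]
    unfolding fps_scale_prod[symmetric] by (metis fps_nth_Abs_fps)
  also have "\<dots> = (\<Prod>s\<in>S. 1 - fps_const (T * X s) * fps_X)"
  proof (rule prod.cong[OF refl], rule fps_ext)
    fix s k
    show "fps_nth (Abs_fps (\<lambda>k. (- T) ^ k * fps_nth (1 - fps_const (- X s) * fps_X) k)) k =
        fps_nth (1 - fps_const (T * X s) * fps_X) k"
      by (cases k; cases "k - 1") simp_all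
  qed
  finally have E: "Abs_fps (\<lambda>i. (- T) ^ i * ev_sym S (esym i)) = (\<Prod>s\<in>S. 1 - fps_const (T * X s) * fps_X)" .
  have "ev S (hl_q (int k)) = (\<Sum>i\<le>k. ((- T) ^ i * ev_sym S (esym i)) * ev_sym S (hsym (k - i)))"
    unfolding hl_q_int
    by (subst ev_sum)
      (simp_all only: ev_mult ev_power ev_X ev_fps_const Lambda_t_closed Lambda_t_power mult.assoc
        sym_hom.mult[OF sym_hom_ev_sym])
  also have "\<dots> = fps_nth (Abs_fps (\<lambda>i. (- T) ^ i * ev_sym S (esym i)) * Abs_fps (\<lambda>k. ev_sym S (hsym k))) k"
    by (simp add: fps_mult_nth atMost_atLeast0)
  also have "\<dots> = fps_nth (\<Prod>s\<in>S. (1 - fps_const (T * X s) * fps_X) * geom_fps (X s)) k"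
    unfolding E ev_sym_hsym_fps prod.distrib ..
  also have "\<dots> = (if k = 0 then T ^ card S else 0) + (1 - T) * (\<Sum>s\<in>S. hl_weight S s * X s ^ k)"
    unfolding partial_fractions_fps[OF assms inj]
    by (simp add: fps_sum_nth sum_distrib_left mult.assoc)
  finally show ?thesis .
qed

text \<open>The expansion at u = 0, where the coefficient is 1. It is the source of the factors 1 -
  t^i.\<close>

lemma sum_hl_weight:
  assumes "finite S"
  shows "(1 - T) * (\<Sum>s\<in>S. hl_weight S s) = 1 - T ^ card S"
  using ev_hl_q[OF assms, of 0] by (simp add: hl_q_0 ev_one algebra_simps)

lemma ev_sym_remove:
  assumes "finite S" "s \<in> S"
  shows "poly (map_poly (ev_sym S) (shift_hom f)) (X s) = ev_sym (S - {s}) f"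
proof (rule sym_hom_eqI[where \<phi> = "\<lambda>f. poly (map_poly (ev_sym S) (shift_hom f)) (X s)"])
  interpret sh: sym_hom shift_hom by (rule sym_hom_shift_hom)
  interpret e: sym_hom "ev_sym S" by (rule sym_hom_ev_sym)
  show "sym_hom (\<lambda>f. poly (map_poly (ev_sym S) (shift_hom f)) (X s))"
    by standard (simp_all add: sh.one sh.add sh.mult map_poly_one[OF sym_hom_ev_sym]
        map_poly_add[OF sym_hom_ev_sym] map_poly_mult[OF sym_hom_ev_sym])
  show "poly (map_poly (ev_sym S) (shift_hom (Const c))) (X s) = ev_sym (S - {s}) (Const c)" for c
    by (simp add: shift_hom_Const ev_sym_Const map_poly_pCons e.zero)
  show "poly (map_poly (ev_sym S) (shift_hom (Var i))) (X s) = ev_sym (S - {s}) (Var i)" for i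
  proof -
    have "shift_hom (Var i) = [:Var i:] + monom (-1) (Suc i)"
      using shift_hom_psym[of i] by (simp add: psym_def minus_monom)
    moreover have "map_poly (ev_sym S) (monom (-1) (Suc i)) = monom (-1) (Suc i)"
      by (rule poly_eqI) (simp add: coeff_map_poly e.zero e.uminus e.one)
    ultimately show ?thesis
      using assms by (simp add: map_poly_add[OF sym_hom_ev_sym] map_poly_pCons e.zero ev_sym_Var
          poly_monom sum_diff1 del: power_Suc)
  qed
qed (rule sym_hom_ev_sym)

lemma sum_ev_fps_eperp:
  assumes S: "finite S" "s \<in> S" and F: "F \<in> Lambda_t" and M: "\<And>m. m \<ge> M \<Longrightarrow> fps_eperp m F = 0"
  shows "(\<Sum>m<M. X s ^ m * ev S (fps_eperp m F)) = ev (S - {s}) F"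
proof -
  obtain N where N: "\<And>n. n > N \<Longrightarrow> fps_nth F n = 0" using F unfolding Lambda_t_iff by blast
  have e0: "ev_sym S 0 = 0" by (rule sym_hom.zero[OF sym_hom_ev_sym])
  have zero: "eperp m (fps_nth F n) = 0" if "m \<ge> M" for m n
    using arg_cong[OF M[OF that], of "\<lambda>G. fps_nth G n"] by simp
  have "(\<Sum>m<M. X s ^ m * ev S (fps_eperp m F)) =
      (\<Sum>m<M. \<Sum>n\<le>N. X s ^ m * (ev_sym S (eperp m (fps_nth F n)) * T ^ n))"
    by (subst ev_eq_sum[where N = N]) (simp_all add: N eperp_zero sum_distrib_left)
  also have "\<dots> = (\<Sum>n\<le>N. (\<Sum>m<M. ev_sym S (eperp m (fps_nth F n)) * X s ^ m) * T ^ n)"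
    unfolding sum_distrib_right by (subst sum.swap) (simp only: mult_ac)
  also have "\<dots> = (\<Sum>n\<le>N. ev_sym (S - {s}) (fps_nth F n) * T ^ n)"
  proof (intro sum.cong refl arg_cong2[where f = "(*)"])
    fix n
    let ?p = "map_poly (ev_sym S) (shift_hom (fps_nth F n))"
    have c: "poly.coeff ?p m = ev_sym S (eperp m (fps_nth F n))" for m
      by (simp add: coeff_map_poly e0 eperp_def)
    have "poly ?p (X s) = (\<Sum>m\<le>M. poly.coeff ?p m * X s ^ m)"
      by (rule poly_eq_sum_bound) (simp add: c zero e0)
    also have "\<dots> = (\<Sum>m<M. poly.coeff ?p m * X s ^ m)"
      by (rule sum.mono_neutral_right) (auto simp: c zero e0 not_less)
    finally show "(\<Sum>m<M. ev_sym S (eperp m (fps_nth F n)) * X s ^ m) = ev_sym (S - {s}) (fps_nth F n)"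
      unfolding ev_sym_remove[OF S] c ..
  qed
  also have "\<dots> = ev (S - {s}) F" by (rule ev_eq_sum[symmetric]) (rule N)
  finally show ?thesis .
qed

text \<open>\<open>\<Sum>\<^sub>m x\<^sub>s\<^sup>m (-1)\<^sup>m e\<^sub>m\<^sup>\<bottom>\<close> deletes the variable \<open>x\<^sub>s\<close>. For \<open>j > 0\<close> the constant term \<open>t\<^sup>n\<close> of the partial
  fraction expansion does not contribute.\<close>

lemma ev_hl_Gamma:
  assumes S: "finite S" and F: "F \<in> Lambda_t" and j: "0 < j"
  shows "ev S (hl_Gamma (- int j) F) = (1 - T) * (\<Sum>s\<in>S. X s ^ j * hl_weight S s * ev (S - {s}) F)"
proof -
  obtain M where M: "\<And>m. m \<ge> M \<Longrightarrow> fps_eperp m F = 0"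
    using fps_eperp_eventually_zero[OF F] by blast
  have "ev S (hl_Gamma (- int j) F) = (\<Sum>m<M. ev S (hl_q (int (m + j)) * fps_eperp m F))"
    by (subst hl_Gamma_eq_sum[where M = M], erule M, subst ev_sum)
      (simp_all add: Lambda_t_closed Lambda_t_hl_q Lambda_t_fps_eperp F)
  also have "\<dots> = (\<Sum>m<M. (1 - T) * (\<Sum>s\<in>S. hl_weight S s * X s ^ (m + j)) * ev S (fps_eperp m F))"
    using j by (simp add: ev_mult Lambda_t_hl_q Lambda_t_fps_eperp F ev_hl_q[OF S] del: of_nat_add)
  also have "\<dots> = (1 - T) * (\<Sum>m<M. \<Sum>s\<in>S. (X s ^ j * hl_weight S s) * (X s ^ m * ev S (fps_eperp m F)))"
    unfolding sum_distrib_left sum_distrib_right power_add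
    by (intro sum.cong refl) (simp only: mult_ac)
  also have "(\<Sum>m<M. \<Sum>s\<in>S. (X s ^ j * hl_weight S s) * (X s ^ m * ev S (fps_eperp m F))) =
      (\<Sum>s\<in>S. (X s ^ j * hl_weight S s) * (\<Sum>m<M. X s ^ m * ev S (fps_eperp m F)))"
    by (subst sum.swap) (simp only: sum_distrib_left)
  also have "\<dots> = (\<Sum>s\<in>S. X s ^ j * hl_weight S s * ev (S - {s}) F)"
    by (rule sum.cong) (simp_all add: sum_ev_fps_eperp[OF S _ F M])
  finally show ?thesis .
qed

section \<open>The symmetrisation formula\<close>

lemma before_first_nonzero:
  assumes N: "\<forall>j<N. A i j = 0" and r: "r < first_nonzero A i"
  shows "A i r = 0"
proof (cases "\<exists>k. A i k \<noteq> 0")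
  case True
  then obtain k where k: "A i k \<noteq> 0" by blast
  \<comment> \<open>The window from the bound \<open>N\<close> to a non-zero entry is finite, so the
    first non-zero position exists as a minimum.\<close>
  define S where "S = {j \<in> {N..k}. A i j \<noteq> 0}"
  have "N \<le> k" using N k not_le by blast
  then have S: "finite S" "S \<noteq> {}" using k by (auto simp: S_def intro: finite_subset[of _ "{N..k}"])
  have below: "A i r = 0" if "r < Min S" for r
  proof (rule ccontr)
    assume "A i r \<noteq> 0"
    have "Min S \<le> k" using Min_in[OF S] by (auto simp: S_def)
    moreover have "N \<le> r" using N \<open>A i r \<noteq> 0\<close> not_le by blast
    ultimately have "r \<in> S" using that \<open>A i r \<noteq> 0\<close> by (simp add: S_def)
    with S that show False by (meson Min_le not_le)
  qed
  have "first_nonzero A i = Min S"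
    unfolding first_nonzero_def
  proof (rule Greatest_equality)
    show "y \<le> Min S" if "\<forall>r<y. A i r = 0" for y
    proof (rule ccontr)
      assume "\<not> y \<le> Min S"
      then have "A i (Min S) = 0" using that by simp
      moreover have "A i (Min S) \<noteq> 0" using Min_in[OF S] by (simp add: S_def)
      ultimately show False by simp
    qed
  qed (use below in blast)
  then show ?thesis using below r by simp
qed auto

text \<open>For powers beyond the upper end of the defining sum the matrix entry lies to the left of
  the first non-zero one and vanishes, so all positive powers can be treated alike.\<close>

lemma coeff_f_poly:
  assumes "\<forall>j<N. A (- k) j = 0" "0 < k"
  shows "poly.coeff (f_poly A k) i = (if 1 \<le> i then A (- k) (- int i) else 0)"
proof -
  have "poly.coeff (f_poly A k) i =
      (\<Sum>j\<in>{1..- first_nonzero A (- k)}. if j = int i then A (- k) (- int i) else 0)"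
  proof -
    have f: "f_poly A k = (\<Sum>j\<in>{1..- first_nonzero A (- k)}. monom (A (- k) (- j)) (nat j))"
      using assms(2) by (simp add: f_poly_def)
    show ?thesis unfolding f coeff_sum by (rule sum.cong) auto
  qed
  then show ?thesis using before_first_nonzero[of N A "- k" "- int i"] assms(1) by auto
qed

definition f_val :: "(int \<Rightarrow> int \<Rightarrow> complex) \<Rightarrow> int \<Rightarrow> nat \<Rightarrow> xpoly fract" where
  "f_val A k s = poly (map_poly const_rat (f_poly A k)) (X s)"

lemma f_val_0: "f_val A 0 s = 1"
proof -
  have "map_poly const_rat 1 = 1"
    by (rule poly_eqI) (simp add: coeff_map_poly const_rat_hom)
  then show ?thesis by (simp add: f_val_def f_poly_def)
qed

context
  fixes A :: "int \<Rightarrow> int \<Rightarrow> complex"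
  assumes row_bounded: "\<And>i. \<exists>N. \<forall>j<N. A i j = 0"
    and lower: "\<And>i j. i < 0 \<Longrightarrow> 0 \<le> j \<Longrightarrow> A i j = 0"
begin

lemma poly_f_poly_0: "0 < k \<Longrightarrow> poly (f_poly A k) 0 = 0"
  using row_bounded[of "- k"] by (auto simp: poly_0_coeff_0 coeff_f_poly)

lemma ev_tGamma:
  assumes S: "finite S" and F: "F \<in> Lambda_t" and k: "0 < k"
  shows "ev S (tGamma A (- k) F) = (1 - T) * (\<Sum>s\<in>S. f_val A k s * hl_weight S s * ev (S - {s}) F)"
proof -
  obtain N0 where "\<forall>j<N0. A (- k) j = 0" using row_bounded by blast
  define N where "N = nat (- N0)"
  have N: "\<forall>j<(- int N). A (- k) j = 0" using \<open>\<forall>j<N0. A (- k) j = 0\<close> by (auto simp: N_def)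
  \<comment> \<open>\<open>lower\<close> excludes the operators with index \<ge> 0, so only those
    remain to which \<open>ev_hl_Gamma\<close> applies.\<close>
  define J where "J = (\<lambda>j. - int j) ` {1..N}"
  have J: "A (- k) j = 0" if "j \<notin> J" for j
  proof (cases "j < - int N \<or> 0 \<le> j")
    case False
    then have "j \<in> J" unfolding J_def by (intro image_eqI[of _ _ "nat (- j)"]) auto
    with that show ?thesis by simp
  qed (use N lower k in auto)
  have "tGamma A (- k) F = (\<Sum>j\<in>J. scalar (A (- k) j) * hl_Gamma j F)"
    by (rule tGamma_eq_sum) (auto simp: J scalar_0, simp add: J_def)
  also have "\<dots> = (\<Sum>j\<in>{1..N}. scalar (A (- k) (- int j)) * hl_Gamma (- int j) F)"
    unfolding J_def by (subst sum.reindex) (auto simp: inj_on_def)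
  finally have "ev S (tGamma A (- k) F) = (\<Sum>j\<in>{1..N}. ev S (scalar (A (- k) (- int j)) * hl_Gamma (- int j) F))"
    by (simp add: ev_sum Lambda_t_closed Lambda_t_scalar Lambda_t_hl_Gamma F)
  also have "\<dots> = (\<Sum>j\<in>{1..N}. const_rat (A (- k) (- int j)) *
      ((1 - T) * (\<Sum>s\<in>S. X s ^ j * hl_weight S s * ev (S - {s}) F)))"
  proof (rule sum.cong[OF refl])
    fix j assume "j \<in> {1..N}"
    then have "0 < j" by simp
    from ev_hl_Gamma[OF S F this]
    show "ev S (scalar (A (- k) (- int j)) * hl_Gamma (- int j) F) = const_rat (A (- k) (- int j)) *
        ((1 - T) * (\<Sum>s\<in>S. X s ^ j * hl_weight S s * ev (S - {s}) F))"
      by (simp add: ev_mult Lambda_t_scalar Lambda_t_hl_Gamma F) (simp add: scalar_def ev_fps_const ev_sym_Const)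
  qed
  also have "\<dots> = (1 - T) * (\<Sum>j\<in>{1..N}. \<Sum>s\<in>S. (const_rat (A (- k) (- int j)) * X s ^ j) * (hl_weight S s * ev (S - {s}) F))"
    unfolding sum_distrib_left by (simp only: mult_ac)
  also have "\<dots> = (1 - T) * (\<Sum>s\<in>S. (\<Sum>j\<in>{1..N}. const_rat (A (- k) (- int j)) * X s ^ j) * (hl_weight S s * ev (S - {s}) F))"
    unfolding sum_distrib_right by (subst sum.swap) (rule refl)
  finally have e: "ev S (tGamma A (- k) F) =
    (1 - T) * (\<Sum>s\<in>S. (\<Sum>j\<in>{1..N}. const_rat (A (- k) (- int j)) * X s ^ j) * (hl_weight S s * ev (S - {s}) F))" .
  have f: "(\<Sum>j\<in>{1..N}. const_rat (A (- k) (- int j)) * X s ^ j) = f_val A k s" for s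
  proof -
    have c: "poly.coeff (map_poly const_rat (f_poly A k)) j = (if 1 \<le> j then const_rat (A (- k) (- int j)) else 0)" for j
      by (simp add: coeff_map_poly const_rat_hom coeff_f_poly[where A = A, OF N k])
    have "f_val A k s = (\<Sum>j\<le>N. poly.coeff (map_poly const_rat (f_poly A k)) j * X s ^ j)"
      unfolding f_val_def by (rule poly_eq_sum_bound) (use N in \<open>simp add: c const_rat_hom\<close>)
    also have "\<dots> = (\<Sum>j\<in>{1..N}. const_rat (A (- k) (- int j)) * X s ^ j)"
      by (rule sum.mono_neutral_cong_right) (auto simp: c)
    finally show ?thesis ..
  qed
  show ?thesis unfolding e f by (simp only: mult.assoc)
qed

end

section \<open>The sum over the symmetric group as a sum over orderings\<close>

fun f_prod :: "(int \<Rightarrow> int \<Rightarrow> complex) \<Rightarrow> (nat \<Rightarrow> int) \<Rightarrow> nat \<Rightarrow> nat list \<Rightarrow> xpoly fract" where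
  "f_prod A lam a [] = 1"
| "f_prod A lam a (s # xs) = f_val A (lam a) s * f_prod A lam (Suc a) xs"

fun pair_prod :: "nat list \<Rightarrow> xpoly fract" where
  "pair_prod [] = 1"
| "pair_prod (s # xs) = (\<Prod>r\<in>set xs. (X s - T * X r) / (X s - X r)) * pair_prod xs"

text \<open>A list stands for (\<sigma>(a), \<sigma>(a+1), ...). Lists remain meaningful when S has
  gaps, and their head is the variable that the outermost operator deletes.\<close>

definition perm_sum :: "(int \<Rightarrow> int \<Rightarrow> complex) \<Rightarrow> (nat \<Rightarrow> int) \<Rightarrow> nat \<Rightarrow> nat set \<Rightarrow> xpoly fract" where
  "perm_sum A lam a S = (\<Sum>xs\<in>permutations_of_set S. f_prod A lam a xs * pair_prod xs)"

lemma perm_sum_empty: "perm_sum A lam a {} = 1"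
  by (simp add: perm_sum_def)

lemma perm_sum_rec:
  assumes "finite S" "S \<noteq> {}"
  shows "perm_sum A lam a S = (\<Sum>s\<in>S. f_val A (lam a) s * hl_weight S s * perm_sum A lam (Suc a) (S - {s}))"
proof -
  have "perm_sum A lam a S = (\<Sum>s\<in>S. \<Sum>xs\<in>(#) s ` permutations_of_set (S - {s}). f_prod A lam a xs * pair_prod xs)"
    unfolding perm_sum_def permutations_of_set_nonempty[OF assms(2)]
    by (rule sum.UNION_disjoint) (use assms in auto)
  also have "\<dots> = (\<Sum>s\<in>S. f_val A (lam a) s * hl_weight S s * perm_sum A lam (Suc a) (S - {s}))"
  proof (rule sum.cong[OF refl])
    fix s assume "s \<in> S"
    have "(\<Sum>xs\<in>(#) s ` permutations_of_set (S - {s}). f_prod A lam a xs * pair_prod xs) =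
        (\<Sum>xs\<in>permutations_of_set (S - {s}). f_prod A lam a (s # xs) * pair_prod (s # xs))"
      by (subst sum.reindex) (auto simp: inj_on_def)
    also have "\<dots> = (\<Sum>xs\<in>permutations_of_set (S - {s}). f_val A (lam a) s * hl_weight S s * (f_prod A lam (Suc a) xs * pair_prod xs))"
    proof (rule sum.cong[OF refl])
      fix xs assume "xs \<in> permutations_of_set (S - {s})"
      then have "set xs = S - {s}" by (rule permutations_of_setD)
      then show "f_prod A lam a (s # xs) * pair_prod (s # xs) =
          f_val A (lam a) s * hl_weight S s * (f_prod A lam (Suc a) xs * pair_prod xs)"
        by (simp only: f_prod.simps pair_prod.simps pf_weight_def mult_ac)
    qed
    also have "\<dots> = f_val A (lam a) s * hl_weight S s * perm_sum A lam (Suc a) (S - {s})"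
      by (simp only: perm_sum_def sum_distrib_left)
    finally show "(\<Sum>xs\<in>(#) s ` permutations_of_set (S - {s}). f_prod A lam a xs * pair_prod xs) =
        f_val A (lam a) s * hl_weight S s * perm_sum A lam (Suc a) (S - {s})" .
  qed
  finally show ?thesis .
qed

text \<open>The classical evaluation of the symmetrised product of (x_i - t x_j) / (x_i - x_j). As
  f_0 = 1, splitting off the head of the ordering leaves \<open>sum_hl_weight\<close>, and a set of
  i variables contributes 1 - t^i.\<close>

lemma perm_sum_zeros:
  assumes "finite S" "\<And>i. a \<le> i \<Longrightarrow> lam i = 0"
  shows "(1 - T) ^ card S * perm_sum A lam a S = (\<Prod>i=1..card S. 1 - T ^ i)"
  using assms
proof (induction "card S" arbitrary: S a)
  case 0
  then show ?case by (simp add: perm_sum_empty)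
next
  case (Suc n)
  then have ne: "S \<noteq> {}" by auto
  have IH: "(1 - T) ^ n * perm_sum A lam (Suc a) (S - {s}) = (\<Prod>i=1..n. 1 - T ^ i)" if "s \<in> S" for s
  proof -
    have n: "n = card (S - {s})" using Suc.hyps(2) that by simp
    show ?thesis using Suc.hyps(1)[OF n, of "Suc a"] Suc.prems n by simp
  qed
  have "(1 - T) ^ Suc n * perm_sum A lam a S =
      (1 - T) * (\<Sum>s\<in>S. hl_weight S s * ((1 - T) ^ n * perm_sum A lam (Suc a) (S - {s})))"
    unfolding perm_sum_rec[OF Suc.prems(1) ne] Suc.prems(2)[OF order.refl] f_val_0 sum_distrib_left
    by (intro sum.cong refl) (simp add: mult_ac)
  also have "\<dots> = ((1 - T) * (\<Sum>s\<in>S. hl_weight S s)) * (\<Prod>i=1..n. 1 - T ^ i)"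
    by (simp add: IH sum_distrib_right mult.assoc)
  also have "\<dots> = (\<Prod>i=1..Suc n. 1 - T ^ i)"
    unfolding sum_hl_weight[OF Suc.prems(1)] Suc.hyps(2)[symmetric] by simp
  finally show ?case unfolding Suc.hyps(2)[symmetric] .
qed

lemma f_prod_map_upt:
  "a \<le> Suc n \<Longrightarrow> f_prod A lam a (map \<sigma> [a..<Suc n]) = (\<Prod>i=a..n. f_val A (lam i) (\<sigma> i))"
proof (induction rule: inc_induct)
  case (step a)
  then have "{a..n} = insert a {Suc a..n}" by auto
  then show ?case using step by (simp add: upt_conv_Cons del: upt_Suc)
qed simp

lemma pair_prod_map_upt:
  assumes "inj \<sigma>"
  shows "a \<le> Suc n \<Longrightarrow> pair_prod (map \<sigma> [a..<Suc n]) =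
    (\<Prod>(i, j)\<in>pairs_from a n. (X (\<sigma> i) - T * X (\<sigma> j)) / (X (\<sigma> i) - X (\<sigma> j)))"
proof (induction rule: inc_induct)
  case base
  have "pairs_from (Suc n) n = {}" by (auto simp: pairs_from_def)
  then show ?case by simp
next
  case (step a)
  let ?h = "\<lambda>(i, j). (X (\<sigma> i) - T * X (\<sigma> j)) / (X (\<sigma> i) - X (\<sigma> j))"
  have p: "pairs_from a n = Pair a ` {Suc a..<Suc n} \<union> pairs_from (Suc a) n"
    using step.hyps by (auto simp: pairs_from_def)
  have "prod ?h (pairs_from a n) = prod ?h (Pair a ` {Suc a..<Suc n}) * prod ?h (pairs_from (Suc a) n)"
    unfolding p by (rule prod.union_disjoint) (use finite_pairs_from in \<open>auto simp: pairs_from_def\<close>)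
  also have "prod ?h (Pair a ` {Suc a..<Suc n}) = (\<Prod>j\<in>{Suc a..<Suc n}. ?h (a, j))"
    by (subst prod.reindex) (auto simp: inj_on_def)
  also have "\<dots> = (\<Prod>r\<in>\<sigma> ` {Suc a..<Suc n}. (X (\<sigma> a) - T * X r) / (X (\<sigma> a) - X r))"
    using assms by (subst prod.reindex) (auto intro: inj_on_subset)
  finally show ?case
    using step by (simp add: upt_conv_Cons del: upt_Suc)
qed

lemma bij_betw_permutes_permutations_of_set:
  "bij_betw (\<lambda>\<sigma>. map \<sigma> [1..<Suc n]) {\<sigma>. \<sigma> permutes {1..n}} (permutations_of_set {1..n})"
proof -
  have inj: "inj_on (\<lambda>\<sigma>. map \<sigma> [1..<Suc n]) {\<sigma>. \<sigma> permutes {1..n}}"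
  proof (rule inj_onI)
    fix \<sigma> \<tau> assume s: "\<sigma> \<in> {\<sigma>. \<sigma> permutes {1..n}}" "\<tau> \<in> {\<sigma>. \<sigma> permutes {1..n}}"
      and e: "map \<sigma> [1..<Suc n] = map \<tau> [1..<Suc n]"
    show "\<sigma> = \<tau>"
    proof
      fix i
      show "\<sigma> i = \<tau> i"
      proof (cases "i \<in> {1..n}")
        case True
        then have "i \<in> set [1..<Suc n]" by auto
        with e show ?thesis by (metis map_eq_conv)
      next
        case False
        with s show ?thesis by (simp add: permutes_not_in)
      qed
    qed
  qed
  have sub: "(\<lambda>\<sigma>. map \<sigma> [1..<Suc n]) ` {\<sigma>. \<sigma> permutes {1..n}} \<subseteq> permutations_of_set {1..n}"
  proof clarify
    fix \<sigma> assume s: "\<sigma> permutes {1..n}"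
    have u: "set [1..<Suc n] = {1..n}" by auto
    show "map \<sigma> [1..<Suc n] \<in> permutations_of_set {1..n}"
    proof (rule permutations_of_setI)
      show "set (map \<sigma> [1..<Suc n]) = {1..n}" unfolding set_map u by (rule permutes_image[OF s])
      show "distinct (map \<sigma> [1..<Suc n])"
        unfolding distinct_map u using permutes_inj_on[OF s] by simp
    qed
  qed
  have "card ((\<lambda>\<sigma>. map \<sigma> [1..<Suc n]) ` {\<sigma>. \<sigma> permutes {1..n}}) = card (permutations_of_set {1..n})"
    unfolding card_image[OF inj] by (subst card_permutations[OF refl]) simp_all
  with sub have "(\<lambda>\<sigma>. map \<sigma> [1..<Suc n]) ` {\<sigma>. \<sigma> permutes {1..n}} = permutations_of_set {1..n}"
    by (intro card_subset_eq) auto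
  with inj show ?thesis by (simp add: bij_betw_def)
qed

lemma sum_hl_term:
  "(\<Sum>\<sigma> | \<sigma> permutes {1..n}. hl_term A n lam (X \<circ> \<sigma>)) = perm_sum A lam 1 {1..n}"
proof -
  have "hl_term A n lam (X \<circ> \<sigma>) = f_prod A lam 1 (map \<sigma> [1..<Suc n]) * pair_prod (map \<sigma> [1..<Suc n])"
    if "\<sigma> permutes {1..n}" for \<sigma>
  proof -
    have "pairs n = pairs_from 1 n" by (simp add: pairs_def pairs_from_def)
    moreover have "(\<lambda>c. to_rat (Const [:c:])) = const_rat" by (rule ext) (simp add: const_rat_def)
    ultimately show ?thesis
      using f_prod_map_upt[of 1 n A lam \<sigma>] pair_prod_map_upt[OF permutes_inj[OF that], of 1 n]
      by (simp add: hl_term_def f_val_def del: upt_Suc)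
  qed
  then have "(\<Sum>\<sigma> | \<sigma> permutes {1..n}. hl_term A n lam (X \<circ> \<sigma>)) =
      (\<Sum>\<sigma> | \<sigma> permutes {1..n}. f_prod A lam 1 (map \<sigma> [1..<Suc n]) * pair_prod (map \<sigma> [1..<Suc n]))"
    by (intro sum.cong) auto
  also have "\<dots> = perm_sum A lam 1 {1..n}"
    unfolding perm_sum_def
    by (rule sum.reindex_bij_betw[OF bij_betw_permutes_permutations_of_set])
  finally show ?thesis .
qed

text \<open>Each step removes one component and one variable, so the number \<open>m\<close> of
  variables left for the trailing zeros is constant, and one factor 1 - T is gained. Keeping the
  product of the 1 - T^i on the left postpones the division.\<close>

lemma ev_tF_from:
  assumes row_bounded: "\<And>i. \<exists>N. \<forall>j<N. A i j = 0"
    and lower: "\<And>i j. i < 0 \<Longrightarrow> 0 \<le> j \<Longrightarrow> A i j = 0"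
    and pos: "\<And>i. i \<in> {1..l} \<Longrightarrow> 0 < lam i" and zero: "\<And>i. l < i \<Longrightarrow> lam i = 0"
    and "a \<le> Suc l" "1 \<le> a" "finite S" "card S = m + (Suc l - a)"
  shows "(\<Prod>i=1..m. 1 - T ^ i) * ev S (tF_from A a l lam) = (1 - T) ^ card S * perm_sum A lam a S"
  using assms(5-)
proof (induction arbitrary: S rule: inc_induct)
  case base
  then show ?case using perm_sum_zeros[of S "Suc l" lam A] zero by (simp add: tF_from_empty ev_one)
next
  case (step a)
  then have al: "a \<le> l" and ne: "S \<noteq> {}" by auto
  have k: "0 < lam a" using pos al step.prems by simp
  have IH: "(\<Prod>i=1..m. 1 - T ^ i) * ev (S - {s}) (tF_from A (Suc a) l lam) =
      (1 - T) ^ (card S - 1) * perm_sum A lam (Suc a) (S - {s})" if "s \<in> S" for s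
    using step.IH[of "S - {s}"] step.prems step.hyps that by simp
  have c: "Suc (card S - 1) = card S" using step.prems al by simp
  have "tF_from A (Suc a) l lam \<in> Lambda_t"
    using al by (intro Lambda_t_tF_from row_bounded) simp
  then have ev_t: "ev S (tGamma A (- lam a) (tF_from A (Suc a) l lam)) =
      (1 - T) * (\<Sum>s\<in>S. f_val A (lam a) s * hl_weight S s * ev (S - {s}) (tF_from A (Suc a) l lam))"
    by (intro ev_tGamma row_bounded lower step.prems(2) k)
  have "(\<Prod>i=1..m. 1 - T ^ i) * ev S (tF_from A a l lam) =
      (1 - T) * (\<Sum>s\<in>S. f_val A (lam a) s * hl_weight S s * ((\<Prod>i=1..m. 1 - T ^ i) * ev (S - {s}) (tF_from A (Suc a) l lam)))"
    unfolding tF_from_step[OF al] ev_t sum_distrib_left by (simp only: mult_ac)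
  also have "\<dots> = (1 - T) * (\<Sum>s\<in>S. f_val A (lam a) s * hl_weight S s * ((1 - T) ^ (card S - 1) * perm_sum A lam (Suc a) (S - {s})))"
    by (simp only: IH cong: sum.cong)
  also have "\<dots> = (1 - T) ^ Suc (card S - 1) * perm_sum A lam a S"
    unfolding perm_sum_rec[OF step.prems(2) ne] power_Suc sum_distrib_left by (simp only: mult_ac)
  finally show ?case unfolding c .
qed

text \<open>The finiteness clauses are part of the content: \<open>sum'\<close>, on which
  \<open>fps_fam_sum\<close> is built, returns 0 on an infinite support, so equations alone would
  not show that the sums are finite.\<close>

theorem theorem4p2:
  fixes A :: "int \<Rightarrow> int \<Rightarrow> complex" and l :: nat
  assumes "\<And>i. \<exists>N. \<forall>j<N. A i j = 0"
  shows
    "(\<forall>f\<in>range fps_of_poly. \<forall>i. finite {j. scalar (A i j) * hl_Gamma j f \<noteq> 0}) \<and>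
    (\<forall>lam\<in>Zvec l.
       tF A l lam \<in> range fps_of_poly \<and>
       finite {\<alpha>\<in>Zvec l. scalar (\<Prod>i=1..l. A (- lam i) (- \<alpha> i)) * hl_F l \<alpha> \<noteq> 0} \<and>
       tF A l lam = sum' (\<lambda>\<alpha>. scalar (\<Prod>i=1..l. A (- lam i) (- \<alpha> i)) * hl_F l \<alpha>) (Zvec l)) \<and>
    (\<forall>lam\<in>Zvec l. \<forall>n.
       symmetric_poly n (at_vars n (tF A l lam)) \<and>
       subst_vars (Var(Suc n := 0)) (at_vars (Suc n) (tF A l lam)) = at_vars n (tF A l lam)) \<and>
    (\<forall>B. left_inverse B A \<longrightarrow>
       (\<forall>\<alpha>\<in>Zvec l.
          has_coeff_sum (\<lambda>lam. scalar (\<Prod>i=1..l. B (- \<alpha> i) (- lam i)) * tF A l lam) (hl_F l \<alpha>) (Zvec l) \<and>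
          ((\<forall>i j. finite {k. B i k * A k j \<noteq> 0}) \<longrightarrow>
            (\<forall>n m. finite {lam\<in>Zvec l.
               coeff_at (scalar (\<Prod>i=1..l. B (- \<alpha> i) (- lam i)) * tF A l lam) n m \<noteq> 0})))) \<and>
    (\<forall>B. left_inverse B A \<longrightarrow>
       has_dist_sum l
         (\<lambda>lam \<alpha>. tF A l lam * scalar (dist_prod l (\<lambda>i. g_dist B (lam i)) \<alpha>)) (hl_F l) (Zvec l)) \<and>
    ((\<forall>i<0. \<forall>j\<ge>0. A i j = 0) \<and> (\<forall>j. A 0 j = (if j = 0 then 1 else 0)) \<longrightarrow>
       (\<forall>k>0. poly (f_poly A k) 0 = 0) \<and>
       (\<forall>lam\<in>Zvec l. \<forall>n\<ge>l. (\<forall>i\<in>{1..l}. lam i \<ge> 1) \<longrightarrow>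
          to_rat (at_vars n (tF A l lam)) =
            (1 - T) ^ n / (\<Prod>i=1..n - l. 1 - T ^ i) *
            (\<Sum>\<sigma> | \<sigma> permutes {1..n}. hl_term A n lam (X \<circ> \<sigma>))))"
proof (intro conjI allI impI ballI; (elim conjE)?)
  note row_bounded = assms
  show "finite {j. scalar (A i j) * hl_Gamma j f \<noteq> 0}" if "f \<in> range fps_of_poly" for f i
    using that finite_tGamma_support[OF row_bounded] by (simp add: Lambda_t_def)
  show "tF A l lam \<in> range fps_of_poly" for lam
    using Lambda_t_tF[OF row_bounded] by (simp add: Lambda_t_def)
  show "finite {\<alpha> \<in> Zvec l. scalar (\<Prod>i=1..l. A (- lam i) (- \<alpha> i)) * hl_F l \<alpha> \<noteq> 0}" for lam
    by (rule finite_tF_support[OF row_bounded])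
  show "tF A l lam = sum' (\<lambda>\<alpha>. scalar (\<Prod>i=1..l. A (- lam i) (- \<alpha> i)) * hl_F l \<alpha>) (Zvec l)" for lam
    by (rule tF_expansion[OF row_bounded])
  show "symmetric_poly n (at_vars n (tF A l lam))" for lam n
    by (rule symmetric_poly_at_vars)
  show "subst_vars (Var(Suc n := 0)) (at_vars (Suc n) (tF A l lam)) = at_vars n (tF A l lam)" for lam n
    by (rule at_vars_stable)
  show "has_coeff_sum (\<lambda>lam. scalar (\<Prod>i=1..l. B (- \<alpha> i) (- lam i)) * tF A l lam) (hl_F l \<alpha>) (Zvec l)"
    if "left_inverse B A" "\<alpha> \<in> Zvec l" for B \<alpha>
    by (rule has_coeff_sum_inverse[OF row_bounded that])
  show "finite {lam \<in> Zvec l. coeff_at (scalar (\<Prod>i=1..l. B (- \<alpha> i) (- lam i)) * tF A l lam) n m \<noteq> 0}"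
    if "\<forall>i j. finite {k. B i k * A k j \<noteq> 0}" for B \<alpha> n m
    by (rule finite_inverse_support[OF row_bounded]) (use that in blast)
  show "has_dist_sum l (\<lambda>lam \<alpha>. tF A l lam * scalar (dist_prod l (\<lambda>i. g_dist B (lam i)) \<alpha>)) (hl_F l) (Zvec l)"
    if "left_inverse B A" for B
    by (rule has_dist_sum_inverse[OF row_bounded that])
  assume lower: "\<forall>i<0. \<forall>j\<ge>0. A i j = 0"
  show "poly (f_poly A k) 0 = 0" if "0 < k" for k
    by (rule poly_f_poly_0[OF row_bounded]) (use lower that in auto)
  fix lam n
  assume lam: "lam \<in> Zvec l" "\<forall>i\<in>{1..l}. 1 \<le> lam i" and n: "l \<le> n"
  have "(\<Prod>i=1..n - l. 1 - T ^ i) * ev {1..n} (tF_from A 1 l lam) = (1 - T) ^ card {1..n} * perm_sum A lam 1 {1..n}"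
  proof (rule ev_tF_from[OF row_bounded])
    show "A i j = 0" if "i < 0" "0 \<le> j" for i j using lower that by blast
    show "0 < lam i" if "i \<in> {1..l}" for i using lam(2) that by fastforce
    show "lam i = 0" if "l < i" for i using lam(1) that by (simp add: Zvec_def)
  qed (use n in auto)
  \<comment> \<open>As t is an indeterminate, no positive power of it is 1, which allows the
    division postponed so far.\<close>
  moreover have "(\<Prod>i=1..n - l. 1 - T ^ i) \<noteq> 0"
  proof -
    have "1 - T ^ i \<noteq> 0" if "i \<in> {1..n - l}" for i using T_power_ne_1[of i] that by auto
    then show ?thesis by simp
  qed
  ultimately show "to_rat (at_vars n (tF A l lam)) =
      (1 - T) ^ n / (\<Prod>i=1..n - l. 1 - T ^ i) * (\<Sum>\<sigma> | \<sigma> permutes {1..n}. hl_term A n lam (X \<circ> \<sigma>))"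
    unfolding to_rat_at_vars[OF Lambda_t_tF[OF row_bounded]] unfolding tF_eq_tF_from sum_hl_term
    by (simp add: field_simps)
qed

end
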